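(* Let $\gamma>0$. (i) Assume that either $$\sigma>2,\quad \gamma>0,\quad \alpha\le-\frac{\sigma}{2}\quad\text{satisfy}\quad \gamma-\frac{1+\alpha}{\sigma-2}\ge1,$$ or otherwise that $$\sigma<2,\quad \gamma>0,\quad \alpha\ge-\frac{\sigma}{2}\quad\text{satisfy}\quad \gamma+\frac{1+\alpha}{2-\sigma}\ge1.$$ Then $$\operatorname{tr}(H_\sigma-V)_-^\gamma\le\left|\frac{2}{2-\sigma}\right|^{\frac{2\alpha+\sigma}{2-\sigma}}C_{\gamma,\frac{2\alpha+\sigma}{2-\sigma}}\int_{\mathbb{R}_+}V(r)_+^{\gamma+\frac{1+\alpha}{2-\sigma}}\,r^\alpha\,dr .$$ (ii) Let $\sigma=2$ and assume that either $\gamma\ge1/2$ and $\alpha=0$, or otherwise that $\gamma>0$ and $\alpha>0$ with $\gamma+\frac{1+\alpha}{2}\ge1+\alpha$. Then $$\operatorname{tr}(H_2-V)_-^\gamma\le C^{EK}_{\gamma,\alpha}\int_{\mathbb{R}_+}V(r)_+^{\gamma+\frac{1+\alpha}{2}}\,|\log r|^\alpha\,r^{-1}\,dr .$$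
   Context: $\mathbb{R}_+=(0,\infty)$ and $v_\pm=\max\{\pm v,0\}$. For a self-adjoint operator $A$ bounded below, $\operatorname{tr}(A)_-^\gamma$ is the trace of $(A_-)^\gamma$; when the negative spectrum of $A$ is discrete this is the sum of $|\lambda|^\gamma$ over the negative eigenvalues $\lambda$ of $A$, counted with multiplicity. For $\sigma\in\mathbb{R}$ let $$h_\sigma[u]:=\int_{\mathbb{R}_+}\left(r^\sigma|u'(r)|^2-\frac{(\sigma-1)^2|u(r)|^2}{4r^{2-\sigma}}\right)dr,$$ defined on $C_0^\infty(\mathbb{R}_+)$ (compact support in the open half-line) if $\sigma\le1$ and on $C_0^\infty(\overline{\mathbb{R}_+})$ (smooth on $[0,\infty)$ with bounded support) if $\sigma>1$. These forms are non-negative and closable in $L_2(\mathbb{R}_+)$, and $H_\sigma$ denotes the self-adjoint operator associated with the closure of $h_\sigma$. The potential $V:\mathbb{R}_+\to\mathbb{R}$ has $V_-\in L_{1,\mathrm{loc}}(\mathbb{R}_+)$ and is such that the integral on the right-hand side of the inequality under consideration is finite; $H_\sigma-V$ is defined in the sense of quadratic forms. Constants. $C_{\gamma,a}$ is the constant, independent of $W$, in the inequality $$\operatorname{tr}\left(-\frac{d^2}{dr^2}-\frac1{4r^2}-W\right)_-^\gamma\le C_{\gamma,a}\int_{\mathbb{R}_+}W(r)_+^{\gamma+\frac{1+a}2}r^a\,dr,$$ where the operator in $L_2(\mathbb{R}_+)$ is associated with the closure of $\int_{\mathbb{R}_+}\left(|u'|^2-\frac{|u|^2}{4r^2}-W|u|^2\right)dr$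 on $C_0^\infty(\mathbb{R}_+)$; the authors' main theorem establishes this inequality for $\gamma>0$, $a\in[0,1)$, $\gamma+\frac{1+a}2\ge1$. $C^{EK}_{\gamma,\alpha}$ is the constant, independent of $W$, in the inequality $$\operatorname{tr}_{L_2(\mathbb{R})}\left(-\frac{d^2}{dx^2}-W\right)_-^\gamma\le C^{EK}_{\gamma,\alpha}\int_{\mathbb{R}}W(x)_+^{\gamma+\frac{1+\alpha}2}|x|^\alpha\,dx ,$$ which for $\alpha=0$ is the Lieb--Thirring inequality (with $C^{EK}_{\gamma,0}=L_\gamma$ the Lieb--Thirring constant) and for $\alpha>0$ is the Egorov--Kondrat'ev inequality. *)

theory Defs
  imports "HOL-Analysis.Analysis"
begin

section \<open>The Hilbert space of square integrable functions\<close>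

text \<open>Elements are functions; equality in the Hilbert space is equality almost everywhere.
  The inner product is linear in the first argument.\<close>

definition L2 :: "'a measure \<Rightarrow> ('a \<Rightarrow> complex) set" where
  "L2 M = {u. u \<in> borel_measurable M \<and> integrable M (\<lambda>x. (cmod (u x))\<^sup>2)}"

definition L2_inner :: "'a measure \<Rightarrow> ('a \<Rightarrow> complex) \<Rightarrow> ('a \<Rightarrow> complex) \<Rightarrow> complex" where
  "L2_inner M u v = (\<integral>x. u x * cnj (v x) \<partial>M)"

definition L2_norm :: "'a measure \<Rightarrow> ('a \<Rightarrow> complex) \<Rightarrow> real" where
  "L2_norm M u = sqrt (\<integral>x. (cmod (u x))\<^sup>2 \<partial>M)"

definition orthonormal_basis :: "'a measure \<Rightarrow> ('a \<Rightarrow> complex) set \<Rightarrow> bool" where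
  "orthonormal_basis M B \<longleftrightarrow>
     B \<subseteq> L2 M \<and>
     (\<forall>e\<in>B. \<forall>e'\<in>B. L2_inner M e e' = (if e = e' then 1 else 0)) \<and>
     (\<forall>u\<in>L2 M. (\<forall>e\<in>B. L2_inner M u e = 0) \<longrightarrow> (AE x in M. u x = 0))"


section \<open>Trace of a power of the negative part\<close>

text \<open>An operator is given by its graph, a relation that is closed under changing
  functions on null sets.\<close>

type_synonym 'a operator = "(('a \<Rightarrow> complex) \<times> ('a \<Rightarrow> complex)) set"

definition spectral_dist ::
  "'a measure \<Rightarrow> (real set \<Rightarrow> ('a \<Rightarrow> complex) \<Rightarrow> ('a \<Rightarrow> complex)) \<Rightarrow> ('a \<Rightarrow> complex) \<Rightarrow> real measure"
where
  "spectral_dist M E u = measure_of UNIV (sets borel) (\<lambda>S. ennreal ((L2_norm M (E S u))\<^sup>2))"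

text \<open>\<open>E\<close> is the projection-valued measure of the self-adjoint operator \<open>A\<close>. The last two
  clauses say that \<open>A\<close> is the integral of \<open>t\<close> with respect to \<open>E\<close>: the domain consists
  of all \<open>u\<close> for which \<open>t\<^sup>2\<close> has finite integral with respect to the spectral distribution of \<open>u\<close>,
  and (by polarization) \<open>A\<close> is determined by its quadratic form on that domain.\<close>

definition spectral_resolution ::
  "'a measure \<Rightarrow> 'a operator \<Rightarrow> (real set \<Rightarrow> ('a \<Rightarrow> complex) \<Rightarrow> ('a \<Rightarrow> complex)) \<Rightarrow> bool"
where
  "spectral_resolution M A E \<longleftrightarrow>
     (\<forall>S\<in>sets borel. \<forall>u\<in>L2 M. E S u \<in> L2 M) \<and>
     (\<forall>S\<in>sets borel. \<forall>u\<in>L2 M. \<forall>v\<in>L2 M. L2_inner M (E S u) v = L2_inner M u (E S v)) \<and>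
     (\<forall>S\<in>sets borel. \<forall>T\<in>sets borel. \<forall>u\<in>L2 M. AE x in M. E S (E T u) x = E (S \<inter> T) u x) \<and>
     (\<forall>u\<in>L2 M. AE x in M. E UNIV u x = u x) \<and>
     (\<forall>F :: nat \<Rightarrow> real set. range F \<subseteq> sets borel \<and> disjoint_family F \<longrightarrow>
        (\<forall>u\<in>L2 M. \<forall>v\<in>L2 M.
           (\<lambda>n. L2_inner M (E (F n) u) v) sums L2_inner M (E (\<Union>n. F n) u) v)) \<and>
     Domain A = {u \<in> L2 M. (\<integral>\<^sup>+t. ennreal (t\<^sup>2) \<partial>spectral_dist M E u) < \<infinity>} \<and>
     (\<forall>(u, f)\<in>A. L2_inner M f u = complex_of_real (\<integral>t. t \<partial>spectral_dist M E u))"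

text \<open>\<open>neg_part_trace M A \<gamma>\<close> is the trace of \<open>(A\<^sub>-)\<^sup>\<gamma>\<close>, where the bounded operator \<open>(A\<^sub>-)\<^sup>\<gamma>\<close> is given
  by the functional calculus, i.e. has the quadratic form
  \<open>e \<mapsto> \<integral> max (-t) 0 powr \<gamma> d\<mu>\<^sub>e(t)\<close>. The spectral resolution of a self-adjoint operator
  exists and is unique up to null sets, and the trace of a non-negative operator does not depend
  on the orthonormal basis, so \<open>INF\<close> and \<open>SUP\<close> merely select the common value. If \<open>A\<close> is not
  self-adjoint, the value is \<open>\<infinity>\<close>; it is also \<open>\<infinity>\<close> if the negative spectrum is not discrete.\<close>

definition neg_part_trace :: "'a measure \<Rightarrow> 'a operator \<Rightarrow> real \<Rightarrow> ennreal" where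
  "neg_part_trace M A \<gamma> =
     (INF E\<in>{E. spectral_resolution M A E}. SUP B\<in>{B. orthonormal_basis M B}.
        \<integral>\<^sup>+e. (\<integral>\<^sup>+t. ennreal (max (- t) 0 powr \<gamma>) \<partial>spectral_dist M E e) \<partial>count_space B)"


section \<open>Quadratic forms\<close>

text \<open>A quadratic form is given by its domain and its sesquilinear form \<open>q\<close>; the quadratic form
  itself is \<open>u \<mapsto> q u u\<close>.\<close>

type_synonym 'a sesq = "('a \<Rightarrow> complex) \<Rightarrow> ('a \<Rightarrow> complex) \<Rightarrow> complex"

text \<open>Convergence in the Hilbert space together with the Cauchy property in the form. For a form
  that is bounded below this is convergence to \<open>u\<close> in the sense of form closures.\<close>

definition form_approx ::
  "'a measure \<Rightarrow> ('a \<Rightarrow> complex) set \<Rightarrow> 'a sesq \<Rightarrow> (nat \<Rightarrow> 'a \<Rightarrow> complex) \<Rightarrow> ('a \<Rightarrow> complex) \<Rightarrow> bool"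
where
  "form_approx M D q un u \<longleftrightarrow>
     (\<forall>n. un n \<in> D) \<and>
     (\<lambda>n. L2_norm M (\<lambda>x. un n x - u x)) \<longlonglongrightarrow> 0 \<and>
     (\<forall>\<epsilon>>0. \<exists>N. \<forall>m\<ge>N. \<forall>n\<ge>N.
        cmod (q (\<lambda>x. un m x - un n x) (\<lambda>x. un m x - un n x)) < \<epsilon>)"

definition closure_dom :: "'a measure \<Rightarrow> ('a \<Rightarrow> complex) set \<Rightarrow> 'a sesq \<Rightarrow> ('a \<Rightarrow> complex) set" where
  "closure_dom M D q = {u \<in> L2 M. \<exists>un. form_approx M D q un u}"

definition closure_form :: "'a measure \<Rightarrow> ('a \<Rightarrow> complex) set \<Rightarrow> 'a sesq \<Rightarrow> 'a sesq" where
  "closure_form M D q u v =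
     (THE c. \<forall>un vn. form_approx M D q un u \<longrightarrow> form_approx M D q vn v \<longrightarrow>
        (\<lambda>n. q (un n) (vn n)) \<longlonglongrightarrow> c)"

text \<open>The operator associated with a closed form (first representation theorem).\<close>

definition form_operator :: "'a measure \<Rightarrow> ('a \<Rightarrow> complex) set \<Rightarrow> 'a sesq \<Rightarrow> 'a operator" where
  "form_operator M D q = {(u, f). u \<in> D \<and> f \<in> L2 M \<and> (\<forall>v\<in>D. q u v = L2_inner M f v)}"

text \<open>The form sum of a closed form and the multiplication operator by \<open>-V\<close>.\<close>

definition minus_potential_dom ::
  "'a measure \<Rightarrow> ('a \<Rightarrow> complex) set \<Rightarrow> ('a \<Rightarrow> real) \<Rightarrow> ('a \<Rightarrow> complex) set" where
  "minus_potential_dom M D V = {u \<in> D. integrable M (\<lambda>x. \<bar>V x\<bar> * (cmod (u x))\<^sup>2)}"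

definition minus_potential_form :: "'a measure \<Rightarrow> 'a sesq \<Rightarrow> ('a \<Rightarrow> real) \<Rightarrow> 'a sesq" where
  "minus_potential_form M q V u v = q u v - (\<integral>x. complex_of_real (V x) * (u x * cnj (v x)) \<partial>M)"


section \<open>Test functions and potentials\<close>

text \<open>For \<open>S = {0<..}\<close>, \<open>S = {0..}\<close> and \<open>S = UNIV\<close> these are the smooth functions
  on \<open>S\<close> whose support is a compact subset of \<open>S\<close>; values outside \<open>S\<close> are irrelevant.
  At the endpoint of \<open>{0..}\<close> the derivatives are one-sided.\<close>

definition smooth_on :: "real set \<Rightarrow> (real \<Rightarrow> complex) \<Rightarrow> bool" where
  "smooth_on S u \<longleftrightarrow>
     (\<exists>D :: nat \<Rightarrow> real \<Rightarrow> complex. (\<forall>x\<in>S. D 0 x = u x) \<and>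
        (\<forall>n. \<forall>x\<in>S. (D n has_vector_derivative D (Suc n) x) (at x within S)))"

definition test_functions :: "real set \<Rightarrow> (real \<Rightarrow> complex) set" where
  "test_functions S =
     {u. smooth_on S u \<and> (\<exists>K. compact K \<and> K \<subseteq> S \<and> (\<forall>x\<in>S - K. u x = 0))}"

definition potential_on :: "real set \<Rightarrow> (real \<Rightarrow> real) \<Rightarrow> bool" where
  "potential_on S V \<longleftrightarrow>
     V \<in> borel_measurable (lebesgue_on S) \<and>
     (\<forall>K. compact K \<and> K \<subseteq> S \<longrightarrow> integrable (lebesgue_on K) (\<lambda>x. max (- V x) 0))"


section \<open>The operators\<close>

abbreviation halfline :: "real measure" where
  "halfline \<equiv> lebesgue_on {0<..}"

definition h_dom :: "real \<Rightarrow> (real \<Rightarrow> complex) set" where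
  "h_dom \<sigma> = (if \<sigma> \<le> 1 then test_functions {0<..} else test_functions {0..})"

definition h_form :: "real \<Rightarrow> real sesq" where
  "h_form \<sigma> u v =
     (\<integral>r. complex_of_real (r powr \<sigma>) *
            (vector_derivative u (at r) * cnj (vector_derivative v (at r)))
          - complex_of_real ((\<sigma> - 1)\<^sup>2 / (4 * r powr (2 - \<sigma>))) * (u r * cnj (v r)) \<partial>halfline)"

text \<open>\<open>H\<^sub>\<sigma> - V\<close> as a form sum.\<close>

definition H_minus :: "real \<Rightarrow> (real \<Rightarrow> real) \<Rightarrow> real operator" where
  "H_minus \<sigma> V =
     form_operator halfline
       (minus_potential_dom halfline (closure_dom halfline (h_dom \<sigma>) (h_form \<sigma>)) V)
       (minus_potential_form halfline (closure_form halfline (h_dom \<sigma>) (h_form \<sigma>)) V)"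

text \<open>\<open>- d\<^sup>2/dr\<^sup>2 - 1/(4 r\<^sup>2) - W\<close> on the half-line. Here the closure is taken of the full form,
  including the potential.\<close>

definition hardy_form :: "(real \<Rightarrow> real) \<Rightarrow> real sesq" where
  "hardy_form W u v =
     (\<integral>r. vector_derivative u (at r) * cnj (vector_derivative v (at r))
          - complex_of_real (1 / (4 * r\<^sup>2)) * (u r * cnj (v r))
          - complex_of_real (W r) * (u r * cnj (v r)) \<partial>halfline)"

definition hardy_minus :: "(real \<Rightarrow> real) \<Rightarrow> real operator" where
  "hardy_minus W =
     form_operator halfline
       (closure_dom halfline (test_functions {0<..}) (hardy_form W))
       (closure_form halfline (test_functions {0<..}) (hardy_form W))"

text \<open>\<open>- d\<^sup>2/dx\<^sup>2 - W\<close> on the whole line, as a form sum.\<close>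

definition laplace_form :: "real sesq" where
  "laplace_form u v =
     (\<integral>x. vector_derivative u (at x) * cnj (vector_derivative v (at x)) \<partial>lebesgue)"

definition line_minus :: "(real \<Rightarrow> real) \<Rightarrow> real operator" where
  "line_minus W =
     form_operator lebesgue
       (minus_potential_dom lebesgue (closure_dom lebesgue (test_functions UNIV) laplace_form) W)
       (minus_potential_form lebesgue (closure_form lebesgue (test_functions UNIV) laplace_form) W)"


section \<open>The constants\<close>

text \<open>\<open>C\<close> is admissible as the constant \<open>C\<^sub>\<gamma>\<^sub>,\<^sub>a\<close>, respectively \<open>C\<^sup>E\<^sup>K\<^sub>\<gamma>\<^sub>,\<^sub>\<alpha>\<close>, if the corresponding
  inequality holds with \<open>C\<close> for every potential \<open>W\<close>.\<close>

definition hardy_LT_constant :: "real \<Rightarrow> real \<Rightarrow> real \<Rightarrow> bool" where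
  "hardy_LT_constant \<gamma> a C \<longleftrightarrow>
     0 \<le> C \<and>
     (\<forall>W. potential_on {0<..} W \<longrightarrow>
        (\<integral>\<^sup>+r. ennreal (max (W r) 0 powr (\<gamma> + (1 + a) / 2) * r powr a) \<partial>halfline) < \<infinity> \<longrightarrow>
        neg_part_trace halfline (hardy_minus W) \<gamma>
          \<le> ennreal C *
            (\<integral>\<^sup>+r. ennreal (max (W r) 0 powr (\<gamma> + (1 + a) / 2) * r powr a) \<partial>halfline))"

definition EK_constant :: "real \<Rightarrow> real \<Rightarrow> real \<Rightarrow> bool" where
  "EK_constant \<gamma> \<alpha> C \<longleftrightarrow>
     0 \<le> C \<and>
     (\<forall>W. potential_on UNIV W \<longrightarrow>
        (\<integral>\<^sup>+x. ennreal (max (W x) 0 powr (\<gamma> + (1 + \<alpha>) / 2) * \<bar>x\<bar> powr \<alpha>) \<partial>lebesgue) < \<infinity> \<longrightarrow>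
        neg_part_trace lebesgue (line_minus W) \<gamma>
          \<le> ennreal C *
            (\<integral>\<^sup>+x. ennreal (max (W x) 0 powr (\<gamma> + (1 + \<alpha>) / 2) * \<bar>x\<bar> powr \<alpha>) \<partial>lebesgue))"

end

theory Submission
  imports Defs
begin

text \<open>In logarithmic coordinates all operators of the theorem become one family. Put
  \<open>u r = r powr (- \<kappa>) * g (ln r)\<close> with \<open>\<kappa> = (\<sigma> - 1) / 2\<close> and \<open>x = ln r\<close>. Then the integrand of \<open>h\<^sub>\<sigma>\<close>
  turns into \<open>\<bar>g'\<bar>\<^sup>2\<close> minus the total derivative of \<open>\<kappa> \<bar>g\<bar>\<^sup>2\<close>, which integrates to zero
  (\<open>h_integrand_transform\<close>, \<open>h_form_eq_laplace\<close>). So \<open>h\<^sub>\<sigma>\<close> is the kinetic energy on the line for every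
  \<open>\<sigma>\<close>, and \<open>\<sigma>\<close> survives only in the weight \<open>exp ((2 - \<sigma>) * x)\<close> of the Hilbert space. For \<open>\<sigma> = 2\<close>
  the weight is trivial and \<open>H\<^sub>2 - V\<close> is a Schroedinger operator on the line with potential
  \<open>V (exp x)\<close>. For \<open>\<sigma> \<noteq> 2\<close> an affine change of \<open>x\<close> turns the weight into \<open>exp (2 * y)\<close>,
  which is the weight of the case \<open>\<sigma> = 0\<close>, that is, of the Hardy operator
  \<open>- d\<^sup>2/dr\<^sup>2 - 1/(4 r\<^sup>2)\<close>. Hence \<open>H\<^sub>\<sigma> - V\<close> is unitarily equivalent to a Hardy operator with a
  potential \<open>W\<close>, the trace of the negative part is the same for both
  (\<open>neg_part_trace_transport\<close>), and the power of \<open>\<bar>2 / (2 - \<sigma>)\<bar>\<close> in the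
  inequality is the factor by which the integrals of \<open>V\<close> and \<open>W\<close> differ.

  Two points need analysis, because unitary equivalence of the operators requires equality of the
  closed forms. First, for \<open>\<sigma> > 1\<close> the form is defined on functions that need not vanish at \<open>0\<close>.
  In logarithmic coordinates these decay exponentially at \<open>- \<infinity>\<close>, and cutting them off shows that
  they have the same closure as the test functions on the line (\<open>laplace_closure_core\<close>).
  Second, \<open>H\<^sub>\<sigma> - V\<close> is a form sum, whereas the Hardy operator with potential comes from closing the
  form that includes the potential. Both agree (\<open>closure_eq_form_sum\<close>): the finite integral makes the
  positive part of the potential form bounded with relative bound \<open>1/2\<close>
  (\<open>potential_form_bound\<close>), and cut-offs approximate every function of finite total energy by test
  functions, with the absolute value of the potential as an additional weight
  (\<open>cutoff_approximant\<close>). In one dimension energy bounds give locally uniform convergence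
  (\<open>form_approx_locally_uniform\<close>), which replaces both the completeness of the Hilbert space and
  mollification.\<close>

section \<open>The space of square integrable functions\<close>

lemma L2_measurable: "u \<in> L2 M \<Longrightarrow> u \<in> borel_measurable M"
  by (simp add: L2_def)

lemma L2_integrable_square: "u \<in> L2 M \<Longrightarrow> integrable M (\<lambda>x. (cmod (u x))\<^sup>2)"
  by (simp add: L2_def)

lemma two_mult_le_squares: "2 * (a * b) \<le> a\<^sup>2 + b\<^sup>2" for a b :: real
  using sum_squares_bound[of a b] by simp

lemma mult_le_squares: "0 \<le> a \<Longrightarrow> 0 \<le> b \<Longrightarrow> a * b \<le> a\<^sup>2 + b\<^sup>2" for a b :: real
  using two_mult_le_squares[of a b] mult_nonneg_nonneg[of a b] by linarith

lemma L2_integrable_mult: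
  assumes "u \<in> L2 M" "v \<in> L2 M"
  shows "integrable M (\<lambda>x. u x * v x)"
proof (rule Bochner_Integration.integrable_bound)
  show "integrable M (\<lambda>x. (cmod (u x))\<^sup>2 + (cmod (v x))\<^sup>2)"
    using assms by (intro Bochner_Integration.integrable_add L2_integrable_square)
  show "(\<lambda>x. u x * v x) \<in> borel_measurable M"
    using assms[THEN L2_measurable] by measurable
  show "AE x in M. norm (u x * v x) \<le> norm ((cmod (u x))\<^sup>2 + (cmod (v x))\<^sup>2)"
    by (auto simp: norm_mult intro!: mult_le_squares)
qed

lemma L2_cnj: "u \<in> L2 M \<Longrightarrow> (\<lambda>x. cnj (u x)) \<in> L2 M"
  by (auto simp: L2_def intro: borel_measurable_continuous_on[OF continuous_on_cnj[OF continuous_on_id]])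

lemma L2_integrable_inner:
  assumes "u \<in> L2 M" "v \<in> L2 M"
  shows "integrable M (\<lambda>x. u x * cnj (v x))"
  using L2_integrable_mult[OF assms(1) L2_cnj[OF assms(2)]] .

lemma L2_bounded_mult:
  assumes "u \<in> L2 M" "h \<in> borel_measurable M" "\<And>x. x \<in> space M \<Longrightarrow> cmod (h x) \<le> C"
  shows "(\<lambda>x. h x * u x) \<in> L2 M"
proof -
  have m: "(\<lambda>x. h x * u x) \<in> borel_measurable M"
    using assms(2) L2_measurable[OF assms(1)] by measurable
  moreover have "integrable M (\<lambda>x. (cmod (h x * u x))\<^sup>2)"
  proof (rule Bochner_Integration.integrable_bound)
    show "integrable M (\<lambda>x. C\<^sup>2 * (cmod (u x))\<^sup>2)"
      using L2_integrable_square[OF assms(1)] by simp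
    show "(\<lambda>x. (cmod (h x * u x))\<^sup>2) \<in> borel_measurable M"
      using m by measurable
    show "AE x in M. norm ((cmod (h x * u x))\<^sup>2) \<le> norm (C\<^sup>2 * (cmod (u x))\<^sup>2)"
      using assms(3) by (auto simp: norm_mult power_mult_distrib intro!: mult_right_mono power_mono)
  qed
  ultimately show ?thesis by (simp add: L2_def)
qed

lemma L2_add:
  assumes "u \<in> L2 M" "v \<in> L2 M"
  shows "(\<lambda>x. u x + v x) \<in> L2 M"
proof -
  have m: "(\<lambda>x. u x + v x) \<in> borel_measurable M"
    using assms[THEN L2_measurable] by measurable
  moreover have "integrable M (\<lambda>x. (cmod (u x + v x))\<^sup>2)"
  proof (rule Bochner_Integration.integrable_bound)
    show "integrable M (\<lambda>x. 2 * (cmod (u x))\<^sup>2 + 2 * (cmod (v x))\<^sup>2)"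
      using assms[THEN L2_integrable_square] by simp
    show "(\<lambda>x. (cmod (u x + v x))\<^sup>2) \<in> borel_measurable M"
      using m by measurable
    have "(cmod (u x + v x))\<^sup>2 \<le> 2 * (cmod (u x))\<^sup>2 + 2 * (cmod (v x))\<^sup>2" for x
    proof -
      have "(cmod (u x + v x))\<^sup>2 \<le> (cmod (u x) + cmod (v x))\<^sup>2"
        by (intro power_mono norm_triangle_ineq) auto
      also have "\<dots> \<le> 2 * (cmod (u x))\<^sup>2 + 2 * (cmod (v x))\<^sup>2"
        using two_mult_le_squares[of "cmod (u x)" "cmod (v x)"] by (simp add: power2_sum)
      finally show ?thesis .
    qed
    then show "AE x in M. norm ((cmod (u x + v x))\<^sup>2) \<le> norm (2 * (cmod (u x))\<^sup>2 + 2 * (cmod (v x))\<^sup>2)"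
      by simp
  qed
  ultimately show ?thesis by (simp add: L2_def)
qed

lemma L2_scale:
  assumes "u \<in> L2 M"
  shows "(\<lambda>x. c * u x) \<in> L2 M"
  using L2_bounded_mult[OF assms, of "\<lambda>_. c" "cmod c"] by simp

lemma L2_uminus: "u \<in> L2 M \<Longrightarrow> (\<lambda>x. - u x) \<in> L2 M"
  using L2_scale[of u M "-1"] by simp

lemma L2_diff: "u \<in> L2 M \<Longrightarrow> v \<in> L2 M \<Longrightarrow> (\<lambda>x. u x - v x) \<in> L2 M"
  using L2_add[of u M "\<lambda>x. - v x"] L2_uminus[of v M] by simp

lemma L2_norm_nonneg [simp]: "0 \<le> L2_norm M u"
  by (simp add: L2_norm_def)

lemma L2_norm_square: "(L2_norm M u)\<^sup>2 = (\<integral>x. (cmod (u x))\<^sup>2 \<partial>M)"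
  by (simp add: L2_norm_def)

lemma L2_inner_self: "L2_inner M u u = complex_of_real ((L2_norm M u)\<^sup>2)"
proof -
  have "L2_inner M u u = (\<integral>x. complex_of_real ((cmod (u x))\<^sup>2) \<partial>M)"
    unfolding L2_inner_def by (simp only: complex_norm_square)
  then show ?thesis by (simp only: integral_complex_of_real L2_norm_square)
qed

lemma L2_norm_eq_sqrt_inner: "L2_norm M u = sqrt (Re (L2_inner M u u))"
  by (simp add: L2_inner_self)

lemma L2_norm_minus_commute: "L2_norm M (\<lambda>x. u x - v x) = L2_norm M (\<lambda>x. v x - u x)"
  by (simp add: L2_norm_def norm_minus_commute)

lemma L2_norm_eq_0_iff:
  assumes "u \<in> L2 M"
  shows "L2_norm M u = 0 \<longleftrightarrow> (AE x in M. u x = 0)"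
  using integral_nonneg_eq_0_iff_AE[OF L2_integrable_square[OF assms]]
  by (simp add: L2_norm_def)

lemma L2_inner_cong_AE:
  assumes "u \<in> borel_measurable M" "v \<in> borel_measurable M" "u' \<in> borel_measurable M" "v' \<in> borel_measurable M"
    "AE x in M. u x = u' x" "AE x in M. v x = v' x"
  shows "L2_inner M u v = L2_inner M u' v'"
proof -
  have [measurable]: "u \<in> borel_measurable M" "v \<in> borel_measurable M"
    "u' \<in> borel_measurable M" "v' \<in> borel_measurable M" using assms by auto
  have cm: "(\<lambda>x. cnj (f x)) \<in> borel_measurable M" if "f \<in> borel_measurable M" for f
    using borel_measurable_continuous_on[OF continuous_on_cnj[OF continuous_on_id] that] .
  have [measurable]: "(\<lambda>x. cnj (v x)) \<in> borel_measurable M" "(\<lambda>x. cnj (v' x)) \<in> borel_measurable M"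
    using cm assms by auto
  show ?thesis unfolding L2_inner_def
    using assms(5,6) by (intro integral_cong_AE) (auto)
qed

lemma L2_inner_cnj: "L2_inner M v u = cnj (L2_inner M u v)"
  unfolding L2_inner_def by (simp flip: Bochner_Integration.integral_cnj add: mult.commute)

lemma L2_inner_diff_left:
  assumes "u \<in> L2 M" "v \<in> L2 M" "w \<in> L2 M"
  shows "L2_inner M (\<lambda>x. u x - v x) w = L2_inner M u w - L2_inner M v w"
  unfolding L2_inner_def using assms
  by (simp add: left_diff_distrib L2_integrable_inner)

lemma L2_inner_diff_right:
  assumes "u \<in> L2 M" "v \<in> L2 M" "w \<in> L2 M"
  shows "L2_inner M w (\<lambda>x. u x - v x) = L2_inner M w u - L2_inner M w v"
  unfolding L2_inner_def using assms
  by (simp add: right_diff_distrib L2_integrable_inner)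

lemma L2_Cauchy_Schwarz_abs:
  assumes "u \<in> L2 M" "v \<in> L2 M"
  shows "(\<integral>x. cmod (u x) * cmod (v x) \<partial>M) \<le> L2_norm M u * L2_norm M v"
proof -
  have i: "integrable M (\<lambda>x. cmod (u x) * cmod (v x))"
    using integrable_norm[OF L2_integrable_mult[OF assms]] by (simp add: norm_mult)
  have [measurable]: "u \<in> borel_measurable M" "v \<in> borel_measurable M"
    using assms[THEN L2_measurable] by auto
  define I where "I = (\<integral>x. cmod (u x) * cmod (v x) \<partial>M)"
  have I0: "0 \<le> I" unfolding I_def by simp
  have sq: "(\<integral>\<^sup>+x. ennreal ((cmod (w x))\<^sup>2) \<partial>M) = ennreal ((L2_norm M w)\<^sup>2)" if "w \<in> L2 M" for w
    using nn_integral_eq_integral[OF L2_integrable_square[OF that]]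
    by (simp add: L2_norm_square)
  have "(\<integral>\<^sup>+x. ennreal (cmod (u x)) * ennreal (cmod (v x)) \<partial>M) = ennreal I"
    using nn_integral_eq_integral[OF i] by (simp add: I_def ennreal_mult)
  then have "ennreal (I\<^sup>2) \<le> ennreal ((L2_norm M u)\<^sup>2) * ennreal ((L2_norm M v)\<^sup>2)"
    using Cauchy_Schwarz_nn_integral[of "\<lambda>x. ennreal (cmod (u x))" M "\<lambda>x. ennreal (cmod (v x))"]
    by (simp add: sq[OF assms(1)] sq[OF assms(2)] ennreal_power I0)
  then have "I\<^sup>2 \<le> (L2_norm M u * L2_norm M v)\<^sup>2"
    by (simp add: ennreal_mult[symmetric] power_mult_distrib)
  then show ?thesis
    unfolding I_def[symmetric] by (rule power2_le_imp_le) simp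
qed

lemma L2_Cauchy_Schwarz:
  assumes "u \<in> L2 M" "v \<in> L2 M"
  shows "cmod (L2_inner M u v) \<le> L2_norm M u * L2_norm M v"
proof -
  have "cmod (L2_inner M u v) \<le> (\<integral>x. cmod (u x * cnj (v x)) \<partial>M)"
    unfolding L2_inner_def by (rule integral_norm_bound)
  then show ?thesis using L2_Cauchy_Schwarz_abs[OF assms] by (simp add: norm_mult)
qed

lemma L2_norm_triangle:
  assumes "u \<in> L2 M" "v \<in> L2 M"
  shows "L2_norm M (\<lambda>x. u x + v x) \<le> L2_norm M u + L2_norm M v"
proof (rule power2_le_imp_le)
  have i: "integrable M (\<lambda>x. cmod (u x) * cmod (v x))"
    using integrable_norm[OF L2_integrable_mult[OF assms]] by (simp add: norm_mult)
  note iu = L2_integrable_square[OF assms(1)] and iv = L2_integrable_square[OF assms(2)]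
  have "(L2_norm M (\<lambda>x. u x + v x))\<^sup>2 \<le>
      (\<integral>x. (cmod (u x))\<^sup>2 + (cmod (v x))\<^sup>2 + 2 * (cmod (u x) * cmod (v x)) \<partial>M)"
    unfolding L2_norm_square
  proof (rule integral_mono)
    show "integrable M (\<lambda>x. (cmod (u x + v x))\<^sup>2)"
      using L2_integrable_square[OF L2_add[OF assms]] .
    show "integrable M (\<lambda>x. (cmod (u x))\<^sup>2 + (cmod (v x))\<^sup>2 + 2 * (cmod (u x) * cmod (v x)))"
      using i iu iv by simp
    fix x
    have "(cmod (u x + v x))\<^sup>2 \<le> (cmod (u x) + cmod (v x))\<^sup>2"
      by (intro power_mono norm_triangle_ineq) auto
    then show "(cmod (u x + v x))\<^sup>2 \<le> (cmod (u x))\<^sup>2 + (cmod (v x))\<^sup>2 + 2 * (cmod (u x) * cmod (v x))"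
      by (simp add: power2_sum)
  qed
  also have "\<dots> = (L2_norm M u)\<^sup>2 + (L2_norm M v)\<^sup>2 + 2 * (\<integral>x. cmod (u x) * cmod (v x) \<partial>M)"
    using i iu iv by (simp add: L2_norm_square)
  also have "\<dots> \<le> (L2_norm M u + L2_norm M v)\<^sup>2"
    using L2_Cauchy_Schwarz_abs[OF assms] by (simp add: power2_sum)
  finally show "(L2_norm M (\<lambda>x. u x + v x))\<^sup>2 \<le> (L2_norm M u + L2_norm M v)\<^sup>2" .
qed simp

lemma L2_norm_triangle_diff:
  assumes "u \<in> L2 M" "v \<in> L2 M" "w \<in> L2 M"
  shows "L2_norm M (\<lambda>x. u x - w x) \<le> L2_norm M (\<lambda>x. u x - v x) + L2_norm M (\<lambda>x. v x - w x)"
  using L2_norm_triangle[OF L2_diff[OF assms(1,2)] L2_diff[OF assms(2,3)]] by simp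

lemma L2_norm_triangle_ineq4:
  assumes "u \<in> L2 M" "v \<in> L2 M"
  shows "L2_norm M (\<lambda>x. u x - v x) \<le> L2_norm M u + L2_norm M v"
  using L2_norm_triangle[OF assms(1) L2_uminus[OF assms(2)]] by (simp add: L2_norm_def)

lemma L2_norm_triangle_diff3:
  assumes "u \<in> L2 M" "v \<in> L2 M" "u' \<in> L2 M" "v' \<in> L2 M"
  shows "L2_norm M (\<lambda>x. u x - v x) \<le>
    L2_norm M (\<lambda>x. u x - u' x) + L2_norm M (\<lambda>x. u' x - v' x) + L2_norm M (\<lambda>x. v x - v' x)"
proof -
  have "L2_norm M (\<lambda>x. u x - v x) \<le> L2_norm M (\<lambda>x. u x - u' x) + L2_norm M (\<lambda>x. u' x - v x)"
    by (rule L2_norm_triangle_diff) (use assms in auto)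
  also have "L2_norm M (\<lambda>x. u' x - v x) \<le> L2_norm M (\<lambda>x. u' x - v' x) + L2_norm M (\<lambda>x. v' x - v x)"
    by (rule L2_norm_triangle_diff) (use assms in auto)
  finally show ?thesis by (simp add: L2_norm_minus_commute[of M v' v])
qed

lemma L2_norm_bound:
  assumes "u \<in> L2 M" "v \<in> L2 M"
  shows "L2_norm M u \<le> L2_norm M v + L2_norm M (\<lambda>x. u x - v x)"
  using L2_norm_triangle[OF assms(2) L2_diff[OF assms]] by simp

lemma L2_inner_diff_bound:
  assumes "u \<in> L2 M" "v \<in> L2 M" "u' \<in> L2 M" "v' \<in> L2 M"
  shows "cmod (L2_inner M u v - L2_inner M u' v') \<le>
    L2_norm M (\<lambda>x. u x - u' x) * L2_norm M v + L2_norm M u' * L2_norm M (\<lambda>x. v x - v' x)"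
proof -
  have "L2_inner M u v - L2_inner M u' v' =
      L2_inner M (\<lambda>x. u x - u' x) v + L2_inner M u' (\<lambda>x. v x - v' x)"
    using assms by (simp add: L2_inner_diff_left L2_inner_diff_right)
  also have "cmod \<dots> \<le> cmod (L2_inner M (\<lambda>x. u x - u' x) v) + cmod (L2_inner M u' (\<lambda>x. v x - v' x))"
    by (rule norm_triangle_ineq)
  also have "\<dots> \<le> L2_norm M (\<lambda>x. u x - u' x) * L2_norm M v + L2_norm M u' * L2_norm M (\<lambda>x. v x - v' x)"
    using assms by (intro add_mono L2_Cauchy_Schwarz L2_diff)
  finally show ?thesis .
qed

lemma L2_inner_tendsto:
  assumes un: "\<And>n. un n \<in> L2 M" and vn: "\<And>n. vn n \<in> L2 M" and u: "u \<in> L2 M" and v: "v \<in> L2 M"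
    and lu: "(\<lambda>n. L2_norm M (\<lambda>x. un n x - u x)) \<longlonglongrightarrow> 0"
    and lv: "(\<lambda>n. L2_norm M (\<lambda>x. vn n x - v x)) \<longlonglongrightarrow> 0"
  shows "(\<lambda>n. L2_inner M (un n) (vn n)) \<longlonglongrightarrow> L2_inner M u v"
proof -
  let ?b = "\<lambda>n. L2_norm M (\<lambda>x. un n x - u x) * (L2_norm M v + L2_norm M (\<lambda>x. vn n x - v x))
      + L2_norm M u * L2_norm M (\<lambda>x. vn n x - v x)"
  have "?b \<longlonglongrightarrow> 0 * (L2_norm M v + 0) + L2_norm M u * 0"
    by (rule tendsto_add[OF tendsto_mult[OF lu tendsto_add[OF tendsto_const lv]]
          tendsto_mult[OF tendsto_const lv]])
  then have lim: "?b \<longlonglongrightarrow> 0" by simp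
  have bnd: "norm (L2_inner M (un n) (vn n) - L2_inner M u v) \<le> ?b n" for n
  proof -
    have "cmod (L2_inner M (un n) (vn n) - L2_inner M u v) \<le>
      L2_norm M (\<lambda>x. un n x - u x) * L2_norm M (vn n) + L2_norm M u * L2_norm M (\<lambda>x. vn n x - v x)"
      by (rule L2_inner_diff_bound[OF un vn u v])
    also have "\<dots> \<le> ?b n"
      by (intro add_mono mult_left_mono L2_norm_bound vn v) auto
    finally show ?thesis by simp
  qed
  have "(\<lambda>n. L2_inner M (un n) (vn n) - L2_inner M u v) \<longlonglongrightarrow> 0"
    by (rule Lim_null_comparison[OF always_eventually lim]) (use bnd in blast)
  then show ?thesis by (simp add: LIM_zero_iff)
qed

lemma L2_norm_tendsto_0I:
  assumes "(\<lambda>n. \<integral>x. (cmod (un n x))\<^sup>2 \<partial>M) \<longlonglongrightarrow> 0"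
  shows "(\<lambda>n. L2_norm M (un n)) \<longlonglongrightarrow> 0"
  using tendsto_real_sqrt[OF assms] by (simp add: L2_norm_def)

section \<open>Unitary equivalence\<close>

text \<open>The two maps act on functions, and they are inverse to each other only up to null sets; so
  both are part of the data.\<close>

locale L2_iso =
  fixes M :: "'a measure" and N :: "'b measure"
    and G :: "('a \<Rightarrow> complex) \<Rightarrow> ('b \<Rightarrow> complex)" and H :: "('b \<Rightarrow> complex) \<Rightarrow> ('a \<Rightarrow> complex)"
  assumes G_L2: "u \<in> L2 M \<Longrightarrow> G u \<in> L2 N"
    and H_L2: "g \<in> L2 N \<Longrightarrow> H g \<in> L2 M"
    and G_inner: "u \<in> L2 M \<Longrightarrow> v \<in> L2 M \<Longrightarrow> L2_inner N (G u) (G v) = L2_inner M u v"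
    and H_inner: "g \<in> L2 N \<Longrightarrow> h \<in> L2 N \<Longrightarrow> L2_inner M (H g) (H h) = L2_inner N g h"
    and HG: "u \<in> L2 M \<Longrightarrow> AE x in M. H (G u) x = u x"
    and GH: "g \<in> L2 N \<Longrightarrow> AE y in N. G (H g) y = g y"
    and G_diff: "G (\<lambda>x. u x - v x) = (\<lambda>y. G u y - G v y)"
    and H_diff: "H (\<lambda>y. g y - h y) = (\<lambda>x. H g x - H h x)"
begin

lemma L2_iso_sym: "L2_iso N M H G"
  by unfold_locales (use G_L2 H_L2 G_inner H_inner HG GH G_diff H_diff in auto)

lemma G_norm: "u \<in> L2 M \<Longrightarrow> L2_norm N (G u) = L2_norm M u"
  by (simp add: L2_norm_eq_sqrt_inner G_inner)

lemma H_norm: "g \<in> L2 N \<Longrightarrow> L2_norm M (H g) = L2_norm N g"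
  by (simp add: L2_norm_eq_sqrt_inner H_inner)

lemma G_norm_diff:
  "u \<in> L2 M \<Longrightarrow> v \<in> L2 M \<Longrightarrow> L2_norm N (\<lambda>y. G u y - G v y) = L2_norm M (\<lambda>x. u x - v x)"
  using G_norm[OF L2_diff[of u M v]] by (simp add: G_diff)

lemma H_cong_AE:
  assumes "g \<in> L2 N" "h \<in> L2 N" "AE y in N. g y = h y"
  shows "AE x in M. H g x = H h x"
proof -
  have d: "(\<lambda>y. g y - h y) \<in> L2 N" using assms by (intro L2_diff)
  have "L2_norm M (H (\<lambda>y. g y - h y)) = 0"
    unfolding H_norm[OF d] L2_norm_eq_0_iff[OF d] using assms(3) by auto
  then have "AE x in M. H (\<lambda>y. g y - h y) x = 0"
    using L2_norm_eq_0_iff[OF H_L2[OF d]] by simp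
  then show ?thesis by (simp add: H_diff)
qed

lemma H_adjoint:
  assumes "g \<in> L2 N" "u \<in> L2 M"
  shows "L2_inner M (H g) u = L2_inner N g (G u)"
proof -
  have "L2_inner N g (G u) = L2_inner M (H g) (H (G u))"
    using assms by (simp add: H_inner G_L2)
  also have "\<dots> = L2_inner M (H g) u"
    using assms HG[OF assms(2)] by (intro L2_inner_cong_AE) (auto intro!: L2_measurable H_L2 G_L2)
  finally show ?thesis by simp
qed

end

lemma spectral_resolutionD:
  assumes "spectral_resolution M A E"
  shows spectral_resolution_L2: "S \<in> sets borel \<Longrightarrow> u \<in> L2 M \<Longrightarrow> E S u \<in> L2 M"
    and spectral_resolution_adjoint: "S \<in> sets borel \<Longrightarrow> u \<in> L2 M \<Longrightarrow> v \<in> L2 M \<Longrightarrow>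
      L2_inner M (E S u) v = L2_inner M u (E S v)"
    and spectral_resolution_mult: "S \<in> sets borel \<Longrightarrow> T \<in> sets borel \<Longrightarrow> u \<in> L2 M \<Longrightarrow>
      AE x in M. E S (E T u) x = E (S \<inter> T) u x"
    and spectral_resolution_UNIV: "u \<in> L2 M \<Longrightarrow> AE x in M. E UNIV u x = u x"
    and spectral_resolution_sums: "range F \<subseteq> sets borel \<Longrightarrow> disjoint_family F \<Longrightarrow>
      u \<in> L2 M \<Longrightarrow> v \<in> L2 M \<Longrightarrow>
      (\<lambda>n::nat. L2_inner M (E (F n) u) v) sums L2_inner M (E (\<Union>n. F n) u) v"
    and spectral_resolution_Domain:
      "Domain A = {u \<in> L2 M. (\<integral>\<^sup>+t. ennreal (t\<^sup>2) \<partial>spectral_dist M E u) < \<infinity>}"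
    and spectral_resolution_form:
      "(u, f) \<in> A \<Longrightarrow> L2_inner M f u = complex_of_real (\<integral>t. t \<partial>spectral_dist M E u)"
proof -
  note * = assms[unfolded spectral_resolution_def]
  note r = *[THEN conjunct2]
  note r2 = r[THEN conjunct2]
  note r3 = r2[THEN conjunct2]
  note r4 = r3[THEN conjunct2]
  note r5 = r4[THEN conjunct2]
  show "S \<in> sets borel \<Longrightarrow> u \<in> L2 M \<Longrightarrow> E S u \<in> L2 M"
    using *[THEN conjunct1] by blast
  show "S \<in> sets borel \<Longrightarrow> u \<in> L2 M \<Longrightarrow> v \<in> L2 M \<Longrightarrow>
      L2_inner M (E S u) v = L2_inner M u (E S v)"
    using r[THEN conjunct1] by blast
  show "S \<in> sets borel \<Longrightarrow> T \<in> sets borel \<Longrightarrow> u \<in> L2 M \<Longrightarrow>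
      AE x in M. E S (E T u) x = E (S \<inter> T) u x"
    using r2[THEN conjunct1] by blast
  show "u \<in> L2 M \<Longrightarrow> AE x in M. E UNIV u x = u x"
    using r3[THEN conjunct1] by blast
  show "range F \<subseteq> sets borel \<Longrightarrow> disjoint_family F \<Longrightarrow> u \<in> L2 M \<Longrightarrow> v \<in> L2 M \<Longrightarrow>
      (\<lambda>n::nat. L2_inner M (E (F n) u) v) sums L2_inner M (E (\<Union>n. F n) u) v"
    using r4[THEN conjunct1] by blast
  show "Domain A = {u \<in> L2 M. (\<integral>\<^sup>+t. ennreal (t\<^sup>2) \<partial>spectral_dist M E u) < \<infinity>}"
    using r5[THEN conjunct1] .
  show "(u, f) \<in> A \<Longrightarrow> L2_inner M f u = complex_of_real (\<integral>t. t \<partial>spectral_dist M E u)"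
    using r5[THEN conjunct2] by blast
qed

text \<open>The members of a projection-valued measure act on functions, and nothing in the definition
  makes them respect equality almost everywhere. Self-adjointness does: if \<open>u\<close> and \<open>v\<close> agree almost
  everywhere, then \<open>E S u\<close> and \<open>E S v\<close> have the same inner products with all vectors.\<close>

lemma spectral_resolution_cong_AE:
  assumes E: "spectral_resolution M A E" and S: "S \<in> sets borel"
    and u: "u \<in> L2 M" "v \<in> L2 M" "AE x in M. u x = v x"
  shows "AE x in M. E S u x = E S v x"
proof -
  note L = spectral_resolution_L2[OF E S] and adj = spectral_resolution_adjoint[OF E S]
  define d where "d = (\<lambda>x. E S u x - E S v x)"
  have d: "d \<in> L2 M" unfolding d_def using u L by (intro L2_diff) auto
  have "L2_inner M d d = L2_inner M (E S u) d - L2_inner M (E S v) d"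
    using L2_inner_diff_left[OF L[OF u(1)] L[OF u(2)] d] by (simp add: d_def)
  also have "\<dots> = L2_inner M u (E S d) - L2_inner M v (E S d)"
    using u d by (simp add: adj)
  also have "\<dots> = 0"
    using L2_inner_cong_AE[of u M "E S d" v "E S d"] u L[OF d] by (simp add: L2_measurable)
  finally have "L2_norm M d = 0" by (simp add: L2_inner_self)
  then show ?thesis using L2_norm_eq_0_iff[OF d] by (simp add: d_def)
qed

definition pullback_operator ::
  "'a measure \<Rightarrow> (('a \<Rightarrow> complex) \<Rightarrow> ('b \<Rightarrow> complex)) \<Rightarrow> 'a operator \<Rightarrow> 'b operator \<Rightarrow> bool"
where
  "pullback_operator M G A' A \<longleftrightarrow>
     (\<forall>u f. (u, f) \<in> A' \<longleftrightarrow> u \<in> L2 M \<and> f \<in> L2 M \<and> (G u, G f) \<in> A)"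

text \<open>Graphs are transported along maps whose composition is the identity only almost everywhere,
  so the graph has to contain with a pair all its modifications of the second component on null sets.\<close>

definition AE_closed_operator :: "'a measure \<Rightarrow> 'a operator \<Rightarrow> bool" where
  "AE_closed_operator M A \<longleftrightarrow> (\<forall>(u, f)\<in>A. u \<in> L2 M \<and> f \<in> L2 M \<and>
     (\<forall>f'\<in>L2 M. (AE x in M. f x = f' x) \<longrightarrow> (u, f') \<in> A))"

lemma AE_closed_operatorD:
  "AE_closed_operator M A \<Longrightarrow> (u, f) \<in> A \<Longrightarrow> f' \<in> L2 M \<Longrightarrow> AE x in M. f x = f' x \<Longrightarrow> (u, f') \<in> A"
  unfolding AE_closed_operator_def by blast

context L2_iso
begin

lemma spectral_dist_transport:
  assumes L: "\<And>S g. S \<in> sets borel \<Longrightarrow> g \<in> L2 N \<Longrightarrow> E S g \<in> L2 N" and u: "u \<in> L2 M"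
  shows "spectral_dist M (\<lambda>S u. H (E S (G u))) u = spectral_dist N E (G u)"
  unfolding spectral_dist_def
proof (rule measure_of_eq)
  fix X :: "real set" assume "X \<in> sigma_sets UNIV (sets borel)"
  then have "X \<in> sets borel"
    using sets.sigma_sets_eq[of "borel :: real measure"] by simp
  then show "ennreal ((L2_norm M (H (E X (G u))))\<^sup>2) = ennreal ((L2_norm N (E X (G u)))\<^sup>2)"
    using L u by (simp add: H_norm G_L2)
qed simp

text \<open>Conjugation by the unitary map. Multiplicativity is the clause that is not a computation:
  between the two projections stands \<open>G \<circ> H\<close>, which is the identity only almost everywhere.\<close>

lemma spectral_resolution_transport:
  assumes E: "spectral_resolution N A E" and pb: "pullback_operator M G A' A"
    and cl: "AE_closed_operator N A"
  shows "spectral_resolution M A' (\<lambda>S u. H (E S (G u)))"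
proof -
  note L = spectral_resolution_L2[OF E] and adj = spectral_resolution_adjoint[OF E]
    and mult = spectral_resolution_mult[OF E] and one = spectral_resolution_UNIV[OF E]
    and add = spectral_resolution_sums[OF E] and dom = spectral_resolution_Domain[OF E]
    and val = spectral_resolution_form[OF E]
  note sd = spectral_dist_transport[of E, OF L]
  show ?thesis
    unfolding spectral_resolution_def
  proof (intro conjI ballI allI impI)
    fix S :: "real set" and u assume "S \<in> sets borel" "u \<in> L2 M"
    then show "H (E S (G u)) \<in> L2 M" by (intro H_L2 L G_L2)
  next
    fix S :: "real set" and u v assume *: "S \<in> sets borel" "u \<in> L2 M" "v \<in> L2 M"
    have "L2_inner M (H (E S (G u))) v = L2_inner N (G u) (E S (G v))"
      using * by (simp add: H_adjoint L G_L2 adj)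
    also have "\<dots> = cnj (L2_inner M (H (E S (G v))) u)"
      using * by (simp add: H_adjoint L G_L2 L2_inner_cnj[of N _ "G u"])
    finally show "L2_inner M (H (E S (G u))) v = L2_inner M u (H (E S (G v)))"
      by (simp add: L2_inner_cnj[of M u])
  next
    fix S T :: "real set" and u assume *: "S \<in> sets borel" "T \<in> sets borel" "u \<in> L2 M"
    have t: "E T (G u) \<in> L2 N" using * by (intro L G_L2)
    have t': "G (H (E T (G u))) \<in> L2 N" using t by (intro G_L2 H_L2)
    have "AE y in N. E S (G (H (E T (G u)))) y = E (S \<inter> T) (G u) y"
      using spectral_resolution_cong_AE[OF E *(1) t' t GH[OF t]] mult[OF *(1,2) G_L2[OF *(3)]]
      by eventually_elim simp
    then show "AE x in M. H (E S (G (H (E T (G u))))) x = H (E (S \<inter> T) (G u)) x"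
      using * t t' by (intro H_cong_AE L) (auto intro: G_L2)
  next
    fix u assume *: "u \<in> L2 M"
    have "AE x in M. H (E UNIV (G u)) x = H (G u) x"
      using * by (intro H_cong_AE L G_L2 one) auto
    then show "AE x in M. H (E UNIV (G u)) x = u x"
      using HG[OF *] by eventually_elim simp
  next
    fix F :: "nat \<Rightarrow> real set" and u v
    assume F: "range F \<subseteq> sets borel \<and> disjoint_family F" and uv: "u \<in> L2 M" "v \<in> L2 M"
    have b: "F n \<in> sets borel" for n using F by auto
    have "(\<Union>n. F n) \<in> sets borel" using b by auto
    then show "(\<lambda>n. L2_inner M (H (E (F n) (G u))) v) sums L2_inner M (H (E (\<Union>n. F n) (G u))) v"
      using add[of F "G u" "G v"] F uv b by (simp add: H_adjoint L G_L2)
  next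
    show "Domain A' = {u \<in> L2 M. (\<integral>\<^sup>+t. ennreal (t\<^sup>2) \<partial>spectral_dist M (\<lambda>S u. H (E S (G u))) u) < \<infinity>}"
    proof (intro set_eqI iffI)
      fix u assume "u \<in> Domain A'"
      then obtain f where "u \<in> L2 M" "(G u, G f) \<in> A"
        using pb by (auto simp: pullback_operator_def)
      then have "u \<in> L2 M" "G u \<in> Domain A" by auto
      then show "u \<in> {u \<in> L2 M. (\<integral>\<^sup>+t. ennreal (t\<^sup>2) \<partial>spectral_dist M (\<lambda>S u. H (E S (G u))) u) < \<infinity>}"
        using dom by (simp add: sd)
    next
      fix u assume "u \<in> {u \<in> L2 M. (\<integral>\<^sup>+t. ennreal (t\<^sup>2) \<partial>spectral_dist M (\<lambda>S u. H (E S (G u))) u) < \<infinity>}"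
      then have u: "u \<in> L2 M" and "G u \<in> Domain A"
        using dom by (auto simp: sd G_L2)
      then obtain f where f: "(G u, f) \<in> A" by auto
      then have fL: "f \<in> L2 N" using cl by (auto simp: AE_closed_operator_def)
      have "(G u, G (H f)) \<in> A"
        using AE_closed_operatorD[OF cl f G_L2[OF H_L2[OF fL]]] GH[OF fL] by (simp add: eq_commute)
      then have "(u, H f) \<in> A'"
        using pb u H_L2[OF fL] by (simp add: pullback_operator_def)
      then show "u \<in> Domain A'" by auto
    qed
  next
    fix p assume "p \<in> A'"
    then obtain u f where p: "p = (u, f)" and uf: "u \<in> L2 M" "f \<in> L2 M" "(G u, G f) \<in> A"
      using pb by (cases p) (auto simp: pullback_operator_def)
    show "case p of (u, f) \<Rightarrow> L2_inner M f u =
        complex_of_real (\<integral>t. t \<partial>spectral_dist M (\<lambda>S u. H (E S (G u))) u)"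
      using val[OF uf(3)] uf(1,2) by (simp add: p sd G_inner)
  qed
qed

lemma orthonormal_basis_image:
  assumes B: "orthonormal_basis M B"
  shows "orthonormal_basis N (G ` B)" "inj_on G B"
proof -
  have BL: "B \<subseteq> L2 M" and on: "\<And>e e'. e \<in> B \<Longrightarrow> e' \<in> B \<Longrightarrow> L2_inner M e e' = (if e = e' then 1 else 0)"
    and comp: "\<And>u. u \<in> L2 M \<Longrightarrow> (\<And>e. e \<in> B \<Longrightarrow> L2_inner M u e = 0) \<Longrightarrow> AE x in M. u x = 0"
    using B unfolding orthonormal_basis_def by simp_all
  have inG: "L2_inner N (G e) (G e') = (if e = e' then 1 else 0)" if "e \<in> B" "e' \<in> B" for e e'
    using that BL on by (simp add: G_inner subset_iff)
  show inj: "inj_on G B"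
  proof (rule inj_onI)
    fix e e' assume *: "e \<in> B" "e' \<in> B" "G e = G e'"
    then have "L2_inner N (G e) (G e') = 1" using inG[of e' e'] by simp
    then show "e = e'" using inG[of e e'] * by (simp split: if_splits)
  qed
  have comp': "AE y in N. g y = 0" if g: "g \<in> L2 N" "\<And>e. e \<in> B \<Longrightarrow> L2_inner N g (G e) = 0" for g
  proof -
    have "AE x in M. H g x = 0"
      using g BL by (intro comp H_L2) (auto simp: H_adjoint)
    then have "L2_norm N g = 0"
      using L2_norm_eq_0_iff[OF H_L2[OF g(1)]] by (simp add: H_norm g)
    then show ?thesis using L2_norm_eq_0_iff[OF g(1)] by simp
  qed
  show "orthonormal_basis N (G ` B)"
    unfolding orthonormal_basis_def
  proof (intro conjI ballI impI)
    show "G ` B \<subseteq> L2 N" using BL G_L2 by auto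
    fix e e' assume "e \<in> G ` B" "e' \<in> G ` B"
    then obtain f f' where f: "f \<in> B" "f' \<in> B" "e = G f" "e' = G f'" by blast
    show "L2_inner N e e' = (if e = e' then 1 else 0)"
      using inG[OF f(1,2)] inj_on_eq_iff[OF inj f(1,2)] by (simp add: f(3,4))
  next
    fix g assume "g \<in> L2 N" "\<forall>e\<in>G ` B. L2_inner N g e = 0"
    then show "AE y in N. g y = 0" by (intro comp') auto
  qed
qed

text \<open>Every resolution of \<open>A\<close> conjugates to one of \<open>A'\<close>, which bounds the infimum, and the image of
  a basis is a basis on which the integrals do not change, which bounds the supremum. The reverse
  inequality is the same statement for the inverse map.\<close>

theorem neg_part_trace_transport:
  assumes pb: "pullback_operator M G A' A" and cl: "AE_closed_operator N A"
  shows "neg_part_trace M A' \<gamma> \<le> neg_part_trace N A \<gamma>"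
  unfolding neg_part_trace_def
proof (rule INF_greatest)
  fix E assume "E \<in> {E. spectral_resolution N A E}"
  then have E: "spectral_resolution N A E" by simp
  note L = spectral_resolution_L2[OF E]
  let ?E = "\<lambda>S u. H (E S (G u))"
  let ?t = "\<lambda>t::real. ennreal (max (- t) 0 powr \<gamma>)"
  have "(INF E\<in>{E. spectral_resolution M A' E}. SUP B\<in>{B. orthonormal_basis M B}.
        \<integral>\<^sup>+e. (\<integral>\<^sup>+t. ?t t \<partial>spectral_dist M E e) \<partial>count_space B) \<le>
      (SUP B\<in>{B. orthonormal_basis M B}.
        \<integral>\<^sup>+e. (\<integral>\<^sup>+t. ?t t \<partial>spectral_dist M ?E e) \<partial>count_space B)"
    by (rule INF_lower) (simp add: spectral_resolution_transport[OF E pb cl])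
  also have "\<dots> \<le> (SUP B\<in>{B. orthonormal_basis N B}.
        \<integral>\<^sup>+e. (\<integral>\<^sup>+t. ?t t \<partial>spectral_dist N E e) \<partial>count_space B)"
  proof (rule SUP_least)
    fix B assume "B \<in> {B. orthonormal_basis M B}"
    then have B: "orthonormal_basis M B" by simp
    then have BL: "B \<subseteq> L2 M" by (simp add: orthonormal_basis_def)
    note GB = orthonormal_basis_image[OF B]
    have "(\<integral>\<^sup>+e. (\<integral>\<^sup>+t. ?t t \<partial>spectral_dist M ?E e) \<partial>count_space B) =
        (\<integral>\<^sup>+e. (\<integral>\<^sup>+t. ?t t \<partial>spectral_dist N E (G e)) \<partial>count_space B)"
      using BL by (intro nn_integral_cong) (auto simp: spectral_dist_transport[of E, OF L] subset_iff)
    also have "\<dots> = (\<integral>\<^sup>+e. (\<integral>\<^sup>+t. ?t t \<partial>spectral_dist N E e) \<partial>count_space (G ` B))"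
      using GB(2) by (intro nn_integral_bij_count_space) (rule inj_on_imp_bij_betw)
    also have "\<dots> \<le> (SUP B\<in>{B. orthonormal_basis N B}.
        \<integral>\<^sup>+e. (\<integral>\<^sup>+t. ?t t \<partial>spectral_dist N E e) \<partial>count_space B)"
      using GB(1) by (intro SUP_upper) simp
    finally show "(\<integral>\<^sup>+e. (\<integral>\<^sup>+t. ?t t \<partial>spectral_dist M ?E e) \<partial>count_space B) \<le>
      (SUP B\<in>{B. orthonormal_basis N B}.
        \<integral>\<^sup>+e. (\<integral>\<^sup>+t. ?t t \<partial>spectral_dist N E e) \<partial>count_space B)" .
  qed
  finally show "(INF E\<in>{E. spectral_resolution M A' E}. SUP B\<in>{B. orthonormal_basis M B}.
        \<integral>\<^sup>+e. (\<integral>\<^sup>+t. ?t t \<partial>spectral_dist M E e) \<partial>count_space B) \<le>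
     (SUP B\<in>{B. orthonormal_basis N B}.
        \<integral>\<^sup>+e. (\<integral>\<^sup>+t. ?t t \<partial>spectral_dist N E e) \<partial>count_space B)" .
qed

end

section \<open>Operators associated with forms\<close>

lemma form_operator_AE_closed:
  assumes "D \<subseteq> L2 M"
  shows "AE_closed_operator M (form_operator M D q)"
  unfolding AE_closed_operator_def
proof (safe)
  fix u f assume "(u, f) \<in> form_operator M D q"
  then have *: "u \<in> D" "f \<in> L2 M" "\<And>v. v \<in> D \<Longrightarrow> q u v = L2_inner M f v"
    by (auto simp: form_operator_def)
  show "u \<in> L2 M" "f \<in> L2 M" using * assms by auto
  fix f' assume f': "f' \<in> L2 M" "AE x in M. f x = f' x"
  have "L2_inner M f v = L2_inner M f' v" if "v \<in> D" for v
    using that f' * assms by (intro L2_inner_cong_AE) (auto intro: L2_measurable)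
  then show "(u, f') \<in> form_operator M D q"
    using * f' by (auto simp: form_operator_def)
qed

context L2_iso
begin

text \<open>Testing with all \<open>g\<close> in the form domain on \<open>N\<close> is testing with all \<open>G v\<close>: here \<open>G (H g) = g\<close> has
  to hold everywhere, since the form \<open>q\<close> need not respect null sets.\<close>

lemma form_operator_pullback:
  assumes GH_eq: "\<And>g. G (H g) = g" and DL: "D \<subseteq> L2 N"
    and D': "D' = {u \<in> L2 M. G u \<in> D}"
    and q: "\<And>u v. u \<in> D' \<Longrightarrow> v \<in> D' \<Longrightarrow> q' u v = q (G u) (G v)"
  shows "pullback_operator M G (form_operator M D' q') (form_operator N D q)"
    and "pullback_operator N H (form_operator N D q) (form_operator M D' q')"
proof -
  have HD: "H g \<in> D'" if "g \<in> D" for g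
    using that DL H_L2 by (auto simp: D' GH_eq)
  have iff: "(u, f) \<in> form_operator M D' q' \<longleftrightarrow>
      u \<in> L2 M \<and> f \<in> L2 M \<and> (G u, G f) \<in> form_operator N D q" for u f
  proof
    assume "(u, f) \<in> form_operator M D' q'"
    then have u: "u \<in> D'" and f: "f \<in> L2 M" and v: "\<And>v. v \<in> D' \<Longrightarrow> q' u v = L2_inner M f v"
      by (auto simp: form_operator_def)
    have "q (G u) g = L2_inner N (G f) g" if "g \<in> D" for g
    proof -
      have "H g \<in> L2 M" using HD[OF that] D' by simp
      then show ?thesis
        using v[OF HD[OF that]] q[OF u HD[OF that]] G_inner[OF f, of "H g"] by (simp add: GH_eq)
    qed
    then show "u \<in> L2 M \<and> f \<in> L2 M \<and> (G u, G f) \<in> form_operator N D q"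
      using u f by (auto simp: form_operator_def D' G_L2)
  next
    assume *: "u \<in> L2 M \<and> f \<in> L2 M \<and> (G u, G f) \<in> form_operator N D q"
    then have u: "u \<in> D'" and f: "f \<in> L2 M" and g: "\<And>g. g \<in> D \<Longrightarrow> q (G u) g = L2_inner N (G f) g"
      by (auto simp: form_operator_def D')
    have "q' u v = L2_inner M f v" if v: "v \<in> D'" for v
      using q[OF u v] g[of "G v"] v f by (simp add: D' G_inner)
    then show "(u, f) \<in> form_operator M D' q'"
      using u f by (simp add: form_operator_def)
  qed
  then show "pullback_operator M G (form_operator M D' q') (form_operator N D q)"
    by (simp add: pullback_operator_def)
  have "(g, k) \<in> form_operator N D q \<longleftrightarrow>
      g \<in> L2 N \<and> k \<in> L2 N \<and> (H g, H k) \<in> form_operator M D' q'" for g k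
    using iff[of "H g" "H k"] DL by (auto simp: GH_eq H_L2 form_operator_def)
  then show "pullback_operator N H (form_operator N D q) (form_operator M D' q')"
    by (simp add: pullback_operator_def)
qed

lemma form_operator_neg_part_trace:
  assumes GH_eq: "\<And>g. G (H g) = g" and DL: "D \<subseteq> L2 N"
    and D': "D' = {u \<in> L2 M. G u \<in> D}"
    and q: "\<And>u v. u \<in> D' \<Longrightarrow> v \<in> D' \<Longrightarrow> q' u v = q (G u) (G v)"
  shows "neg_part_trace M (form_operator M D' q') \<gamma> = neg_part_trace N (form_operator N D q) \<gamma>"
proof (rule antisym)
  have D'L: "D' \<subseteq> L2 M" by (auto simp: D')
  show "neg_part_trace M (form_operator M D' q') \<gamma> \<le> neg_part_trace N (form_operator N D q) \<gamma>"
    by (rule neg_part_trace_transport[OF form_operator_pullback(1)[where q=q and q'=q', OF assms] form_operator_AE_closed[OF DL]])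
  interpret sym: L2_iso N M H G by (rule L2_iso_sym)
  show "neg_part_trace N (form_operator N D q) \<gamma> \<le> neg_part_trace M (form_operator M D' q') \<gamma>"
    by (rule sym.neg_part_trace_transport[OF form_operator_pullback(2)[where q=q and q'=q', OF assms] form_operator_AE_closed[OF D'L]])
qed

end

section \<open>Closures of forms\<close>

context L2_iso
begin

lemma form_approx_transport:
  assumes DL: "D \<subseteq> L2 M" and q: "\<And>u v. u \<in> D \<Longrightarrow> v \<in> D \<Longrightarrow>
      q (\<lambda>x. u x - v x) (\<lambda>x. u x - v x) = q' (\<lambda>y. G u y - G v y) (\<lambda>y. G u y - G v y)"
    and u: "u \<in> L2 M" and un: "\<And>n. un n \<in> D"
  shows "form_approx M D q un u \<longleftrightarrow> form_approx N (G ` D) q' (\<lambda>n. G (un n)) (G u)"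
  unfolding form_approx_def using un DL u by (simp add: q G_norm_diff subset_iff)

text \<open>The closure of a form sees only norms of differences and values of the form along sequences in
  its domain, and all of these are the same on both sides.\<close>

lemma closure_transport:
  assumes DL: "D \<subseteq> L2 M" and qd: "\<And>u v. u \<in> D \<Longrightarrow> v \<in> D \<Longrightarrow>
      q (\<lambda>x. u x - v x) (\<lambda>x. u x - v x) = q' (\<lambda>y. G u y - G v y) (\<lambda>y. G u y - G v y)"
    and q: "\<And>u v. u \<in> D \<Longrightarrow> v \<in> D \<Longrightarrow> q u v = q' (G u) (G v)"
  shows "closure_dom M D q = {u \<in> L2 M. G u \<in> closure_dom N (G ` D) q'}"
    and "u \<in> L2 M \<Longrightarrow> v \<in> L2 M \<Longrightarrow>
      closure_form M D q u v = closure_form N (G ` D) q' (G u) (G v)"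
proof -
  have fa: "form_approx M D q un u \<longleftrightarrow> form_approx N (G ` D) q' (\<lambda>n. G (un n)) (G u)"
    if "u \<in> L2 M" "\<And>n. un n \<in> D" for un u
    by (rule form_approx_transport[OF DL _ that]) (rule qd)
  have lift: "\<exists>un. (\<forall>n. un n \<in> D) \<and> gn = (\<lambda>n. G (un n))" if "form_approx N (G ` D) q' gn g" for gn g
  proof -
    have "\<forall>n. \<exists>u. u \<in> D \<and> gn n = G u" using that by (auto simp: form_approx_def)
    then obtain un where "\<forall>n. un n \<in> D \<and> gn n = G (un n)" by metis
    then show ?thesis by auto
  qed
  have inD: "\<And>n. un n \<in> D" if "form_approx M D q un u" for un u
    using that by (auto simp: form_approx_def)
  show "closure_dom M D q = {u \<in> L2 M. G u \<in> closure_dom N (G ` D) q'}"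
  proof (intro set_eqI iffI)
    fix u assume "u \<in> closure_dom M D q"
    then obtain un where u: "u \<in> L2 M" and un: "form_approx M D q un u"
      by (auto simp: closure_dom_def)
    have "form_approx N (G ` D) q' (\<lambda>n. G (un n)) (G u)"
      using fa[OF u inD[OF un]] un by simp
    then have "G u \<in> closure_dom N (G ` D) q'"
      unfolding closure_dom_def using G_L2[OF u] by blast
    then show "u \<in> {u \<in> L2 M. G u \<in> closure_dom N (G ` D) q'}" using u by simp
  next
    fix u assume "u \<in> {u \<in> L2 M. G u \<in> closure_dom N (G ` D) q'}"
    then obtain gn where u: "u \<in> L2 M" and gn: "form_approx N (G ` D) q' gn (G u)"
      by (auto simp: closure_dom_def)
    from lift[OF gn] obtain un where un: "\<And>n. un n \<in> D" "gn = (\<lambda>n. G (un n))" by blast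
    have "form_approx M D q un u"
      using fa[OF u un(1)] gn by (simp add: un(2))
    then show "u \<in> closure_dom M D q"
      unfolding closure_dom_def using u by blast
  qed
  assume u: "u \<in> L2 M" and v: "v \<in> L2 M"
  have "(\<forall>un vn. form_approx M D q un u \<longrightarrow> form_approx M D q vn v \<longrightarrow>
        (\<lambda>n. q (un n) (vn n)) \<longlonglongrightarrow> c) \<longleftrightarrow>
      (\<forall>gn hn. form_approx N (G ` D) q' gn (G u) \<longrightarrow> form_approx N (G ` D) q' hn (G v) \<longrightarrow>
        (\<lambda>n. q' (gn n) (hn n)) \<longlonglongrightarrow> c)" (is "?L = ?R") for c
  proof
    assume L: ?L
    show ?R
    proof (intro allI impI)
      fix gn hn
      assume g: "form_approx N (G ` D) q' gn (G u)" and h: "form_approx N (G ` D) q' hn (G v)"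
      from lift[OF g] lift[OF h] obtain un vn
        where un: "\<And>n. un n \<in> D" "gn = (\<lambda>n. G (un n))" and vn: "\<And>n. vn n \<in> D" "hn = (\<lambda>n. G (vn n))"
        by blast
      have "form_approx M D q un u" "form_approx M D q vn v"
        using g h fa[OF u un(1)] fa[OF v vn(1)] by (simp_all add: un(2) vn(2))
      then have "(\<lambda>n. q (un n) (vn n)) \<longlonglongrightarrow> c"
        using L by blast
      then show "(\<lambda>n. q' (gn n) (hn n)) \<longlonglongrightarrow> c"
        using un vn by (simp add: q)
    qed
  next
    assume R: ?R
    show ?L
    proof (intro allI impI)
      fix un vn
      assume a: "form_approx M D q un u" and b: "form_approx M D q vn v"
      note iD = inD[OF a] inD[OF b]
      have "(\<lambda>n. q' (G (un n)) (G (vn n))) \<longlonglongrightarrow> c"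
        using R[rule_format, of "\<lambda>n. G (un n)" "\<lambda>n. G (vn n)"]
          fa[OF u iD(1)] fa[OF v iD(2)] a b by simp
      then show "(\<lambda>n. q (un n) (vn n)) \<longlonglongrightarrow> c"
        using iD by (simp add: q)
    qed
  qed
  then show "closure_form M D q u v = closure_form N (G ` D) q' (G u) (G v)"
    unfolding closure_form_def by simp
qed

end

section \<open>Cores and closability\<close>

text \<open>A kinetic energy is \<open>q u v = \<langle>d u, d v\<rangle>\<close> for a derivative \<open>d\<close>. Cauchy sequences for \<open>q\<close> are then
  those for which \<open>d (un n)\<close> is a Cauchy sequence, and the Cauchy-Schwarz inequality controls \<open>q\<close>.\<close>

locale square_form =
  fixes M :: "'a measure" and K :: "'b measure" and D :: "('a \<Rightarrow> complex) set"
    and d :: "('a \<Rightarrow> complex) \<Rightarrow> ('b \<Rightarrow> complex)" and q :: "'a sesq"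
  assumes D_L2: "D \<subseteq> L2 M" and d_L2: "u \<in> D \<Longrightarrow> d u \<in> L2 K"
    and d_diff: "u \<in> D \<Longrightarrow> v \<in> D \<Longrightarrow> d (\<lambda>x. u x - v x) = (\<lambda>y. d u y - d v y)"
    and q_eq: "q u v = L2_inner K (d u) (d v)"
begin

lemma form_approx_iff:
  "form_approx M D q un u \<longleftrightarrow> (\<forall>n. un n \<in> D) \<and> (\<lambda>n. L2_norm M (\<lambda>x. un n x - u x)) \<longlonglongrightarrow> 0 \<and>
     (\<forall>\<epsilon>>0. \<exists>N. \<forall>m\<ge>N. \<forall>n\<ge>N. L2_norm K (\<lambda>y. d (un m) y - d (un n) y) < \<epsilon>)"
proof (cases "\<forall>n. un n \<in> D")
  case True
  have q': "cmod (q (\<lambda>x. un m x - un n x) (\<lambda>x. un m x - un n x)) =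
      (L2_norm K (\<lambda>y. d (un m) y - d (un n) y))\<^sup>2" for m n
    using True by (simp add: q_eq L2_inner_self d_diff del: of_real_power)
  have sq: "x\<^sup>2 < e \<longleftrightarrow> x < sqrt e" if "0 \<le> x" for x e :: real
    using real_sqrt_less_iff[of "x\<^sup>2" e] that by simp
  have "(\<forall>\<epsilon>>0. \<exists>N. \<forall>m\<ge>N. \<forall>n\<ge>N. f m n < sqrt \<epsilon>) \<longleftrightarrow>
      (\<forall>\<epsilon>>0. \<exists>N. \<forall>m\<ge>N. \<forall>n\<ge>N. f m n < \<epsilon>)" (is "?L \<longleftrightarrow> ?R") for f :: "nat \<Rightarrow> nat \<Rightarrow> real"
  proof
    assume L: ?L
    show ?R
    proof (intro allI impI)
      fix e :: real assume "0 < e"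
      then have "0 < e\<^sup>2" "sqrt (e\<^sup>2) = e" by simp_all
      then show "\<exists>N. \<forall>m\<ge>N. \<forall>n\<ge>N. f m n < e" using L[rule_format, of "e\<^sup>2"] by simp
    qed
  qed simp
  then show ?thesis unfolding form_approx_def q' by (simp add: sq)
qed (auto simp: form_approx_def)

lemma form_approxD:
  assumes "form_approx M D q un u"
  shows "un n \<in> D" "(\<lambda>n. L2_norm M (\<lambda>x. un n x - u x)) \<longlonglongrightarrow> 0"
    "0 < \<epsilon> \<Longrightarrow> \<exists>N. \<forall>m\<ge>N. \<forall>n\<ge>N. L2_norm K (\<lambda>y. d (un m) y - d (un n) y) < \<epsilon>"
  using assms by (simp_all add: form_approx_iff)

lemma form_approx_bounded:
  assumes "form_approx M D q un u"
  obtains B where "0 \<le> B" "\<And>n. L2_norm K (d (un n)) \<le> B"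
proof -
  note * = form_approxD[OF assms]
  obtain N where N: "\<And>m n. m \<ge> N \<Longrightarrow> n \<ge> N \<Longrightarrow> L2_norm K (\<lambda>y. d (un m) y - d (un n) y) < 1"
    using *(3)[of 1] by auto
  define B where "B = (\<Sum>n\<le>N. L2_norm K (d (un n))) + 1"
  have le: "L2_norm K (d (un n)) \<le> (\<Sum>n\<le>N. L2_norm K (d (un n)))" if "n \<le> N" for n
    using that by (intro member_le_sum) auto
  have "L2_norm K (d (un n)) \<le> B" for n
  proof (cases "n \<le> N")
    case True
    then show ?thesis using le[of n] by (simp add: B_def)
  next
    case False
    have "L2_norm K (d (un n)) \<le> L2_norm K (d (un N)) + L2_norm K (\<lambda>y. d (un n) y - d (un N) y)"
      by (intro L2_norm_bound d_L2 *)
    then show ?thesis using N[of n N] False le[of N] by (simp add: B_def)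
  qed
  moreover have "0 \<le> B" by (simp add: B_def sum_nonneg)
  ultimately show ?thesis using that by blast
qed

lemma form_diff_tendsto_0:
  assumes un: "\<And>n. un n \<in> D" and vn: "\<And>n. vn n \<in> D" and wn: "\<And>n. wn n \<in> D" and zn: "\<And>n. zn n \<in> D"
    and B: "\<And>n. L2_norm K (d (vn n)) \<le> B" "\<And>n. L2_norm K (d (wn n)) \<le> C"
    and l1: "(\<lambda>n. L2_norm K (\<lambda>y. d (un n) y - d (wn n) y)) \<longlonglongrightarrow> 0"
    and l2: "(\<lambda>n. L2_norm K (\<lambda>y. d (vn n) y - d (zn n) y)) \<longlonglongrightarrow> 0"
  shows "(\<lambda>n. q (un n) (vn n) - q (wn n) (zn n)) \<longlonglongrightarrow> 0"
proof (rule Lim_null_comparison[OF always_eventually])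
  show "(\<lambda>n. L2_norm K (\<lambda>y. d (un n) y - d (wn n) y) * B + C * L2_norm K (\<lambda>y. d (vn n) y - d (zn n) y)) \<longlonglongrightarrow> 0"
    using tendsto_add[OF tendsto_mult[OF l1 tendsto_const[of B]] tendsto_mult[OF tendsto_const[of C] l2]] by simp
  show "\<forall>n. norm (q (un n) (vn n) - q (wn n) (zn n)) \<le>
      L2_norm K (\<lambda>y. d (un n) y - d (wn n) y) * B + C * L2_norm K (\<lambda>y. d (vn n) y - d (zn n) y)"
  proof
    fix n
    have "norm (q (un n) (vn n) - q (wn n) (zn n)) \<le>
        L2_norm K (\<lambda>y. d (un n) y - d (wn n) y) * L2_norm K (d (vn n)) +
        L2_norm K (d (wn n)) * L2_norm K (\<lambda>y. d (vn n) y - d (zn n) y)"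
      unfolding q_eq by (intro L2_inner_diff_bound d_L2 un vn wn zn)
    also have "\<dots> \<le> L2_norm K (\<lambda>y. d (un n) y - d (wn n) y) * B + C * L2_norm K (\<lambda>y. d (vn n) y - d (zn n) y)"
      by (intro add_mono mult_left_mono mult_right_mono B) auto
    finally show "norm (q (un n) (vn n) - q (wn n) (zn n)) \<le>
      L2_norm K (\<lambda>y. d (un n) y - d (wn n) y) * B + C * L2_norm K (\<lambda>y. d (vn n) y - d (zn n) y)" .
  qed
qed

lemma form_approx_convergent:
  assumes a: "form_approx M D q un u" and b: "form_approx M D q vn v"
  shows "\<exists>c. (\<lambda>n. q (un n) (vn n)) \<longlonglongrightarrow> c"
proof -
  note u = form_approxD[OF a] and v = form_approxD[OF b]
  obtain A where A: "0 \<le> A" "\<And>n. L2_norm K (d (un n)) \<le> A" using form_approx_bounded[OF a] by blast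
  obtain B where B: "0 \<le> B" "\<And>n. L2_norm K (d (vn n)) \<le> B" using form_approx_bounded[OF b] by blast
  have "Cauchy (\<lambda>n. q (un n) (vn n))"
  proof (rule metric_CauchyI)
    fix e :: real assume e: "0 < e"
    define e' where "e' = e / (A + B + 1)"
    have e': "0 < e'" using e A B by (simp add: e'_def)
    obtain N1 where N1: "\<And>m n. m \<ge> N1 \<Longrightarrow> n \<ge> N1 \<Longrightarrow> L2_norm K (\<lambda>y. d (un m) y - d (un n) y) < e'"
      using u(3)[OF e'] by auto
    obtain N2 where N2: "\<And>m n. m \<ge> N2 \<Longrightarrow> n \<ge> N2 \<Longrightarrow> L2_norm K (\<lambda>y. d (vn m) y - d (vn n) y) < e'"
      using v(3)[OF e'] by auto
    have "dist (q (un m) (vn m)) (q (un n) (vn n)) < e" if mn: "m \<ge> max N1 N2" "n \<ge> max N1 N2" for m n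
    proof -
      have "dist (q (un m) (vn m)) (q (un n) (vn n)) \<le>
          L2_norm K (\<lambda>y. d (un m) y - d (un n) y) * L2_norm K (d (vn m)) +
          L2_norm K (d (un n)) * L2_norm K (\<lambda>y. d (vn m) y - d (vn n) y)"
        unfolding q_eq dist_norm by (intro L2_inner_diff_bound d_L2 u(1) v(1))
      also have "\<dots> \<le> e' * B + A * e'"
        using mn N1[of m n] N2[of m n] e' A B by (intro add_mono mult_mono) auto
      also have "\<dots> < e' * (A + B + 1)" using e' by (simp add: algebra_simps)
      also have "\<dots> = e" using A B by (simp add: e'_def)
      finally show ?thesis .
    qed
    then show "\<exists>N. \<forall>m\<ge>N. \<forall>n\<ge>N. dist (q (un m) (vn m)) (q (un n) (vn n)) < e" by blast
  qed
  then show ?thesis by (simp add: Cauchy_convergent_iff convergent_def)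
qed

text \<open>The limit exists because the form values are a Cauchy sequence of complex numbers. Closability
  makes it independent of the approximating sequences, so that the definite description in
  \<open>closure_form\<close> denotes it.\<close>

lemma closure_form_limit:
  assumes cl: "\<And>wn. form_approx M D q wn (\<lambda>_. 0) \<Longrightarrow> (\<lambda>n. L2_norm K (d (wn n))) \<longlonglongrightarrow> 0"
    and Dd: "\<And>u v. u \<in> D \<Longrightarrow> v \<in> D \<Longrightarrow> (\<lambda>x. u x - v x) \<in> D"
    and u: "u \<in> L2 M" and v: "v \<in> L2 M"
    and a: "form_approx M D q un u" and b: "form_approx M D q vn v"
  shows "(\<lambda>n. q (un n) (vn n)) \<longlonglongrightarrow> closure_form M D q u v"
proof -
  have null: "(\<lambda>n. L2_norm K (\<lambda>y. d (wn n) y - d (zn n) y)) \<longlonglongrightarrow> 0"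
    if w: "form_approx M D q wn w" and z: "form_approx M D q zn w" and wL: "w \<in> L2 M" for wn zn w
  proof -
    note W = form_approxD[OF w] and Z = form_approxD[OF z]
    have L: "\<And>n. wn n \<in> L2 M" "\<And>n. zn n \<in> L2 M" using W(1) Z(1) D_L2 by auto
    have "form_approx M D q (\<lambda>n x. wn n x - zn n x) (\<lambda>_. 0)"
      unfolding form_approx_iff
    proof (intro conjI allI impI)
      show "(\<lambda>x. wn n x - zn n x) \<in> D" for n by (intro Dd W Z)
      have "(\<lambda>n. L2_norm M (\<lambda>x. wn n x - zn n x)) \<longlonglongrightarrow> 0"
      proof (rule Lim_null_comparison[OF always_eventually])
        show "(\<lambda>n. L2_norm M (\<lambda>x. wn n x - w x) + L2_norm M (\<lambda>x. zn n x - w x)) \<longlonglongrightarrow> 0"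
          using tendsto_add[OF W(2) Z(2)] by simp
        show "\<forall>n. norm (L2_norm M (\<lambda>x. wn n x - zn n x)) \<le>
            L2_norm M (\<lambda>x. wn n x - w x) + L2_norm M (\<lambda>x. zn n x - w x)"
        proof
          fix n
          show "norm (L2_norm M (\<lambda>x. wn n x - zn n x)) \<le>
            L2_norm M (\<lambda>x. wn n x - w x) + L2_norm M (\<lambda>x. zn n x - w x)"
            using L2_norm_triangle_diff[OF L(1)[of n] wL L(2)[of n]] L2_norm_minus_commute[of M w "zn n"]
            by simp
        qed
      qed
      then show "(\<lambda>n. L2_norm M (\<lambda>x. wn n x - zn n x - 0)) \<longlonglongrightarrow> 0" by simp
      fix e :: real assume "0 < e"
      then have e: "0 < e / 2" by simp
      obtain N1 where N1: "\<And>m n. m \<ge> N1 \<Longrightarrow> n \<ge> N1 \<Longrightarrow> L2_norm K (\<lambda>y. d (wn m) y - d (wn n) y) < e / 2"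
        using W(3)[OF e] by auto
      obtain N2 where N2: "\<And>m n. m \<ge> N2 \<Longrightarrow> n \<ge> N2 \<Longrightarrow> L2_norm K (\<lambda>y. d (zn m) y - d (zn n) y) < e / 2"
        using Z(3)[OF e] by auto
      have "L2_norm K (\<lambda>y. d (\<lambda>x. wn m x - zn m x) y - d (\<lambda>x. wn n x - zn n x) y) < e"
        if mn: "m \<ge> max N1 N2" "n \<ge> max N1 N2" for m n
      proof -
        have "L2_norm K (\<lambda>y. d (\<lambda>x. wn m x - zn m x) y - d (\<lambda>x. wn n x - zn n x) y) =
            L2_norm K (\<lambda>y. (d (wn m) y - d (wn n) y) - (d (zn m) y - d (zn n) y))"
          using W(1) Z(1) by (simp add: d_diff algebra_simps)
        also have "\<dots> \<le> L2_norm K (\<lambda>y. d (wn m) y - d (wn n) y) + L2_norm K (\<lambda>y. d (zn m) y - d (zn n) y)"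
          by (intro L2_norm_triangle_ineq4 L2_diff d_L2 W Z)
        also have "\<dots> < e" using N1[of m n] N2[of m n] mn by auto
        finally show ?thesis .
      qed
      then show "\<exists>N. \<forall>m\<ge>N. \<forall>n\<ge>N. L2_norm K (\<lambda>y. d (\<lambda>x. wn m x - zn m x) y - d (\<lambda>x. wn n x - zn n x) y) < e"
        by blast
    qed
    from cl[OF this] show ?thesis using W(1) Z(1) by (simp add: d_diff)
  qed
  obtain c where c: "(\<lambda>n. q (un n) (vn n)) \<longlonglongrightarrow> c"
    using form_approx_convergent[OF a b] by blast
  have all: "(\<lambda>n. q (wn n) (zn n)) \<longlonglongrightarrow> c"
    if w: "form_approx M D q wn u" and z: "form_approx M D q zn v" for wn zn
  proof -
    note W = form_approxD[OF w] and Z = form_approxD[OF z]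
    obtain B where B: "0 \<le> B" "\<And>n. L2_norm K (d (vn n)) \<le> B" using form_approx_bounded[OF b] by blast
    obtain C where C: "0 \<le> C" "\<And>n. L2_norm K (d (wn n)) \<le> C" using form_approx_bounded[OF w] by blast
    have "(\<lambda>n. q (un n) (vn n) - q (wn n) (zn n)) \<longlonglongrightarrow> 0"
      by (rule form_diff_tendsto_0[OF form_approxD(1)[OF a] form_approxD(1)[OF b] W(1) Z(1) B(2) C(2)
            null[OF a w u] null[OF b z v]])
    from tendsto_diff[OF c this] show ?thesis by simp
  qed
  have "closure_form M D q u v = c"
    unfolding closure_form_def
  proof (rule the_equality)
    show "\<forall>un vn. form_approx M D q un u \<longrightarrow> form_approx M D q vn v \<longrightarrow> (\<lambda>n. q (un n) (vn n)) \<longlonglongrightarrow> c"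
      using all by blast
    fix c' assume "\<forall>un vn. form_approx M D q un u \<longrightarrow> form_approx M D q vn v \<longrightarrow> (\<lambda>n. q (un n) (vn n)) \<longlonglongrightarrow> c'"
    then have "(\<lambda>n. q (un n) (vn n)) \<longlonglongrightarrow> c'" using a b by blast
    then show "c' = c" using c LIMSEQ_unique by blast
  qed
  then show ?thesis using c by simp
qed

text \<open>Replace the \<open>n\<close>-th member of the sequence by an element of \<open>D0\<close> at distance at most \<open>1 / (n + 1)\<close>.\<close>

lemma core_approx:
  assumes sub: "D0 \<subseteq> D"
    and dense: "\<And>u \<epsilon>. u \<in> D \<Longrightarrow> 0 < \<epsilon> \<Longrightarrow>
      \<exists>w\<in>D0. L2_norm M (\<lambda>x. u x - w x) < \<epsilon> \<and> L2_norm K (\<lambda>y. d u y - d w y) < \<epsilon>"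
    and u: "u \<in> L2 M" and a: "form_approx M D q un u"
  obtains wn where "form_approx M D0 q wn u" "(\<lambda>n. L2_norm K (\<lambda>y. d (un n) y - d (wn n) y)) \<longlonglongrightarrow> 0"
proof -
  note U = form_approxD[OF a]
  have "\<exists>w\<in>D0. L2_norm M (\<lambda>x. un n x - w x) < 1 / real (Suc n) \<and>
      L2_norm K (\<lambda>y. d (un n) y - d w y) < 1 / real (Suc n)" for n
    by (rule dense[OF U(1)]) simp
  then obtain wn where w0: "\<And>n. wn n \<in> D0" and w1: "\<And>n. L2_norm M (\<lambda>x. un n x - wn n x) < 1 / real (Suc n)"
    and w2: "\<And>n. L2_norm K (\<lambda>y. d (un n) y - d (wn n) y) < 1 / real (Suc n)"
    by metis
  have wD: "wn n \<in> D" for n using w0 sub by auto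
  have lim0: "(\<lambda>n. 1 / real (Suc n)) \<longlonglongrightarrow> 0"
    using LIMSEQ_inverse_real_of_nat by (simp add: inverse_eq_divide)
  have l2: "(\<lambda>n. L2_norm K (\<lambda>y. d (un n) y - d (wn n) y)) \<longlonglongrightarrow> 0"
    by (rule Lim_null_comparison[OF always_eventually lim0]) (simp add: less_imp_le[OF w2] del: of_nat_Suc)
  have "form_approx M D q wn u"
    unfolding form_approx_iff
  proof (intro conjI allI impI)
    show "wn n \<in> D" for n by (rule wD)
    show "(\<lambda>n. L2_norm M (\<lambda>x. wn n x - u x)) \<longlonglongrightarrow> 0"
    proof (rule Lim_null_comparison[OF always_eventually])
      show "(\<lambda>n. 1 / real (Suc n) + L2_norm M (\<lambda>x. un n x - u x)) \<longlonglongrightarrow> 0"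
        using tendsto_add[OF lim0 U(2)] by simp
      show "\<forall>n. norm (L2_norm M (\<lambda>x. wn n x - u x)) \<le> 1 / real (Suc n) + L2_norm M (\<lambda>x. un n x - u x)"
      proof
        fix n
        have "wn n \<in> L2 M" "un n \<in> L2 M" using wD U(1) D_L2 by auto
        from L2_norm_triangle_diff[OF this u] w1[of n]
        show "norm (L2_norm M (\<lambda>x. wn n x - u x)) \<le> 1 / real (Suc n) + L2_norm M (\<lambda>x. un n x - u x)"
          using L2_norm_minus_commute[of M "wn n" "un n"] by simp
      qed
    qed
    fix e :: real assume "0 < e"
    then have e: "0 < e / 3" by simp
    obtain N1 where N1: "\<And>m n. m \<ge> N1 \<Longrightarrow> n \<ge> N1 \<Longrightarrow> L2_norm K (\<lambda>y. d (un m) y - d (un n) y) < e / 3"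
      using U(3)[OF e] by auto
    obtain N2 where N2: "\<And>n. n \<ge> N2 \<Longrightarrow> L2_norm K (\<lambda>y. d (un n) y - d (wn n) y) < e / 3"
      using LIMSEQ_D[OF l2 e] by auto
    have "L2_norm K (\<lambda>y. d (wn m) y - d (wn n) y) < e" if mn: "m \<ge> max N1 N2" "n \<ge> max N1 N2" for m n
    proof -
      have "L2_norm K (\<lambda>y. d (wn m) y - d (wn n) y) \<le> L2_norm K (\<lambda>y. d (wn m) y - d (un m) y)
          + L2_norm K (\<lambda>y. d (un m) y - d (un n) y) + L2_norm K (\<lambda>y. d (wn n) y - d (un n) y)"
        by (intro L2_norm_triangle_diff3 d_L2 wD U(1))
      also have "\<dots> < e"
        using N1[of m n] N2[of m] N2[of n] mn
        by (simp add: L2_norm_minus_commute[of K "d (wn m)"] L2_norm_minus_commute[of K "d (wn n)"])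
      finally show ?thesis .
    qed
    then show "\<exists>N. \<forall>m\<ge>N. \<forall>n\<ge>N. L2_norm K (\<lambda>y. d (wn m) y - d (wn n) y) < e" by blast
  qed
  then have "form_approx M D0 q wn u" using w0 by (simp add: form_approx_def)
  then show ?thesis using l2 that by blast
qed

text \<open>The same complex numbers are admissible as limits for both
  domains, because each approximating sequence in \<open>D\<close> can be exchanged for one in \<open>D0\<close> without
  changing the limit of the form values.\<close>

lemma closure_core:
  assumes sub: "D0 \<subseteq> D"
    and dense: "\<And>u \<epsilon>. u \<in> D \<Longrightarrow> 0 < \<epsilon> \<Longrightarrow>
      \<exists>w\<in>D0. L2_norm M (\<lambda>x. u x - w x) < \<epsilon> \<and> L2_norm K (\<lambda>y. d u y - d w y) < \<epsilon>"
  shows "closure_dom M D q = closure_dom M D0 q"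
    and "u \<in> L2 M \<Longrightarrow> v \<in> L2 M \<Longrightarrow> closure_form M D q u v = closure_form M D0 q u v"
proof -
  have up: "form_approx M D q un u" if "form_approx M D0 q un u" for un u
    using that sub by (auto simp: form_approx_def)
  show "closure_dom M D q = closure_dom M D0 q"
  proof (intro set_eqI iffI)
    fix u assume "u \<in> closure_dom M D q"
    then obtain un where u: "u \<in> L2 M" "form_approx M D q un u" by (auto simp: closure_dom_def)
    obtain wn where "form_approx M D0 q wn u" using core_approx[OF sub dense u] by blast
    then show "u \<in> closure_dom M D0 q" unfolding closure_dom_def using u(1) by blast
  next
    fix u assume "u \<in> closure_dom M D0 q"
    then show "u \<in> closure_dom M D q" unfolding closure_dom_def using up by blast
  qed
  assume u: "u \<in> L2 M" and v: "v \<in> L2 M"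
  have "(\<forall>un vn. form_approx M D q un u \<longrightarrow> form_approx M D q vn v \<longrightarrow>
        (\<lambda>n. q (un n) (vn n)) \<longlonglongrightarrow> c) \<longleftrightarrow>
      (\<forall>un vn. form_approx M D0 q un u \<longrightarrow> form_approx M D0 q vn v \<longrightarrow>
        (\<lambda>n. q (un n) (vn n)) \<longlonglongrightarrow> c)" (is "?L = ?R") for c
  proof
    assume ?L then show ?R using up by blast
  next
    assume R: ?R
    show ?L
    proof (intro allI impI)
      fix un vn assume a: "form_approx M D q un u" and b: "form_approx M D q vn v"
      obtain wn where wn: "form_approx M D0 q wn u"
          "(\<lambda>n. L2_norm K (\<lambda>y. d (un n) y - d (wn n) y)) \<longlonglongrightarrow> 0"
        using core_approx[OF sub dense u a] by blast
      obtain zn where zn: "form_approx M D0 q zn v"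
          "(\<lambda>n. L2_norm K (\<lambda>y. d (vn n) y - d (zn n) y)) \<longlonglongrightarrow> 0"
        using core_approx[OF sub dense v b] by blast
      obtain B where B: "0 \<le> B" "\<And>n. L2_norm K (d (vn n)) \<le> B" using form_approx_bounded[OF b] by blast
      obtain C where C: "0 \<le> C" "\<And>n. L2_norm K (d (wn n)) \<le> C"
        using form_approx_bounded[OF up[OF wn(1)]] by blast
      have "(\<lambda>n. q (un n) (vn n) - q (wn n) (zn n)) \<longlonglongrightarrow> 0"
        by (rule form_diff_tendsto_0[OF form_approxD(1)[OF a] form_approxD(1)[OF b]
              form_approxD(1)[OF up[OF wn(1)]] form_approxD(1)[OF up[OF zn(1)]] B(2) C(2) wn(2) zn(2)])
      moreover have "(\<lambda>n. q (wn n) (zn n)) \<longlonglongrightarrow> c" using R wn(1) zn(1) by blast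
      ultimately have "(\<lambda>n. (q (un n) (vn n) - q (wn n) (zn n)) + q (wn n) (zn n)) \<longlonglongrightarrow> 0 + c"
        by (rule tendsto_add)
      then show "(\<lambda>n. q (un n) (vn n)) \<longlonglongrightarrow> c" by simp
    qed
  qed
  then show "closure_form M D q u v = closure_form M D0 q u v"
    unfolding closure_form_def by simp
qed

end

section \<open>Smooth functions\<close>

text \<open>Smoothness asks for a whole sequence of derivatives. It suffices to have a class of functions
  each of which has a derivative in the class: choose derivatives one after the other.\<close>

lemma smooth_on_coinduct:
  assumes "P u"
    and step: "\<And>f. P f \<Longrightarrow> \<exists>f'. P f' \<and> (\<forall>x\<in>S. (f has_vector_derivative f' x) (at x within S))"
  shows "smooth_on S u"
proof -
  define next' where "next' f = (SOME f'. P f' \<and> (\<forall>x\<in>S. (f has_vector_derivative f' x) (at x within S)))" for f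
  have next': "P (next' f) \<and> (\<forall>x\<in>S. (f has_vector_derivative next' f x) (at x within S))" if "P f" for f
    using someI_ex[OF step[OF that]] unfolding next'_def .
  define D where "D n = (next' ^^ n) u" for n
  have P: "P (D n)" for n
    by (induction n) (use assms(1) next' in \<open>auto simp: D_def\<close>)
  have "(\<forall>x\<in>S. D 0 x = u x) \<and> (\<forall>n. \<forall>x\<in>S. (D n has_vector_derivative D (Suc n) x) (at x within S))"
    using next'[OF P] by (auto simp: D_def)
  then show ?thesis unfolding smooth_on_def by blast
qed

lemma smooth_on_derivative:
  assumes "smooth_on S u"
  obtains u' where "smooth_on S u'" "\<And>x. x \<in> S \<Longrightarrow> (u has_vector_derivative u' x) (at x within S)"
proof -
  from assms obtain D where D: "\<And>x. x \<in> S \<Longrightarrow> D 0 x = u x"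
      "\<And>n x. x \<in> S \<Longrightarrow> (D n has_vector_derivative D (Suc n) x) (at x within S)"
    unfolding smooth_on_def by blast
  have "smooth_on S (D 1)"
    unfolding smooth_on_def using D(2) by (intro exI[of _ "\<lambda>n. D (Suc n)"]) auto
  moreover have "(u has_vector_derivative D 1 x) (at x within S)" if "x \<in> S" for x
    using has_vector_derivative_transform[OF that, of u "D 0"] D(1) D(2)[OF that, of 0] by simp
  ultimately show ?thesis using that by blast
qed

lemma smooth_on_cong:
  assumes "smooth_on S u" "\<And>x. x \<in> S \<Longrightarrow> u x = v x"
  shows "smooth_on S v"
  using assms unfolding smooth_on_def by metis

lemma smooth_on_subset:
  assumes "smooth_on S u" "T \<subseteq> S"
  shows "smooth_on T u"
proof -
  from assms(1) obtain D where D: "\<And>x. x \<in> S \<Longrightarrow> D 0 x = u x"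
      "\<And>n x. x \<in> S \<Longrightarrow> (D n has_vector_derivative D (Suc n) x) (at x within S)"
    unfolding smooth_on_def by blast
  have "(D n has_vector_derivative D (Suc n) x) (at x within T)" if "x \<in> T" for n x
    by (rule has_vector_derivative_within_subset[OF D(2) assms(2)]) (use that assms(2) in auto)
  then show ?thesis unfolding smooth_on_def using D(1) assms(2) by (intro exI[of _ D]) auto
qed

lemma smooth_on_const: "smooth_on S (\<lambda>x. c)"
proof (rule smooth_on_coinduct[where P="\<lambda>f. \<exists>c. f = (\<lambda>x. c)"])
  fix f :: "real \<Rightarrow> complex" assume "\<exists>c. f = (\<lambda>x. c)"
  then have "\<forall>x\<in>S. (f has_vector_derivative 0) (at x within S)" by auto
  then show "\<exists>f'. (\<exists>c. f' = (\<lambda>x. c)) \<and> (\<forall>x\<in>S. (f has_vector_derivative f' x) (at x within S))"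
    by (intro exI[of _ "\<lambda>x. 0"]) auto
qed auto

lemma smooth_on_continuous:
  assumes "smooth_on S u"
  shows "continuous_on S u"
proof -
  obtain u' where "\<And>x. x \<in> S \<Longrightarrow> (u has_vector_derivative u' x) (at x within S)"
    using smooth_on_derivative[OF assms] by blast
  then show ?thesis
    by (meson continuous_on_eq_continuous_within has_vector_derivative_continuous)
qed

text \<open>The closure of the smooth functions under the operations below is closed under
  differentiation, so by coinduction it contains only smooth functions. This proves all closure
  properties without a formula for higher derivatives of products and compositions.\<close>

inductive smooth_expr :: "real set \<Rightarrow> real set \<Rightarrow> (real \<Rightarrow> real) \<Rightarrow> (real \<Rightarrow> complex) \<Rightarrow> bool"
  for S S' :: "real set" and T :: "real \<Rightarrow> real"
where
  smooth_expr_base: "smooth_on S u \<Longrightarrow> smooth_expr S S' T u"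
| smooth_expr_comp: "smooth_on S' f \<Longrightarrow> smooth_expr S S' T (\<lambda>x. f (T x))"
| smooth_expr_inverse: "smooth_on S u \<Longrightarrow> (\<And>x. x \<in> S \<Longrightarrow> u x \<noteq> 0) \<Longrightarrow> smooth_expr S S' T (\<lambda>x. inverse (u x))"
| smooth_expr_add: "smooth_expr S S' T u \<Longrightarrow> smooth_expr S S' T v \<Longrightarrow> smooth_expr S S' T (\<lambda>x. u x + v x)"
| smooth_expr_mult: "smooth_expr S S' T u \<Longrightarrow> smooth_expr S S' T v \<Longrightarrow> smooth_expr S S' T (\<lambda>x. u x * v x)"

lemma smooth_expr_smooth:
  assumes "smooth_expr S S' T u"
    and TS: "\<And>x. x \<in> S \<Longrightarrow> T x \<in> S'"
    and T: "\<And>x. x \<in> S \<Longrightarrow> (T has_vector_derivative T' x) (at x within S)"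
    and T': "smooth_on S (\<lambda>x. complex_of_real (T' x))"
  shows "smooth_on S u"
proof (rule smooth_on_coinduct[where P="smooth_expr S S' T"])
  fix f assume "smooth_expr S S' T f"
  then show "\<exists>f'. smooth_expr S S' T f' \<and> (\<forall>x\<in>S. (f has_vector_derivative f' x) (at x within S))"
  proof induction
    case (smooth_expr_base u)
    then obtain u' where "smooth_on S u'" "\<And>x. x \<in> S \<Longrightarrow> (u has_vector_derivative u' x) (at x within S)"
      using smooth_on_derivative by blast
    then show ?case using smooth_expr.smooth_expr_base by blast
  next
    case (smooth_expr_comp f)
    then obtain f' where f': "smooth_on S' f'" "\<And>y. y \<in> S' \<Longrightarrow> (f has_vector_derivative f' y) (at y within S')"
      using smooth_on_derivative by blast
    have "((\<lambda>x. f (T x)) has_vector_derivative complex_of_real (T' x) * f' (T x)) (at x within S)" if x: "x \<in> S" for x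
    proof -
      have "T ` S \<subseteq> S'" using TS by auto
      then have "(f has_vector_derivative f' (T x)) (at (T x) within T ` S)"
        using has_vector_derivative_within_subset[OF f'(2)[OF TS[OF x]]] by blast
      from vector_diff_chain_within[OF T[OF x] this]
      show ?thesis by (simp add: o_def scaleR_conv_of_real)
    qed
    moreover have "smooth_expr S S' T (\<lambda>x. complex_of_real (T' x) * f' (T x))"
      by (intro smooth_expr.smooth_expr_mult smooth_expr.smooth_expr_base[OF T'] smooth_expr.smooth_expr_comp f')
    ultimately show ?case by blast
  next
    case (smooth_expr_inverse u)
    then obtain u' where u': "smooth_on S u'" "\<And>x. x \<in> S \<Longrightarrow> (u has_vector_derivative u' x) (at x within S)"
      using smooth_on_derivative by blast
    let ?f = "\<lambda>x. (-1) * (u' x * (inverse (u x) * inverse (u x)))"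
    have "((\<lambda>x. inverse (u x)) has_vector_derivative ?f x) (at x within S)" if x: "x \<in> S" for x
    proof -
      have "(inverse has_field_derivative - (inverse (u x) ^ Suc (Suc 0))) (at (u x) within u ` S)"
        by (rule DERIV_inverse) (rule smooth_expr_inverse(2)[OF x])
      from field_vector_diff_chain_within[OF u'(2)[OF x] this]
      show ?thesis by (simp add: o_def power2_eq_square)
    qed
    moreover have "smooth_expr S S' T ?f"
      by (intro smooth_expr.smooth_expr_mult smooth_expr.smooth_expr_base[OF u'(1)]
          smooth_expr.smooth_expr_inverse smooth_expr_inverse smooth_expr.smooth_expr_base[OF smooth_on_const])
    ultimately show ?case by blast
  next
    case (smooth_expr_add u v)
    then obtain u' v' where *: "smooth_expr S S' T u'" "\<forall>x\<in>S. (u has_vector_derivative u' x) (at x within S)"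
      "smooth_expr S S' T v'" "\<forall>x\<in>S. (v has_vector_derivative v' x) (at x within S)" by blast
    then have "\<forall>x\<in>S. ((\<lambda>x. u x + v x) has_vector_derivative u' x + v' x) (at x within S)"
      by (auto intro: has_vector_derivative_add)
    then show ?case using smooth_expr.smooth_expr_add[OF *(1,3)] by blast
  next
    case (smooth_expr_mult u v)
    then obtain u' v' where *: "smooth_expr S S' T u'" "\<forall>x\<in>S. (u has_vector_derivative u' x) (at x within S)"
      "smooth_expr S S' T v'" "\<forall>x\<in>S. (v has_vector_derivative v' x) (at x within S)" by blast
    then have "\<forall>x\<in>S. ((\<lambda>x. u x * v x) has_vector_derivative u x * v' x + u' x * v x) (at x within S)"
      by (auto intro: has_vector_derivative_mult)
    moreover have "smooth_expr S S' T (\<lambda>x. u x * v' x + u' x * v x)"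
      by (intro smooth_expr.smooth_expr_add smooth_expr.smooth_expr_mult * smooth_expr_mult.hyps)
    ultimately show ?case by blast
  qed
qed (rule assms(1))

lemma smooth_on_compose:
  assumes "smooth_on S' f" "\<And>x. x \<in> S \<Longrightarrow> T x \<in> S'"
    "\<And>x. x \<in> S \<Longrightarrow> (T has_vector_derivative T' x) (at x within S)"
    "smooth_on S (\<lambda>x. complex_of_real (T' x))"
  shows "smooth_on S (\<lambda>x. f (T x))"
  by (rule smooth_expr_smooth[OF smooth_expr_comp[OF assms(1)] assms(2,3,4)])

lemma smooth_expr_id_smooth: "smooth_expr S S (\<lambda>x. x) u \<Longrightarrow> smooth_on S u"
  by (erule smooth_expr_smooth[where T'="\<lambda>_. 1"]) (auto simp: smooth_on_const)

lemma smooth_on_add: "smooth_on S u \<Longrightarrow> smooth_on S v \<Longrightarrow> smooth_on S (\<lambda>x. u x + v x)"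
  by (rule smooth_expr_id_smooth, intro smooth_expr_add smooth_expr_base)

lemma smooth_on_mult: "smooth_on S u \<Longrightarrow> smooth_on S v \<Longrightarrow> smooth_on S (\<lambda>x. u x * v x)"
  by (rule smooth_expr_id_smooth, intro smooth_expr_mult smooth_expr_base)

lemma smooth_on_inverse: "smooth_on S u \<Longrightarrow> (\<And>x. x \<in> S \<Longrightarrow> u x \<noteq> 0) \<Longrightarrow> smooth_on S (\<lambda>x. inverse (u x))"
  by (rule smooth_expr_id_smooth, rule smooth_expr_inverse)

lemma smooth_on_diff:
  assumes "smooth_on S u" "smooth_on S v"
  shows "smooth_on S (\<lambda>x. u x - v x)"
  using smooth_on_add[OF assms(1) smooth_on_mult[OF smooth_on_const[of S "-1"] assms(2)]] by simp

lemma smooth_on_exp: "smooth_on S (\<lambda>x. complex_of_real (exp (a * x + b)))"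
proof (rule smooth_on_coinduct[where P="\<lambda>f. \<exists>c. f = (\<lambda>x. complex_of_real (c * exp (a * x + b)))"])
  show "\<exists>c. (\<lambda>x. complex_of_real (exp (a * x + b))) = (\<lambda>x. complex_of_real (c * exp (a * x + b)))"
    by (rule exI[of _ 1]) simp
  fix f :: "real \<Rightarrow> complex" assume "\<exists>c. f = (\<lambda>x. complex_of_real (c * exp (a * x + b)))"
  then obtain c where f: "f = (\<lambda>x. complex_of_real (c * exp (a * x + b)))" by blast
  have "(f has_vector_derivative complex_of_real ((c * a) * exp (a * x + b))) (at x within S)" for x
    unfolding f by (intro has_vector_derivative_of_real)
      (auto intro!: derivative_eq_intros simp flip: has_real_derivative_iff_has_vector_derivative)
  then show "\<exists>f'. (\<exists>c. f' = (\<lambda>x. complex_of_real (c * exp (a * x + b)))) \<and>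
      (\<forall>x\<in>S. (f has_vector_derivative f' x) (at x within S))" by blast
qed

lemma smooth_on_powr: "smooth_on {0<..} (\<lambda>x. complex_of_real (x powr b))"
proof (rule smooth_on_coinduct[where P="\<lambda>f. \<exists>c b. f = (\<lambda>x. complex_of_real (c * x powr b))"])
  show "\<exists>c d. (\<lambda>x. complex_of_real (x powr b)) = (\<lambda>x. complex_of_real (c * x powr d))"
    by (intro exI[of _ 1] exI[of _ b]) simp
  fix f :: "real \<Rightarrow> complex" assume "\<exists>c b. f = (\<lambda>x. complex_of_real (c * x powr b))"
  then obtain c b where f: "f = (\<lambda>x. complex_of_real (c * x powr b))" by blast
  have "(f has_vector_derivative complex_of_real ((c * b) * x powr (b - 1))) (at x within {0<..})" if "x \<in> {0<..}" for x
    unfolding f using that by (intro has_vector_derivative_of_real)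
      (auto intro!: derivative_eq_intros simp flip: has_real_derivative_iff_has_vector_derivative)
  then show "\<exists>f'. (\<exists>c b. f' = (\<lambda>x. complex_of_real (c * x powr b))) \<and>
      (\<forall>x\<in>{0<..}. (f has_vector_derivative f' x) (at x within {0<..}))" by blast
qed

lemma smooth_on_of_real: "smooth_on S (\<lambda>x. complex_of_real x)"
proof -
  have "smooth_on S complex_of_real"
  proof (rule smooth_on_coinduct[where P="\<lambda>f. f = complex_of_real \<or> (\<exists>c. f = (\<lambda>x. c))"])
    fix f :: "real \<Rightarrow> complex" assume f: "f = complex_of_real \<or> (\<exists>c. f = (\<lambda>x. c))"
    have "(complex_of_real has_vector_derivative 1) (at x within S)" for x
      using has_vector_derivative_of_real[OF DERIV_ident, of "at x within S"] by simp
    then show "\<exists>f'. (f' = complex_of_real \<or> (\<exists>c. f' = (\<lambda>x. c))) \<and>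
        (\<forall>x\<in>S. (f has_vector_derivative f' x) (at x within S))"
      using f
    proof (elim disjE exE)
      assume "f = complex_of_real"
      then show ?thesis using \<open>\<And>x. (complex_of_real has_vector_derivative 1) (at x within S)\<close>
        by (intro exI[of _ "\<lambda>x. 1"]) auto
    next
      fix c assume "f = (\<lambda>x. c)"
      then show ?thesis by (intro exI[of _ "\<lambda>x. 0"]) auto
    qed
  qed auto
  then show ?thesis .
qed

text \<open>All derivatives on the open half-line vanish near \<open>0\<close>, so each of them can be extended by \<open>0\<close>.\<close>

lemma smooth_on_extend_zero:
  assumes u: "smooth_on {0<..} u" and e: "0 < e" and z: "\<And>x. 0 \<le> x \<Longrightarrow> x < e \<Longrightarrow> u x = 0"
  shows "smooth_on {0..} u"
proof (rule smooth_on_coinduct[where P="\<lambda>f. smooth_on {0<..} f \<and> (\<forall>x. 0 \<le> x \<longrightarrow> x < e \<longrightarrow> f x = 0)"])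
  fix f :: "real \<Rightarrow> complex" assume f: "smooth_on {0<..} f \<and> (\<forall>x. 0 \<le> x \<longrightarrow> x < e \<longrightarrow> f x = 0)"
  obtain f' where f': "smooth_on {0<..} f'" "\<And>x. x \<in> {0<..} \<Longrightarrow> (f has_vector_derivative f' x) (at x within {0<..})"
    using smooth_on_derivative[OF conjunct1[OF f]] by blast
  have fat: "(f has_vector_derivative f' x) (at x)" if "0 < x" for x
    using f'(2)[of x] that by (simp add: at_within_open[of x "{0<..}"])
  define h where "h x = (if x < e then 0 else f' x)" for x
  have d: "(f has_vector_derivative h x) (at x within {0..})" if x: "0 \<le> x" for x
  proof (cases "x < e")
    case True
    have "((\<lambda>_. 0) has_vector_derivative 0) (at x within {0..})" by simp
    then have "(f has_vector_derivative 0) (at x within {0..})"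
      by (rule has_vector_derivative_transform_within[where d="e - x"])
         (use True x f in \<open>auto simp: dist_real_def\<close>)
    then show ?thesis using True by (simp add: h_def)
  next
    case False
    then show ?thesis
      using has_vector_derivative_at_within[OF fat[of x]] e by (simp add: h_def)
  qed
  have "f' x = h x" if "x \<in> {0<..}" for x
  proof -
    have "x \<in> interior {0..}" using that by (simp add: interior_real_atLeast)
    then have "(f has_vector_derivative h x) (at x)"
      using d[of x] that at_within_interior[of x "{0..}"] by simp
    then show ?thesis using vector_derivative_unique_at[OF fat, of x] that by auto
  qed
  then have "smooth_on {0<..} h" by (rule smooth_on_cong[OF f'(1)])
  then show "\<exists>f'. (smooth_on {0<..} f' \<and> (\<forall>x. 0 \<le> x \<longrightarrow> x < e \<longrightarrow> f' x = 0)) \<and>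
      (\<forall>x\<in>{0..}. (f has_vector_derivative f' x) (at x within {0..}))"
    using d by (intro exI[of _ h]) (auto simp: h_def)
qed (use u z in auto)

section \<open>Cut-off functions\<close>

definition flat_exp :: "real \<Rightarrow> real" where
  "flat_exp x = (if 0 < x then exp (- (1 / x)) else 0)"

text \<open>The span of the functions \<open>x \<mapsto> x\<^sup>-\<^sup>k exp (-1/x)\<close>, extended by \<open>0\<close>, is closed under
  differentiation, and its members are continuous at \<open>0\<close>.\<close>

inductive flat_function :: "(real \<Rightarrow> real) \<Rightarrow> bool" where
  flat_base: "flat_function (\<lambda>x. if 0 < x then c * (1 / x) ^ k * exp (- (1 / x)) else 0)"
| flat_add: "flat_function f \<Longrightarrow> flat_function g \<Longrightarrow> flat_function (\<lambda>x. f x + g x)"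

lemma flat_function_at_0:
  "((\<lambda>x. c * (1 / x) ^ k * exp (- (1 / x))) \<longlongrightarrow> 0) (at_right (0::real))"
proof -
  have "((\<lambda>z. c * (z ^ k / exp z)) \<longlongrightarrow> c * 0) (at_top :: real filter)"
    by (intro tendsto_mult tendsto_const tendsto_power_div_exp_0)
  then have "((\<lambda>z. c * z ^ k * exp (- z)) \<longlongrightarrow> 0) (at_top :: real filter)"
    by (simp add: exp_minus divide_inverse mult.assoc)
  from filterlim_compose[OF this filterlim_inverse_at_top_right]
  show ?thesis by (simp add: inverse_eq_divide)
qed

lemma flat_function_derivative:
  assumes "flat_function f"
  shows "\<exists>f'. flat_function f' \<and> (\<forall>x. (f has_real_derivative f' x) (at x))"
  using assms
proof induction
  case (flat_base c k)
  define f where "f x = (if 0 < x then c * (1 / x) ^ k * exp (- (1 / x)) else 0)" for x :: real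
  define f' where "f' x = (if 0 < x then (- c * real k) * (1 / x) ^ (k + 1) * exp (- (1 / x)) else 0)
     + (if 0 < x then c * (1 / x) ^ (k + 2) * exp (- (1 / x)) else 0)" for x :: real
  have "flat_function f'" unfolding f'_def by (intro flat_function.intros)
  moreover have "(f has_real_derivative f' x) (at x)" for x
  proof -
    consider "0 < x" | "x < 0" | "x = 0" by linarith
    then show ?thesis
    proof cases
      case 1
      have p: "real k * (1 / x) ^ (k - Suc 0) * (1 / x) ^ 2 = real k * (1 / x) ^ (k + 1)"
        by (cases k) (simp_all add: power2_eq_square)
      have inv: "((\<lambda>x. 1 / x) has_real_derivative - ((1 / x) ^ 2)) (at x)"
        using 1 by (auto intro!: derivative_eq_intros simp: power2_eq_square)
      have "((\<lambda>x. (1 / x) ^ k) has_real_derivative real k * (1 / x) ^ (k - Suc 0) * (- ((1 / x) ^ 2))) (at x)"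
        using DERIV_power[OF inv, of k] by (simp add: mult_ac)
      moreover have "((\<lambda>x. exp (- (1 / x))) has_real_derivative exp (- (1 / x)) * (1 / x) ^ 2) (at x)"
        using DERIV_fun_exp[OF DERIV_minus[OF inv]] by simp
      ultimately have "((\<lambda>x. c * ((1 / x) ^ k * exp (- (1 / x)))) has_real_derivative
          c * (real k * (1 / x) ^ (k - Suc 0) * (- ((1 / x) ^ 2)) * exp (- (1 / x)) +
            exp (- (1 / x)) * (1 / x) ^ 2 * (1 / x) ^ k)) (at x)"
        by (intro DERIV_cmult DERIV_mult)
      then have "((\<lambda>x. c * (1 / x) ^ k * exp (- (1 / x))) has_real_derivative
          c * (real k * (1 / x) ^ (k - Suc 0) * (- ((1 / x) ^ 2)) * exp (- (1 / x)) +
            (1 / x) ^ k * (exp (- (1 / x)) * (1 / x) ^ 2))) (at x)"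
        by (simp add: mult_ac)
      also have "c * (real k * (1 / x) ^ (k - Suc 0) * (- ((1 / x) ^ 2)) * exp (- (1 / x)) +
            (1 / x) ^ k * (exp (- (1 / x)) * (1 / x) ^ 2)) =
          c * (- (real k * (1 / x) ^ (k - Suc 0) * (1 / x) ^ 2) * exp (- (1 / x)) +
            (1 / x) ^ k * (1 / x) ^ 2 * exp (- (1 / x)))"
        by (simp add: algebra_simps)
      also have "\<dots> = f' x"
        unfolding p power_add[symmetric] using 1 by (simp add: f'_def algebra_simps)
      finally show ?thesis
        by (rule has_field_derivative_transform_within_open[where S="{0<..}"]) (use 1 in \<open>auto simp: f_def\<close>)
    next
      case 2
      have "((\<lambda>x. 0) has_real_derivative 0) (at x)" by simp
      then have "(f has_real_derivative 0) (at x)"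
        by (rule has_field_derivative_transform_within_open[where S="{..<0}"]) (use 2 in \<open>auto simp: f_def\<close>)
      then show ?thesis using 2 by (simp add: f'_def)
    next
      case 3
      have "((\<lambda>y. f y / y) \<longlongrightarrow> 0) (at_left 0)"
        by (rule Lim_transform_eventually[OF tendsto_const])
           (auto simp: eventually_at_left_field f_def intro!: exI[of _ "-1"])
      moreover have "((\<lambda>y. f y / y) \<longlongrightarrow> 0) (at_right 0)"
        by (rule Lim_transform_eventually[OF flat_function_at_0[of c "k + 1"]])
           (auto simp: eventually_at_right_field f_def intro!: exI[of _ "1"])
      ultimately have "((\<lambda>y. f y / y) \<longlongrightarrow> 0) (at 0)" by (rule filterlim_split_at)
      then show ?thesis using 3 by (simp add: has_field_derivative_iff f'_def f_def)
    qed
  qed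
  ultimately show ?case unfolding f_def[abs_def] by blast
next
  case (flat_add f g)
  then obtain f' g' where "flat_function f'" "\<forall>x. (f has_real_derivative f' x) (at x)"
    "flat_function g'" "\<forall>x. (g has_real_derivative g' x) (at x)" by blast
  then show ?case
    by (intro exI[of _ "\<lambda>x. f' x + g' x"]) (auto intro: flat_function.flat_add DERIV_add)
qed

lemma smooth_on_flat_exp: "smooth_on UNIV (\<lambda>x. complex_of_real (flat_exp x))"
proof (rule smooth_on_coinduct[where P="\<lambda>u. \<exists>f. flat_function f \<and> u = (\<lambda>x. complex_of_real (f x))"])
  show "\<exists>f. flat_function f \<and> (\<lambda>x. complex_of_real (flat_exp x)) = (\<lambda>x. complex_of_real (f x))"
  proof (intro exI conjI)
    have "flat_exp = (\<lambda>x. if 0 < x then 1 * (1 / x) ^ 0 * exp (- (1 / x)) else 0)"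
      by (auto simp: flat_exp_def fun_eq_iff)
    then show "flat_function flat_exp" using flat_base[of 1 0] by simp
  qed simp
  fix u assume "\<exists>f. flat_function f \<and> u = (\<lambda>x. complex_of_real (f x))"
  then obtain f where f: "flat_function f" "u = (\<lambda>x. complex_of_real (f x))" by blast
  obtain f' where "flat_function f'" "\<And>x. (f has_real_derivative f' x) (at x)"
    using flat_function_derivative[OF f(1)] by blast
  then show "\<exists>f'. (\<exists>f. flat_function f \<and> f' = (\<lambda>x. complex_of_real (f x))) \<and>
      (\<forall>x\<in>UNIV. (u has_vector_derivative f' x) (at x))"
    unfolding f(2) by (intro exI[of _ "\<lambda>x. complex_of_real (f' x)"]) (auto intro: has_vector_derivative_of_real)
qed

definition bump :: "real \<Rightarrow> real" where
  "bump x = flat_exp (2 - x\<^sup>2) / (flat_exp (2 - x\<^sup>2) + flat_exp (x\<^sup>2 - 1))"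

lemma flat_exp_nonneg: "0 \<le> flat_exp x"
  by (simp add: flat_exp_def)

text \<open>The numbers \<open>2 - x\<^sup>2\<close> and \<open>x\<^sup>2 - 1\<close> add up to \<open>1\<close>, so one of them is positive.\<close>

lemma bump_denominator: "0 < flat_exp (2 - x\<^sup>2) + flat_exp (x\<^sup>2 - 1)"
proof (cases "x\<^sup>2 < 2")
  case True
  then have "0 < flat_exp (2 - x\<^sup>2)" by (simp add: flat_exp_def)
  then show ?thesis using flat_exp_nonneg[of "x\<^sup>2 - 1"] by linarith
next
  case False
  then have "0 < flat_exp (x\<^sup>2 - 1)" by (simp add: flat_exp_def)
  then show ?thesis using flat_exp_nonneg[of "2 - x\<^sup>2"] by linarith
qed

lemma bump_bounds: "0 \<le> bump x" "bump x \<le> 1"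
  using bump_denominator[of x] flat_exp_nonneg[of "2 - x\<^sup>2"] flat_exp_nonneg[of "x\<^sup>2 - 1"]
  by (auto simp: bump_def divide_simps)

lemma bump_eq_1: "\<bar>x\<bar> \<le> 1 \<Longrightarrow> bump x = 1"
proof -
  assume "\<bar>x\<bar> \<le> 1"
  then have "x\<^sup>2 \<le> 1" by (simp add: abs_square_le_1)
  then have "flat_exp (x\<^sup>2 - 1) = 0" by (simp add: flat_exp_def)
  then show ?thesis using bump_denominator[of x] by (simp add: bump_def)
qed

lemma bump_eq_0: "2 \<le> \<bar>x\<bar> \<Longrightarrow> bump x = 0"
proof -
  assume "2 \<le> \<bar>x\<bar>"
  then have "2\<^sup>2 \<le> \<bar>x\<bar>\<^sup>2" by (intro power_mono) auto
  then show ?thesis by (simp add: bump_def flat_exp_def)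
qed

lemma smooth_on_bump: "smooth_on UNIV (\<lambda>x. complex_of_real (bump x))"
proof -
  have d: "smooth_on UNIV (\<lambda>x. complex_of_real (a * x))" for a :: real
    using smooth_on_mult[OF smooth_on_const smooth_on_of_real, of UNIV "complex_of_real a"] by simp
  have d': "smooth_on UNIV (\<lambda>x. complex_of_real (- (2 * x)))" using d[of "-2"] by simp
  have 1: "smooth_on UNIV (\<lambda>x. complex_of_real (flat_exp (2 - x\<^sup>2)))"
    by (rule smooth_on_compose[OF smooth_on_flat_exp, where T="\<lambda>x. 2 - x\<^sup>2" and T'="\<lambda>x. (-2) * x"])
       (auto intro!: derivative_eq_intros d d' simp del: of_real_mult of_real_minus mult_minus_left simp flip: has_real_derivative_iff_has_vector_derivative)
  have 2: "smooth_on UNIV (\<lambda>x. complex_of_real (flat_exp (x\<^sup>2 - 1)))"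
    by (rule smooth_on_compose[OF smooth_on_flat_exp, where T="\<lambda>x. x\<^sup>2 - 1" and T'="\<lambda>x. 2 * x"])
       (auto intro!: derivative_eq_intros d d' simp del: of_real_mult of_real_minus mult_minus_left simp flip: has_real_derivative_iff_has_vector_derivative)
  have nz: "complex_of_real (flat_exp (2 - x\<^sup>2)) + complex_of_real (flat_exp (x\<^sup>2 - 1)) \<noteq> 0" for x
    using bump_denominator[of x] by (metis of_real_add of_real_eq_0_iff less_irrefl)
  from smooth_on_mult[OF 1 smooth_on_inverse[OF smooth_on_add[OF 1 2] nz]]
  show ?thesis by (simp add: bump_def divide_inverse)
qed

abbreviation vderiv :: "(real \<Rightarrow> complex) \<Rightarrow> real \<Rightarrow> complex" where
  "vderiv u \<equiv> (\<lambda>x. vector_derivative u (at x))"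

lemma smooth_vderiv:
  assumes "smooth_on UNIV u"
  shows "(u has_vector_derivative vderiv u x) (at x)" "smooth_on UNIV (vderiv u)"
proof -
  obtain u' where u': "smooth_on UNIV u'" "\<And>x. (u has_vector_derivative u' x) (at x)"
    using smooth_on_derivative[OF assms] by auto
  then have "vderiv u = u'" by (auto simp: vector_derivative_at)
  then show "(u has_vector_derivative vderiv u x) (at x)" "smooth_on UNIV (vderiv u)"
    using u' by auto
qed

definition cutoff :: "nat \<Rightarrow> real \<Rightarrow> complex" where
  "cutoff n x = complex_of_real (bump (x / real (Suc n)))"

lemma cutoff_le_1: "cmod (cutoff n x) \<le> 1"
  using bump_bounds by (simp add: cutoff_def)

lemma cutoff_eq_1: "\<bar>x\<bar> \<le> real (Suc n) \<Longrightarrow> cutoff n x = 1"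
  using bump_eq_1[of "x / real (Suc n)"] by (simp add: cutoff_def divide_simps del: of_nat_Suc)

lemma cutoff_eq_0: "2 * real (Suc n) \<le> \<bar>x\<bar> \<Longrightarrow> cutoff n x = 0"
  using bump_eq_0[of "x / real (Suc n)"] by (simp add: cutoff_def divide_simps del: of_nat_Suc)

lemma smooth_cutoff: "smooth_on UNIV (cutoff n)"
proof -
  have "smooth_on UNIV (\<lambda>x. complex_of_real (bump (x / real (Suc n))))"
    by (rule smooth_on_compose[OF smooth_on_bump, where T="\<lambda>x. x / real (Suc n)" and T'="\<lambda>x. 1 / real (Suc n)"])
       (auto intro!: derivative_eq_intros smooth_on_const
          simp del: of_nat_Suc of_real_divide simp flip: has_real_derivative_iff_has_vector_derivative)
  then show ?thesis by (simp add: cutoff_def[abs_def])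
qed

lemma cutoff_derivative_bound:
  "\<exists>C>0. (\<forall>n x. cmod (vderiv (cutoff n) x) \<le> C / real (Suc n)) \<and>
    (\<forall>n x. 2 * real (Suc n) < \<bar>x\<bar> \<longrightarrow> vderiv (cutoff n) x = 0)"
proof -
  let ?b = "\<lambda>x. complex_of_real (bump x)"
  note b = smooth_vderiv[OF smooth_on_bump]
  have z: "vderiv ?b x = 0" if "2 < \<bar>x\<bar>" for x
  proof -
    have o: "open {x::real. 2 < \<bar>x\<bar>}" by (intro open_Collect_less continuous_intros)
    have "((\<lambda>x. 0) has_vector_derivative (0::complex)) (at x)" by simp
    then have "(?b has_vector_derivative 0) (at x)"
      by (rule has_vector_derivative_transform_within_open[OF _ o]) (use that bump_eq_0 in auto)
    then show ?thesis by (rule vector_derivative_at)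
  qed
  have "compact (vderiv ?b ` {-2..2})"
    by (intro compact_continuous_image continuous_on_subset[OF smooth_on_continuous[OF b(2)]]) auto
  then obtain C0 where C0: "\<And>x. x \<in> {-2..2} \<Longrightarrow> cmod (vderiv ?b x) \<le> C0"
    using compact_imp_bounded bounded_iff by (metis imageI)
  define C where "C = max C0 1"
  have C: "cmod (vderiv ?b x) \<le> C" for x
  proof (cases "\<bar>x\<bar> \<le> 2")
    case True
    then have "cmod (vderiv ?b x) \<le> C0" by (intro C0) auto
    then show ?thesis by (simp add: C_def)
  qed (use z in \<open>auto simp: C_def\<close>)
  have d: "vderiv (cutoff n) x = vderiv ?b (x / real (Suc n)) / of_nat (Suc n)" for n x
  proof -
    have "((\<lambda>x. x / real (Suc n)) has_vector_derivative 1 / real (Suc n)) (at x)"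
      by (auto intro!: derivative_eq_intros simp del: of_nat_Suc simp flip: has_real_derivative_iff_has_vector_derivative)
    from vector_diff_chain_at[OF this b(1)]
    have "(cutoff n has_vector_derivative (1 / real (Suc n)) *\<^sub>R vderiv ?b (x / real (Suc n))) (at x)"
      by (simp add: o_def cutoff_def[abs_def] del: of_nat_Suc)
    from vector_derivative_at[OF this] show ?thesis
      by (simp add: scaleR_conv_of_real divide_inverse mult.commute del: of_nat_Suc)
  qed
  show ?thesis
  proof (intro exI[of _ C] conjI allI impI)
    show "0 < C" by (simp add: C_def)
    show "cmod (vderiv (cutoff n) x) \<le> C / real (Suc n)" for n x
      unfolding d using C[of "x / real (Suc n)"]
      by (simp add: norm_divide divide_right_mono del: of_nat_Suc)
    show "vderiv (cutoff n) x = 0" if "2 * real (Suc n) < \<bar>x\<bar>" for n x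
      unfolding d using z[of "x / real (Suc n)"] that
      by (simp add: divide_simps abs_divide del: of_nat_Suc)
  qed
qed

section \<open>Logarithmic change of variables\<close>

lemma continuous_lebesgue_measurable:
  fixes f :: "real \<Rightarrow> 'a::{second_countable_topology, topological_space}"
  assumes "continuous_on UNIV f"
  shows "f \<in> borel_measurable lebesgue"
  by (rule measurable_completion) (simp add: borel_measurable_continuous_onI[OF assms])

lemma exp_lin_measurable [measurable]: "(\<lambda>y::real. exp (a * y + b)) \<in> borel_measurable lebesgue"
  by (intro continuous_lebesgue_measurable continuous_intros)

lemma exp_mult_measurable [measurable]: "(\<lambda>y::real. exp (a * y)) \<in> borel_measurable lebesgue"
  by (intro continuous_lebesgue_measurable continuous_intros)

definition weighted_line :: "real \<Rightarrow> real measure" where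
  "weighted_line \<tau> = density lebesgue (\<lambda>y. ennreal (exp (\<tau> * y)))"

lemma space_weighted_line [simp]: "space (weighted_line \<tau>) = UNIV"
  by (simp add: weighted_line_def)

lemma sets_weighted_line [simp, measurable_cong]: "sets (weighted_line \<tau>) = sets lebesgue"
  by (simp add: weighted_line_def)

lemma borel_measurable_weighted_line: "borel_measurable (weighted_line \<tau>) = borel_measurable lebesgue"
  by (rule measurable_cong_sets) simp_all

lemma integrable_weighted_line:
  fixes f :: "real \<Rightarrow> 'a::{banach, second_countable_topology}"
  assumes "f \<in> borel_measurable lebesgue"
  shows "integrable (weighted_line \<tau>) f \<longleftrightarrow> integrable lebesgue (\<lambda>y. exp (\<tau> * y) *\<^sub>R f y)"
  unfolding weighted_line_def using assms by (intro integrable_density) auto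

lemma integral_weighted_line:
  fixes f :: "real \<Rightarrow> 'a::{banach, second_countable_topology}"
  assumes "f \<in> borel_measurable lebesgue"
  shows "(\<integral>y. f y \<partial>weighted_line \<tau>) = (\<integral>y. exp (\<tau> * y) *\<^sub>R f y \<partial>lebesgue)"
  unfolding weighted_line_def using assms by (intro integral_density) auto

lemma AE_weighted_line: "(AE y in weighted_line \<tau>. P y) \<longleftrightarrow> (AE y in lebesgue. P y)"
  unfolding weighted_line_def by (subst AE_density) auto

lemma sets_halfline: "A \<in> sets halfline \<longleftrightarrow> A \<subseteq> {0<..} \<and> A \<in> sets lebesgue"
  by (auto simp: sets_restrict_space_iff)

locale log_subst =
  fixes m d :: real
  assumes m_nz: "m \<noteq> 0"
begin

definition \<phi> :: "real \<Rightarrow> real" where "\<phi> y = exp (m * y + d)"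
definition \<psi> :: "real \<Rightarrow> real" where "\<psi> r = (ln r - d) / m"

lemma phi_pos [simp]: "0 < \<phi> y" by (simp add: \<phi>_def)
lemma psi_phi [simp]: "\<psi> (\<phi> y) = y" using m_nz by (simp add: \<phi>_def \<psi>_def)
lemma phi_psi [simp]: "0 < r \<Longrightarrow> \<phi> (\<psi> r) = r" using m_nz by (simp add: \<phi>_def \<psi>_def)
lemma inj_phi: "inj_on \<phi> S" by (metis inj_onI psi_phi)

lemma phi_deriv: "(\<phi> has_real_derivative m * \<phi> y) (at y within S)"
  unfolding \<phi>_def by (auto intro!: derivative_eq_intros)

lemma psi_deriv: "0 < r \<Longrightarrow> (\<psi> has_real_derivative 1 / (m * r)) (at r within S)"
  unfolding \<psi>_def using m_nz by (auto intro!: derivative_eq_intros simp: field_simps)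

lemma phi_vimage: "A \<subseteq> {0<..} \<Longrightarrow> \<phi> -` A = \<psi> ` A"
proof (intro set_eqI iffI)
  fix y assume "y \<in> \<phi> -` A"
  then show "y \<in> \<psi> ` A" by (intro image_eqI[of _ _ "\<phi> y"]) auto
next
  fix y assume "A \<subseteq> {0<..}" "y \<in> \<psi> ` A"
  then show "y \<in> \<phi> -` A" by (auto simp: subset_iff)
qed

lemma phi_measurable: "\<phi> \<in> measurable lebesgue halfline"
proof (rule measurableI)
  fix A assume "A \<in> sets halfline"
  then have A: "A \<subseteq> {0<..}" "A \<in> sets lebesgue" by (auto simp: sets_halfline)
  have "\<psi> differentiable_on A"
    unfolding differentiable_on_def using A(1) psi_deriv
    by (metis greaterThan_iff has_field_derivative_imp_has_derivative differentiable_def subsetD)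
  then have "\<psi> ` A \<in> sets lebesgue" by (intro differentiable_image_in_sets_lebesgue A) auto
  then show "\<phi> -` A \<inter> space lebesgue \<in> sets lebesgue" by (simp add: phi_vimage A)
qed simp

lemma psi_measurable: "\<psi> \<in> measurable halfline lebesgue"
proof (rule measurableI)
  fix A :: "real set" assume A: "A \<in> sets lebesgue"
  have "\<psi> -` A \<inter> {0<..} = \<phi> ` A"
    by (auto simp: image_iff) (metis phi_psi)
  moreover have "\<phi> differentiable_on A"
    unfolding differentiable_on_def
    by (metis phi_deriv has_field_derivative_imp_has_derivative differentiable_def)
  then have "\<phi> ` A \<in> sets lebesgue" by (intro differentiable_image_in_sets_lebesgue A) auto
  ultimately show "\<psi> -` A \<inter> space halfline \<in> sets halfline" by (auto simp: sets_halfline)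
qed simp

lemma phi_comp_measurable [measurable (raw)]:
  "F \<in> borel_measurable halfline \<Longrightarrow> (\<lambda>y. F (\<phi> y)) \<in> borel_measurable lebesgue"
  using measurable_comp[OF phi_measurable] by (simp add: o_def)

lemma psi_comp_measurable:
  "F \<in> borel_measurable lebesgue \<Longrightarrow> (\<lambda>y. F (\<psi> y)) \<in> borel_measurable halfline"
  using measurable_comp[OF psi_measurable] by (simp add: o_def)

lemma phi_borel [measurable]: "\<phi> \<in> borel_measurable lebesgue"
  unfolding \<phi>_def[abs_def] by measurable

text \<open>The change of variables theorem applies to integrable functions, such as the indicators of bounded
  sets; general sets are exhausted by bounded ones in the next lemma.\<close>

lemma distr_phi_bounded:
  assumes A: "A \<in> sets lebesgue" "A \<subseteq> {0<..}" "A \<subseteq> {a..b}"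
  shows "(\<integral>\<^sup>+y. ennreal (\<bar>m\<bar> * \<phi> y) * indicator (\<phi> -` A) y \<partial>lebesgue) = emeasure lebesgue A"
proof -
  have Alm: "A \<in> lmeasurable"
    by (rule bounded_set_imp_lmeasurable[OF bounded_subset[OF bounded_closed_interval A(3)] A(1)])
  define S where "S = \<phi> -` A"
  have S: "S \<in> sets lebesgue"
    using measurable_sets[OF phi_measurable, of A] A by (simp add: S_def sets_halfline)
  have im: "\<phi> ` S = A"
    using A(2) by (auto simp: S_def image_iff subset_iff) (metis phi_psi)
  have "(\<lambda>x. 1::real) absolutely_integrable_on A \<and> integral A (\<lambda>x. 1) = measure lebesgue A"
    using Alm by (simp add: lmeasure_integral absolutely_integrable_on_const)
  then have "(\<lambda>x. \<bar>m * \<phi> x\<bar> * 1) absolutely_integrable_on S \<and>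
      integral S (\<lambda>x. \<bar>m * \<phi> x\<bar> * 1) = measure lebesgue A"
    by (subst has_absolute_integral_change_of_variables_1'[OF S phi_deriv inj_phi]) (simp add: im)
  then have ai: "(\<lambda>x. \<bar>m\<bar> * \<phi> x) absolutely_integrable_on S"
    and I: "integral S (\<lambda>x. \<bar>m\<bar> * \<phi> x) = measure lebesgue A"
    by (simp_all add: abs_mult abs_of_pos[OF phi_pos])
  define f where "f = (\<lambda>y. \<bar>m\<bar> * \<phi> y)"
  have f0: "0 \<le> f y" for y by (simp add: f_def less_imp_le)
  note ai = ai[folded f_def] and I = I[folded f_def]
  have "(\<integral>\<^sup>+y. ennreal (indicator S y *\<^sub>R f y) \<partial>lebesgue) = ennreal (integral S f)"
    using nn_integral_eq_integral[of lebesgue "\<lambda>y. indicator S y *\<^sub>R f y"] ai f0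
      set_lebesgue_integral_eq_integral(2)[OF ai]
    by (simp add: set_integrable_def set_lebesgue_integral_def)
  also have "\<dots> = emeasure lebesgue A"
    using I Alm by (simp add: emeasure_eq_measure2)
  also have "(\<integral>\<^sup>+y. ennreal (indicator S y *\<^sub>R f y) \<partial>lebesgue) =
      (\<integral>\<^sup>+y. ennreal (f y) * indicator (\<phi> -` A) y \<partial>lebesgue)"
    by (intro nn_integral_cong) (simp add: S_def indicator_def)
  finally show ?thesis by (simp only: f_def)
qed

text \<open>Stated for measures, the change of variables applies at once to non-negative integrals, to
  integrability and to integrals with values in any Banach space.\<close>

lemma distr_phi: "distr (density lebesgue (\<lambda>y. ennreal (\<bar>m\<bar> * \<phi> y))) halfline \<phi> = halfline"
proof (rule measure_eqI)
  let ?M = "density lebesgue (\<lambda>y. ennreal (\<bar>m\<bar> * \<phi> y))"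
  have phiM: "\<phi> \<in> measurable ?M halfline"
    using phi_measurable by (simp cong: measurable_cong_sets)
  fix A assume "A \<in> sets (distr ?M halfline \<phi>)"
  then have A: "A \<subseteq> {0<..}" "A \<in> sets lebesgue" by (auto simp: sets_halfline)
  define B where "B n = A \<inter> {- real n..real n}" for n
  have B: "B n \<in> sets halfline" for n using A by (auto simp: B_def sets_halfline)
  have inc: "incseq B" by (auto simp: B_def incseq_def)
  have UN: "(\<Union>n. B n) = A"
  proof -
    have "\<exists>n. x \<in> {- real n..real n}" for x
      using real_arch_simple[of "\<bar>x\<bar>"] by (metis abs_le_iff atLeastAtMost_iff minus_le_iff)
    then show ?thesis by (auto simp: B_def)
  qed
  have eq: "emeasure (distr ?M halfline \<phi>) (B n) = emeasure halfline (B n)" for n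
  proof -
    have bn: "B n \<in> sets lebesgue" "B n \<subseteq> {0<..}" using B[of n] by (auto simp: sets_halfline)
    have v: "\<phi> -` B n \<in> sets lebesgue" using measurable_sets[OF phi_measurable B[of n]] by simp
    have "emeasure (distr ?M halfline \<phi>) (B n) = (\<integral>\<^sup>+y. ennreal (\<bar>m\<bar> * \<phi> y) * indicator (\<phi> -` B n) y \<partial>lebesgue)"
      using v by (simp add: emeasure_distr[OF phiM B] emeasure_density)
    also have "\<dots> = emeasure lebesgue (B n)"
      by (rule distr_phi_bounded[OF bn, of "- real n" "real n"]) (auto simp: B_def)
    finally show ?thesis using bn by (simp add: emeasure_restrict_space)
  qed
  have "emeasure (distr ?M halfline \<phi>) (\<Union>n. B n) = (SUP n. emeasure (distr ?M halfline \<phi>) (B n))"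
    by (rule SUP_emeasure_incseq[symmetric]) (use B inc in auto)
  also have "\<dots> = (SUP n. emeasure halfline (B n))" by (simp only: eq)
  also have "\<dots> = emeasure halfline (\<Union>n. B n)"
    by (rule SUP_emeasure_incseq) (use B inc in auto)
  finally show "emeasure (distr ?M halfline \<phi>) A = emeasure halfline A" by (simp add: UN)
qed simp

lemma nn_integral_halfline:
  assumes F: "F \<in> borel_measurable halfline"
  shows "(\<integral>\<^sup>+r. F r \<partial>halfline) = (\<integral>\<^sup>+y. ennreal (\<bar>m\<bar> * \<phi> y) * F (\<phi> y) \<partial>lebesgue)"
proof -
  have phiM: "\<phi> \<in> measurable (density lebesgue (\<lambda>y. ennreal (\<bar>m\<bar> * \<phi> y))) halfline"
    using phi_measurable by (simp cong: measurable_cong_sets)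
  show ?thesis
    by (subst distr_phi[symmetric], subst nn_integral_distr[OF phiM], simp add: F, subst nn_integral_density)
       (use phi_comp_measurable[OF F] in auto)
qed

lemma
  fixes F :: "real \<Rightarrow> 'a::{banach, second_countable_topology}"
  assumes F: "F \<in> borel_measurable halfline"
  shows integrable_halfline: "integrable halfline F \<longleftrightarrow> integrable lebesgue (\<lambda>y. (\<bar>m\<bar> * \<phi> y) *\<^sub>R F (\<phi> y))"
    and integral_halfline: "(\<integral>r. F r \<partial>halfline) = (\<integral>y. (\<bar>m\<bar> * \<phi> y) *\<^sub>R F (\<phi> y) \<partial>lebesgue)"
proof -
  have phiM: "\<phi> \<in> measurable (density lebesgue (\<lambda>y. ennreal (\<bar>m\<bar> * \<phi> y))) halfline"
    using phi_measurable by (simp cong: measurable_cong_sets)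
  have "integrable halfline F \<longleftrightarrow> integrable (density lebesgue (\<lambda>y. ennreal (\<bar>m\<bar> * \<phi> y))) (\<lambda>y. F (\<phi> y))"
    by (subst distr_phi[symmetric], rule integrable_distr_eq[OF phiM F])
  also have "\<dots> \<longleftrightarrow> integrable lebesgue (\<lambda>y. (\<bar>m\<bar> * \<phi> y) *\<^sub>R F (\<phi> y))"
    by (rule integrable_density) (use phi_comp_measurable[OF F] in \<open>auto simp: less_imp_le\<close>)
  finally show "integrable halfline F \<longleftrightarrow> integrable lebesgue (\<lambda>y. (\<bar>m\<bar> * \<phi> y) *\<^sub>R F (\<phi> y))" .
  have "(\<integral>r. F r \<partial>halfline) = (\<integral>y. F (\<phi> y) \<partial>density lebesgue (\<lambda>y. ennreal (\<bar>m\<bar> * \<phi> y)))"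
    by (subst distr_phi[symmetric], rule integral_distr[OF phiM F])
  also have "\<dots> = (\<integral>y. (\<bar>m\<bar> * \<phi> y) *\<^sub>R F (\<phi> y) \<partial>lebesgue)"
    by (rule integral_density) (use phi_comp_measurable[OF F] in \<open>auto simp: less_imp_le\<close>)
  finally show "(\<integral>r. F r \<partial>halfline) = (\<integral>y. (\<bar>m\<bar> * \<phi> y) *\<^sub>R F (\<phi> y) \<partial>lebesgue)" .
qed

end

section \<open>The unitary map to the weighted line\<close>

text \<open>The weight condition says that \<open>exp ((2 - \<sigma>) * x)\<close>, the weight that belongs to \<open>\<sigma>\<close> in the
  coordinate \<open>x = ln r\<close>, becomes \<open>exp (\<tau> * y)\<close> for \<open>x = m * y + d\<close>. One factor \<open>\<bar>m\<bar>\<close> is the Jacobian, the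
  other one compensates the normalization \<open>1 / sqrt \<bar>m\<bar>\<close> in \<open>G\<close>, which makes the kinetic energy
  independent of \<open>m\<close>.\<close>

locale log_unitary = log_subst m d for m d +
  fixes \<sigma> \<tau> :: real
  assumes weight: "\<And>y. m\<^sup>2 * exp ((2 - \<sigma>) * (m * y + d)) = exp (\<tau> * y)"
begin

definition \<kappa> :: real where "\<kappa> = (\<sigma> - 1) / 2"

definition G :: "(real \<Rightarrow> complex) \<Rightarrow> real \<Rightarrow> complex" where
  "G u y = complex_of_real (exp (\<kappa> * (m * y + d)) / sqrt \<bar>m\<bar>) * u (\<phi> y)"

definition H :: "(real \<Rightarrow> complex) \<Rightarrow> real \<Rightarrow> complex" where
  "H g r = (if 0 < r then complex_of_real (sqrt \<bar>m\<bar> * r powr (- \<kappa>)) * g (\<psi> r) else 0)"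

lemma G_H: "G (H g) = g"
proof
  fix y
  have "exp (\<kappa> * (m * y + d)) / sqrt \<bar>m\<bar> * (sqrt \<bar>m\<bar> * \<phi> y powr (- \<kappa>)) = 1"
    using m_nz by (simp add: \<phi>_def powr_def exp_minus flip: exp_add)
  then have "complex_of_real (exp (\<kappa> * (m * y + d)) / sqrt \<bar>m\<bar>) * complex_of_real (sqrt \<bar>m\<bar> * \<phi> y powr (- \<kappa>)) = 1"
    by (metis of_real_1 of_real_mult)
  then show "G (H g) y = g y" by (simp add: G_def H_def flip: mult.assoc del: of_real_mult of_real_divide)
qed

lemma H_G: "0 < r \<Longrightarrow> H (G u) r = u r"
proof -
  assume r: "0 < r"
  then have "exp (\<kappa> * (m * \<psi> r + d)) = r powr \<kappa>"
    using m_nz by (simp add: \<psi>_def powr_def)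
  then have "sqrt \<bar>m\<bar> * r powr (- \<kappa>) * (exp (\<kappa> * (m * \<psi> r + d)) / sqrt \<bar>m\<bar>) = 1"
    using m_nz r by (simp flip: powr_add)
  then have "complex_of_real (sqrt \<bar>m\<bar> * r powr (- \<kappa>)) * complex_of_real (exp (\<kappa> * (m * \<psi> r + d)) / sqrt \<bar>m\<bar>) = 1"
    by (metis of_real_1 of_real_mult)
  then show ?thesis using r by (simp add: G_def H_def flip: mult.assoc del: of_real_mult of_real_divide)
qed

lemma G_measurable: "u \<in> borel_measurable halfline \<Longrightarrow> G u \<in> borel_measurable lebesgue"
proof -
  assume [measurable]: "u \<in> borel_measurable halfline"
  have e: "(\<lambda>y. exp (\<kappa> * (m * y + d))) \<in> borel_measurable lebesgue"
    by (intro continuous_lebesgue_measurable continuous_intros)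
  show ?thesis unfolding G_def[abs_def] using e by measurable
qed

lemma H_measurable: "g \<in> borel_measurable lebesgue \<Longrightarrow> H g \<in> borel_measurable halfline"
proof -
  assume g: "g \<in> borel_measurable lebesgue"
  have "(\<lambda>r. complex_of_real (sqrt \<bar>m\<bar> * r powr (- \<kappa>)) * g (\<psi> r)) \<in> borel_measurable halfline"
  proof -
    have [measurable]: "(\<lambda>r. g (\<psi> r)) \<in> borel_measurable halfline" by (rule psi_comp_measurable[OF g])
    have [measurable]: "(\<lambda>r. r) \<in> borel_measurable halfline"
      using id_borel_measurable_lebesgue_on[of "{0<..}"] by (simp add: id_def)
    show ?thesis by measurable
  qed
  then show ?thesis
    by (rule measurable_cong[THEN iffD1, rotated]) (simp add: H_def)
qed

lemma weight_eq: "exp (\<tau> * y) * (exp (\<kappa> * (m * y + d)) / sqrt \<bar>m\<bar>)\<^sup>2 = \<bar>m\<bar> * \<phi> y"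
proof -
  have "(exp (\<kappa> * (m * y + d)) / sqrt \<bar>m\<bar>)\<^sup>2 = exp ((\<sigma> - 1) * (m * y + d)) / \<bar>m\<bar>"
    by (simp add: power_divide \<kappa>_def flip: exp_double)
  then have "exp (\<tau> * y) * (exp (\<kappa> * (m * y + d)) / sqrt \<bar>m\<bar>)\<^sup>2 =
      (m\<^sup>2 / \<bar>m\<bar>) * (exp ((2 - \<sigma>) * (m * y + d)) * exp ((\<sigma> - 1) * (m * y + d)))"
    by (simp flip: weight)
  also have "exp ((2 - \<sigma>) * (m * y + d)) * exp ((\<sigma> - 1) * (m * y + d)) = \<phi> y"
    by (simp add: \<phi>_def algebra_simps flip: exp_add)
  also have "m\<^sup>2 / \<bar>m\<bar> = \<bar>m\<bar>" by (simp add: power2_eq_square abs_if)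
  finally show ?thesis .
qed

lemma G_mult:
  "exp (\<tau> * y) *\<^sub>R (w * (G u y * cnj (G v y))) = (\<bar>m\<bar> * \<phi> y) *\<^sub>R (w * (u (\<phi> y) * cnj (v (\<phi> y))))"
proof -
  define c where "c = exp (\<kappa> * (m * y + d)) / sqrt \<bar>m\<bar>"
  have G: "G f y = complex_of_real c * f (\<phi> y)" for f by (simp only: G_def c_def)
  have "exp (\<tau> * y) *\<^sub>R (w * (G u y * cnj (G v y))) =
      complex_of_real (exp (\<tau> * y) * c\<^sup>2) * (w * (u (\<phi> y) * cnj (v (\<phi> y))))"
    by (simp add: G scaleR_conv_of_real power2_eq_square mult_ac)
  then show ?thesis by (simp only: weight_eq c_def scaleR_conv_of_real)
qed

lemma G_norm_sq:
  "exp (\<tau> * y) * (w * (cmod (G u y))\<^sup>2) = (\<bar>m\<bar> * \<phi> y) * (w * (cmod (u (\<phi> y)))\<^sup>2)"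
proof -
  have "(cmod (G u y))\<^sup>2 = (exp (\<kappa> * (m * y + d)) / sqrt \<bar>m\<bar>)\<^sup>2 * (cmod (u (\<phi> y)))\<^sup>2"
    by (simp add: G_def norm_mult power_mult_distrib norm_divide power_divide)
  then have "exp (\<tau> * y) * (w * (cmod (G u y))\<^sup>2) =
      (exp (\<tau> * y) * (exp (\<kappa> * (m * y + d)) / sqrt \<bar>m\<bar>)\<^sup>2) * (w * (cmod (u (\<phi> y)))\<^sup>2)"
    by (simp only: mult_ac)
  then show ?thesis by (simp only: weight_eq)
qed

lemma
  assumes [measurable]: "w \<in> borel_measurable halfline" "u \<in> borel_measurable halfline" "v \<in> borel_measurable halfline"
  shows G_weighted_integrable: "integrable (weighted_line \<tau>) (\<lambda>y. w (\<phi> y) * (G u y * cnj (G v y))) \<longleftrightarrow>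
      integrable halfline (\<lambda>r. w r * (u r * cnj (v r)))"
    and G_weighted_integral: "(\<integral>y. w (\<phi> y) * (G u y * cnj (G v y)) \<partial>weighted_line \<tau>) =
      (\<integral>r. w r * (u r * cnj (v r)) \<partial>halfline)"
proof -
  have cm: "(\<lambda>x. cnj (f x)) \<in> borel_measurable M" if "f \<in> borel_measurable M" for f :: "real \<Rightarrow> complex" and M
    using borel_measurable_continuous_on[OF continuous_on_cnj[OF continuous_on_id] that] .
  have [measurable]: "(\<lambda>x. cnj (v x)) \<in> borel_measurable halfline" "(\<lambda>x. cnj (G v x)) \<in> borel_measurable lebesgue"
    by (intro cm G_measurable assms)+
  have [measurable]: "G u \<in> borel_measurable lebesgue" by (rule G_measurable) (rule assms)
  show "integrable (weighted_line \<tau>) (\<lambda>y. w (\<phi> y) * (G u y * cnj (G v y))) \<longleftrightarrow>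
      integrable halfline (\<lambda>r. w r * (u r * cnj (v r)))"
    by (subst integrable_weighted_line, measurable, subst integrable_halfline, measurable)
       (simp only: G_mult)
  show "(\<integral>y. w (\<phi> y) * (G u y * cnj (G v y)) \<partial>weighted_line \<tau>) =
      (\<integral>r. w r * (u r * cnj (v r)) \<partial>halfline)"
    by (subst integral_weighted_line, measurable, subst integral_halfline, measurable)
       (simp only: G_mult)
qed

lemma G_weighted_integrable_norm:
  assumes [measurable]: "w \<in> borel_measurable halfline" "u \<in> borel_measurable halfline"
  shows "integrable (weighted_line \<tau>) (\<lambda>y. w (\<phi> y) * (cmod (G u y))\<^sup>2) \<longleftrightarrow>
      integrable halfline (\<lambda>r. w r * (cmod (u r))\<^sup>2)"
proof -
  have [measurable]: "G u \<in> borel_measurable lebesgue" by (rule G_measurable) (rule assms)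
  show ?thesis
    by (subst integrable_weighted_line, measurable, subst integrable_halfline, measurable)
       (simp only: real_scaleR_def G_norm_sq)
qed

lemma G_L2_iff: "u \<in> borel_measurable halfline \<Longrightarrow> G u \<in> L2 (weighted_line \<tau>) \<longleftrightarrow> u \<in> L2 halfline"
  using G_weighted_integrable_norm[of "\<lambda>_. 1" u] G_measurable[of u]
  by (simp add: L2_def borel_measurable_weighted_line)

lemma G_inner_eq:
  "u \<in> borel_measurable halfline \<Longrightarrow> v \<in> borel_measurable halfline \<Longrightarrow>
    L2_inner (weighted_line \<tau>) (G u) (G v) = L2_inner halfline u v"
  using G_weighted_integral[of "\<lambda>_. 1" u v] by (simp add: L2_inner_def)

sublocale L2_iso halfline "weighted_line \<tau>" G H
proof unfold_locales
  have mL: "u \<in> borel_measurable halfline" if "u \<in> L2 halfline" for u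
    using that by (rule L2_measurable)
  have mH: "H g \<in> borel_measurable halfline" if "g \<in> L2 (weighted_line \<tau>)" for g
    using L2_measurable[OF that] H_measurable by (simp add: borel_measurable_weighted_line)
  show "G u \<in> L2 (weighted_line \<tau>)" if "u \<in> L2 halfline" for u
    using that G_L2_iff mL by blast
  show "H g \<in> L2 halfline" if "g \<in> L2 (weighted_line \<tau>)" for g
    using that G_L2_iff[OF mH[OF that]] by (simp add: G_H)
  show "L2_inner (weighted_line \<tau>) (G u) (G v) = L2_inner halfline u v"
    if "u \<in> L2 halfline" "v \<in> L2 halfline" for u v
    using that mL G_inner_eq by blast
  show "L2_inner halfline (H g) (H h) = L2_inner (weighted_line \<tau>) g h"
    if "g \<in> L2 (weighted_line \<tau>)" "h \<in> L2 (weighted_line \<tau>)" for g h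
    using G_inner_eq[OF mH[OF that(1)] mH[OF that(2)]] by (simp add: G_H)
  show "AE x in halfline. H (G u) x = u x" if "u \<in> L2 halfline" for u
    by (rule AE_I2) (simp add: H_G)
  show "AE y in weighted_line \<tau>. G (H g) y = g y" if "g \<in> L2 (weighted_line \<tau>)" for g
    by (simp add: G_H)
  show "G (\<lambda>x. u x - v x) = (\<lambda>y. G u y - G v y)" for u v
    by (simp add: G_def[abs_def] right_diff_distrib diff_divide_distrib)
  show "H (\<lambda>y. g y - h y) = (\<lambda>x. H g x - H h x)" for g h
    by (auto simp: H_def[abs_def] right_diff_distrib)
qed

end

section \<open>The kinetic energy on the line\<close>

abbreviation (input) line_test :: "(real \<Rightarrow> complex) set" where
  "line_test \<equiv> test_functions UNIV"

lemma laplace_form_eq: "laplace_form u v = L2_inner lebesgue (vderiv u) (vderiv v)"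
  by (simp add: laplace_form_def L2_inner_def)

lemma test_functions_UNIV_support:
  assumes "g \<in> line_test"
  shows "\<exists>R>0. \<forall>x. R \<le> \<bar>x\<bar> \<longrightarrow> g x = 0"
proof -
  from assms obtain K where K: "compact K" "\<And>x. x \<notin> K \<Longrightarrow> g x = 0"
    by (auto simp: test_functions_def)
  obtain B where B: "\<And>x. x \<in> K \<Longrightarrow> \<bar>x\<bar> \<le> B"
    using compact_imp_bounded[OF K(1)] by (auto simp: bounded_iff)
  have "g x = 0" if "max B 0 + 1 \<le> \<bar>x\<bar>" for x using K(2)[of x] B[of x] that by force
  then show ?thesis by (intro exI[of _ "max B 0 + 1"]) auto
qed

lemma test_functions_UNIV_I:
  assumes "smooth_on UNIV g" "\<And>x. R < \<bar>x\<bar> \<Longrightarrow> g x = 0"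
  shows "g \<in> line_test"
  unfolding test_functions_def using assms by (auto intro!: exI[of _ "{-R..R}"])

lemma vderiv_eq_0:
  assumes "\<And>x. R \<le> \<bar>x\<bar> \<Longrightarrow> g x = 0" "R < \<bar>x\<bar>"
  shows "vderiv g x = 0"
proof -
  have o: "open {x::real. R < \<bar>x\<bar>}" by (intro open_Collect_less continuous_intros)
  have "((\<lambda>x. 0) has_vector_derivative (0::complex)) (at x)" by simp
  then have "(g has_vector_derivative 0) (at x)"
    by (rule has_vector_derivative_transform_within_open[OF _ o]) (use assms in auto)
  then show ?thesis by (rule vector_derivative_at)
qed

lemma vderiv_test_function:
  assumes "g \<in> line_test"
  shows "vderiv g \<in> line_test"
proof -
  obtain R where "0 < R" and R: "\<And>x. R \<le> \<bar>x\<bar> \<Longrightarrow> g x = 0" using test_functions_UNIV_support[OF assms] by blast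
  show ?thesis
  proof (rule test_functions_UNIV_I[where R=R])
    show "smooth_on UNIV (vderiv g)" using assms by (intro smooth_vderiv) (simp add: test_functions_def)
    show "vderiv g x = 0" if "R < \<bar>x\<bar>" for x by (rule vderiv_eq_0[OF R that])
  qed
qed

lemma test_functions_smooth: "g \<in> test_functions S \<Longrightarrow> smooth_on S g"
  by (simp add: test_functions_def)

lemma smooth_lebesgue_measurable: "smooth_on UNIV g \<Longrightarrow> g \<in> borel_measurable lebesgue"
  by (intro continuous_lebesgue_measurable smooth_on_continuous)

lemma test_functions_mult_smooth:
  assumes "g \<in> line_test" "smooth_on UNIV f"
  shows "(\<lambda>x. g x * f x) \<in> line_test"
proof -
  obtain R where "0 < R" and R: "\<And>x. R \<le> \<bar>x\<bar> \<Longrightarrow> g x = 0" using test_functions_UNIV_support[OF assms(1)] by blast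
  show ?thesis
    by (rule test_functions_UNIV_I[where R=R])
       (use R assms test_functions_smooth in \<open>auto intro: smooth_on_mult\<close>)
qed

lemma cutoff_test_function: "cutoff n \<in> line_test"
  by (rule test_functions_UNIV_I[OF smooth_cutoff, of "2 * real (Suc n)"]) (simp add: cutoff_eq_0)

lemma test_functions_diff:
  assumes "g \<in> line_test" "h \<in> line_test"
  shows "(\<lambda>x. g x - h x) \<in> line_test"
proof -
  obtain R where "0 < R" and R: "\<And>x. R \<le> \<bar>x\<bar> \<Longrightarrow> g x = 0" using test_functions_UNIV_support[OF assms(1)] by blast
  obtain Q where "0 < Q" and Q: "\<And>x. Q \<le> \<bar>x\<bar> \<Longrightarrow> h x = 0" using test_functions_UNIV_support[OF assms(2)] by blast
  show ?thesis
    by (rule test_functions_UNIV_I[where R="max R Q"])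
       (use R Q assms test_functions_smooth in \<open>auto intro: smooth_on_diff\<close>)
qed

lemma continuous_compact_support_integrable:
  fixes F :: "real \<Rightarrow> 'a::{banach, second_countable_topology}"
  assumes c: "continuous_on UNIV F" and z: "\<And>x. R < \<bar>x\<bar> \<Longrightarrow> F x = 0"
  shows "integrable lebesgue F"
proof -
  have "compact (F ` {-R..R})"
    by (intro compact_continuous_image continuous_on_subset[OF c]) auto
  then obtain C where C: "\<And>x. x \<in> {-R..R} \<Longrightarrow> norm (F x) \<le> C"
    using compact_imp_bounded bounded_iff by (metis imageI)
  show ?thesis
  proof (rule Bochner_Integration.integrable_bound)
    show "integrable lebesgue (\<lambda>x. C * indicator {-R..R} x)"
      by (intro integrable_mult_right integrable_real_indicator) (auto simp: emeasure_lborel_Icc_eq)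
    show "F \<in> borel_measurable lebesgue" by (rule continuous_lebesgue_measurable[OF c])
    have "norm (F x) \<le> norm (C * indicator {-R..R} x)" for x
    proof (cases "x \<in> {-R..R}")
      case True then show ?thesis using C[OF True] by simp
    next
      case False then have "R < \<bar>x\<bar>" by auto
      then show ?thesis using z by simp
    qed
    then show "AE x in lebesgue. norm (F x) \<le> norm (C * indicator {-R..R} x)" by simp
  qed
qed

lemma test_function_L2:
  assumes "g \<in> line_test"
  shows "g \<in> L2 lebesgue" "g \<in> L2 (weighted_line \<tau>)"
proof -
  obtain R where "0 < R" and R: "\<And>x. R \<le> \<bar>x\<bar> \<Longrightarrow> g x = 0" using test_functions_UNIV_support[OF assms] by blast
  have c: "continuous_on UNIV g" using assms by (intro smooth_on_continuous test_functions_smooth)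
  have m: "g \<in> borel_measurable lebesgue" by (rule continuous_lebesgue_measurable[OF c])
  have "integrable lebesgue (\<lambda>x. (cmod (g x))\<^sup>2)"
    by (rule continuous_compact_support_integrable[where R=R]) (use R in \<open>auto intro!: continuous_intros c\<close>)
  then show "g \<in> L2 lebesgue" using m by (simp add: L2_def)
  have "integrable lebesgue (\<lambda>x. exp (\<tau> * x) *\<^sub>R (cmod (g x))\<^sup>2)"
    by (rule continuous_compact_support_integrable[where R=R]) (use R in \<open>auto intro!: continuous_intros c\<close>)
  moreover have "(\<lambda>x. (cmod (g x))\<^sup>2) \<in> borel_measurable lebesgue" using m by measurable
  ultimately show "g \<in> L2 (weighted_line \<tau>)"
    using m by (simp add: L2_def borel_measurable_weighted_line integrable_weighted_line)
qed

text \<open>Large enough for the images of the domains of all forms \<open>h\<^sub>\<sigma>\<close>, small enough for cut-offs to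
  converge in the form norm: for the latter the function itself has to be square integrable without
  weight.\<close>

definition line_core :: "real \<Rightarrow> (real \<Rightarrow> complex) set" where
  "line_core \<tau> = {g. smooth_on UNIV g \<and> g \<in> L2 lebesgue \<and> vderiv g \<in> L2 lebesgue \<and> g \<in> L2 (weighted_line \<tau>)}"

lemma test_functions_line_core: "line_test \<subseteq> line_core \<tau>"
  unfolding line_core_def using test_function_L2 vderiv_test_function test_functions_smooth by blast

lemma vderiv_diff:
  assumes "smooth_on UNIV g" "smooth_on UNIV h"
  shows "vderiv (\<lambda>x. g x - h x) = (\<lambda>x. vderiv g x - vderiv h x)"
  by (rule ext, rule vector_derivative_at, intro has_vector_derivative_diff smooth_vderiv assms)

lemma vderiv_mult:
  assumes "smooth_on UNIV g" "smooth_on UNIV h"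
  shows "vderiv (\<lambda>x. g x * h x) = (\<lambda>x. g x * vderiv h x + vderiv g x * h x)"
  by (rule ext, rule vector_derivative_at, intro has_vector_derivative_mult smooth_vderiv assms)

lemma square_form_laplace:
  assumes "D \<subseteq> line_core \<tau>"
  shows "square_form (weighted_line \<tau>) lebesgue D vderiv laplace_form"
proof
  show "D \<subseteq> L2 (weighted_line \<tau>)" using assms by (auto simp: line_core_def)
  show "vderiv u \<in> L2 lebesgue" if "u \<in> D" for u using assms that by (auto simp: line_core_def)
  show "vderiv (\<lambda>x. u x - v x) = (\<lambda>y. vderiv u y - vderiv v y)" if "u \<in> D" "v \<in> D" for u v
    using assms that by (intro vderiv_diff) (auto simp: line_core_def)
  show "laplace_form u v = L2_inner lebesgue (vderiv u) (vderiv v)" for u v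
    by (rule laplace_form_eq)
qed

lemma integral_derivative_compact_support:
  assumes F: "\<And>x. (F has_vector_derivative F' x) (at x)" and c: "continuous_on UNIV F'"
    and z: "\<And>x. R \<le> \<bar>x\<bar> \<Longrightarrow> F x = (0::complex)" and R: "0 < R"
  shows "(\<integral>x. F' x \<partial>lebesgue) = 0"
proof -
  have z': "F' x = 0" if "R < \<bar>x\<bar>" for x
    using vderiv_eq_0[OF z that] vector_derivative_at[OF F[of x]] by simp
  have "(F' has_integral (F R - F (-R))) {-R..R}"
    by (rule fundamental_theorem_of_calculus) (use R in simp, rule has_vector_derivative_at_within[OF F])
  then have "(F' has_integral 0) {-R..R}" using z R by simp
  then have "(F' has_integral 0) UNIV"
    by (rule has_integral_on_superset) (use z' in \<open>auto simp: abs_real_def split: if_splits\<close>)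
  moreover have "integrable lebesgue F'"
    by (rule continuous_compact_support_integrable[OF c z'])
  ultimately show ?thesis
    using has_integral_integral_lebesgue has_integral_unique by blast
qed

lemma cutoff_eventually_1: "\<forall>\<^sub>F n in sequentially. cutoff n x = 1"
proof -
  obtain N where N: "\<bar>x\<bar> \<le> real N" using real_arch_simple by blast
  show ?thesis
    by (rule eventually_sequentiallyI[of N], rule cutoff_eq_1) (use N in linarith)
qed

text \<open>Integrability of \<open>F\<close> and \<open>F'\<close> already makes the boundary terms vanish: multiply \<open>F\<close> by cut-off
  functions, whose derivatives tend to \<open>0\<close> uniformly.\<close>

lemma integral_derivative_eq_0:
  assumes F: "\<And>x. (F has_vector_derivative F' x) (at x)" and c: "continuous_on UNIV F'"
    and i: "integrable lebesgue F" "integrable lebesgue F'"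
  shows "(\<integral>x. F' x \<partial>lebesgue) = (0::complex)"
proof -
  obtain C where C0: "0 < C \<and> (\<forall>n x. cmod (vderiv (cutoff n) x) \<le> C / real (Suc n)) \<and>
      (\<forall>n x. 2 * real (Suc n) < \<bar>x\<bar> \<longrightarrow> vderiv (cutoff n) x = 0)"
    using cutoff_derivative_bound ..
  note C = conjunct1[OF C0] conjunct1[OF conjunct2[OF C0], rule_format]
  note sc = smooth_vderiv[OF smooth_cutoff]
  have mc: "cutoff n \<in> borel_measurable lebesgue" "vderiv (cutoff n) \<in> borel_measurable lebesgue" for n
    by (intro smooth_lebesgue_measurable smooth_cutoff sc)+
  have cF: "continuous_on UNIV F"
    by (intro continuous_at_imp_continuous_on ballI has_vector_derivative_continuous[OF F])
  have i1: "integrable lebesgue (\<lambda>x. cutoff n x * F' x)" for n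
  proof (rule Bochner_Integration.integrable_bound[OF i(2)])
    show "(\<lambda>x. cutoff n x * F' x) \<in> borel_measurable lebesgue"
      using mc[of n] i(2)[THEN borel_measurable_integrable] by measurable
    show "AE x in lebesgue. cmod (cutoff n x * F' x) \<le> cmod (F' x)"
      using cutoff_le_1 by (simp add: norm_mult mult_left_le_one_le)
  qed
  have b2: "cmod (vderiv (cutoff n) x * F x) \<le> C / real (Suc n) * cmod (F x)" for n x
    unfolding norm_mult by (rule mult_right_mono[OF C(2)]) simp
  have i2: "integrable lebesgue (\<lambda>x. vderiv (cutoff n) x * F x)" for n
  proof (rule Bochner_Integration.integrable_bound)
    show "integrable lebesgue (\<lambda>x. C / real (Suc n) * cmod (F x))"
      using i(1) by (intro integrable_mult_right integrable_norm)
    show "(\<lambda>x. vderiv (cutoff n) x * F x) \<in> borel_measurable lebesgue"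
      using mc[of n] i(1)[THEN borel_measurable_integrable] by measurable
    show "AE x in lebesgue. cmod (vderiv (cutoff n) x * F x) \<le> norm (C / real (Suc n) * cmod (F x))"
      using b2 C(1) by (simp del: of_nat_Suc)
  qed
  have eq: "(\<integral>x. cutoff n x * F' x \<partial>lebesgue) = - (\<integral>x. vderiv (cutoff n) x * F x \<partial>lebesgue)" for n
  proof -
    have "(\<integral>x. cutoff n x * F' x + vderiv (cutoff n) x * F x \<partial>lebesgue) = 0"
    proof (rule integral_derivative_compact_support[where R="2 * real (Suc n)"])
      show "((\<lambda>x. cutoff n x * F x) has_vector_derivative cutoff n x * F' x + vderiv (cutoff n) x * F x) (at x)" for x
        by (intro has_vector_derivative_mult sc F)
      show "continuous_on UNIV (\<lambda>x. cutoff n x * F' x + vderiv (cutoff n) x * F x)"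
        by (intro continuous_intros smooth_on_continuous smooth_cutoff sc c cF)
      show "cutoff n x * F x = 0" if "2 * real (Suc n) \<le> \<bar>x\<bar>" for x
        using cutoff_eq_0[OF that] by simp
    qed simp
    then show ?thesis by (simp add: Bochner_Integration.integral_add[OF i1 i2] eq_neg_iff_add_eq_0)
  qed
  have "(\<lambda>n. \<integral>x. cutoff n x * F' x \<partial>lebesgue) \<longlonglongrightarrow> (\<integral>x. F' x \<partial>lebesgue)"
  proof (rule integral_dominated_convergence[where w="\<lambda>x. cmod (F' x)"])
    show "AE x in lebesgue. (\<lambda>n. cutoff n x * F' x) \<longlonglongrightarrow> F' x"
    proof (rule AE_I2)
      fix x show "(\<lambda>n. cutoff n x * F' x) \<longlonglongrightarrow> F' x"
        by (rule tendsto_eventually) (use cutoff_eventually_1[of x] in \<open>auto elim: eventually_mono\<close>)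
    qed
    show "AE x in lebesgue. norm (cutoff n x * F' x) \<le> cmod (F' x)" for n
      using cutoff_le_1 by (simp add: norm_mult mult_left_le_one_le)
  qed (use i i1 in auto)
  moreover have "(\<lambda>n. \<integral>x. cutoff n x * F' x \<partial>lebesgue) \<longlonglongrightarrow> 0"
  proof (rule Lim_null_comparison[OF always_eventually])
    show "(\<lambda>n. C * (\<integral>x. cmod (F x) \<partial>lebesgue) * (1 / real (Suc n))) \<longlonglongrightarrow> 0"
      using tendsto_mult_left[OF LIMSEQ_inverse_real_of_nat, of "C * (\<integral>x. cmod (F x) \<partial>lebesgue)"]
      by (simp add: inverse_eq_divide)
    show "\<forall>n. norm (\<integral>x. cutoff n x * F' x \<partial>lebesgue) \<le> C * (\<integral>x. cmod (F x) \<partial>lebesgue) * (1 / real (Suc n))"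
    proof
      fix n
      have "norm (\<integral>x. cutoff n x * F' x \<partial>lebesgue) = norm (\<integral>x. vderiv (cutoff n) x * F x \<partial>lebesgue)"
        by (simp add: eq)
      also have "\<dots> \<le> (\<integral>x. cmod (vderiv (cutoff n) x * F x) \<partial>lebesgue)" by (rule integral_norm_bound)
      also have "\<dots> \<le> (\<integral>x. C / real (Suc n) * cmod (F x) \<partial>lebesgue)"
        using i(1) i2[of n] b2 by (intro integral_mono integrable_mult_right integrable_norm) auto
      finally show "norm (\<integral>x. cutoff n x * F' x \<partial>lebesgue) \<le> C * (\<integral>x. cmod (F x) \<partial>lebesgue) * (1 / real (Suc n))"
        by simp
    qed
  qed
  ultimately show ?thesis by (rule LIMSEQ_unique)
qed

lemma L2_cutoff_tendsto:
  assumes u: "u \<in> L2 M" and m: "\<And>n. cutoff n \<in> borel_measurable M"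
  shows "(\<lambda>n. L2_norm M (\<lambda>x. u x - cutoff n x * u x)) \<longlonglongrightarrow> 0"
proof (rule L2_norm_tendsto_0I)
  have [measurable]: "u \<in> borel_measurable M" "cutoff n \<in> borel_measurable M" for n
    using u m by (auto simp: L2_def)
  have b: "(cmod (u x - cutoff n x * u x))\<^sup>2 \<le> 4 * (cmod (u x))\<^sup>2" for n x
  proof -
    have "cmod (u x - cutoff n x * u x) \<le> cmod (u x) + cmod (cutoff n x * u x)" by (rule norm_triangle_ineq4)
    also have "\<dots> \<le> 2 * cmod (u x)" using cutoff_le_1[of n x] by (simp add: norm_mult mult_left_le_one_le)
    finally have "(cmod (u x - cutoff n x * u x))\<^sup>2 \<le> (2 * cmod (u x))\<^sup>2" by (intro power_mono) auto
    then show ?thesis by (simp add: power_mult_distrib)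
  qed
  have "(\<lambda>n. \<integral>x. (cmod (u x - cutoff n x * u x))\<^sup>2 \<partial>M) \<longlonglongrightarrow> (\<integral>x. 0 \<partial>M)"
  proof (rule integral_dominated_convergence[where w="\<lambda>x. 4 * (cmod (u x))\<^sup>2"])
    show "integrable M (\<lambda>x. 4 * (cmod (u x))\<^sup>2)" using L2_integrable_square[OF u] by simp
    show "AE x in M. (\<lambda>n. (cmod (u x - cutoff n x * u x))\<^sup>2) \<longlonglongrightarrow> 0"
    proof (rule AE_I2)
      fix x show "(\<lambda>n. (cmod (u x - cutoff n x * u x))\<^sup>2) \<longlonglongrightarrow> 0"
        by (rule tendsto_eventually) (use cutoff_eventually_1[of x] in \<open>auto elim: eventually_mono\<close>)
    qed
  qed (use b in auto)
  then show "(\<lambda>n. \<integral>x. (cmod (u x - cutoff n x * u x))\<^sup>2 \<partial>M) \<longlonglongrightarrow> 0" by simp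
qed

lemma L2_norm_le_mult:
  assumes u: "u \<in> L2 M" and m: "v \<in> L2 M" and C: "0 \<le> C" and le: "\<And>x. cmod (v x) \<le> C * cmod (u x)"
  shows "L2_norm M v \<le> C * L2_norm M u"
proof (rule power2_le_imp_le)
  have "(L2_norm M v)\<^sup>2 \<le> (\<integral>x. C\<^sup>2 * (cmod (u x))\<^sup>2 \<partial>M)"
    unfolding L2_norm_square
  proof (rule integral_mono)
    show "integrable M (\<lambda>x. (cmod (v x))\<^sup>2)" by (rule L2_integrable_square[OF m])
    show "integrable M (\<lambda>x. C\<^sup>2 * (cmod (u x))\<^sup>2)" using L2_integrable_square[OF u] by simp
    show "(cmod (v x))\<^sup>2 \<le> C\<^sup>2 * (cmod (u x))\<^sup>2" for x
      using power_mono[OF le[of x], of 2] by (simp add: power_mult_distrib)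
  qed
  then show "(L2_norm M v)\<^sup>2 \<le> (C * L2_norm M u)\<^sup>2" by (simp add: power_mult_distrib L2_norm_square)
qed (use C in simp)

lemma cutoff_mult_vderiv:
  assumes "smooth_on UNIV g"
  shows "vderiv (\<lambda>x. cutoff n x * g x) x = cutoff n x * vderiv g x + vderiv (cutoff n) x * g x"
  using vderiv_mult[OF smooth_cutoff assms, THEN fun_cong] .

lemma test_functions_dense:
  assumes g: "g \<in> line_core \<tau>" and e: "0 < \<epsilon>"
  shows "\<exists>w\<in>line_test. L2_norm (weighted_line \<tau>) (\<lambda>x. g x - w x) < \<epsilon> \<and>
      L2_norm lebesgue (\<lambda>x. vderiv g x - vderiv w x) < \<epsilon>"
proof -
  obtain C where C0: "0 < C \<and> (\<forall>n x. cmod (vderiv (cutoff n) x) \<le> C / real (Suc n)) \<and>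
      (\<forall>n x. 2 * real (Suc n) < \<bar>x\<bar> \<longrightarrow> vderiv (cutoff n) x = 0)"
    using cutoff_derivative_bound ..
  note C = conjunct1[OF C0] conjunct1[OF conjunct2[OF C0], rule_format]
  have sg: "smooth_on UNIV g" and gL: "g \<in> L2 lebesgue" and g'L: "vderiv g \<in> L2 lebesgue"
    and gN: "g \<in> L2 (weighted_line \<tau>)" using g by (auto simp: line_core_def)
  note sc = smooth_vderiv[OF smooth_cutoff]
  have mc: "cutoff n \<in> borel_measurable lebesgue" "vderiv (cutoff n) \<in> borel_measurable lebesgue" for n
    by (intro smooth_lebesgue_measurable smooth_cutoff sc)+
  have l1: "(\<lambda>n. L2_norm (weighted_line \<tau>) (\<lambda>x. g x - cutoff n x * g x)) \<longlonglongrightarrow> 0"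
    by (rule L2_cutoff_tendsto[OF gN]) (simp add: borel_measurable_weighted_line mc)
  have l2: "(\<lambda>n. L2_norm lebesgue (\<lambda>x. vderiv g x - vderiv (\<lambda>x. cutoff n x * g x) x)) \<longlonglongrightarrow> 0"
  proof (rule Lim_null_comparison[OF always_eventually])
    show "(\<lambda>n. L2_norm lebesgue (\<lambda>x. vderiv g x - cutoff n x * vderiv g x) +
        C * L2_norm lebesgue g * (1 / real (Suc n))) \<longlonglongrightarrow> 0"
      using tendsto_add[OF L2_cutoff_tendsto[OF g'L mc(1)]
          tendsto_mult_left[OF LIMSEQ_inverse_real_of_nat, of "C * L2_norm lebesgue g"]]
      by (simp add: inverse_eq_divide)
    show "\<forall>n. norm (L2_norm lebesgue (\<lambda>x. vderiv g x - vderiv (\<lambda>x. cutoff n x * g x) x)) \<le>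
        L2_norm lebesgue (\<lambda>x. vderiv g x - cutoff n x * vderiv g x) + C * L2_norm lebesgue g * (1 / real (Suc n))"
    proof
      fix n
      have a: "(\<lambda>x. vderiv g x - cutoff n x * vderiv g x) \<in> L2 lebesgue"
        by (intro L2_diff g'L L2_bounded_mult[where C=1] mc cutoff_le_1)
      have b: "(\<lambda>x. vderiv (cutoff n) x * g x) \<in> L2 lebesgue"
        by (intro L2_bounded_mult[where C="C / real (Suc n)"] gL mc C)
      have "L2_norm lebesgue (\<lambda>x. vderiv g x - vderiv (\<lambda>x. cutoff n x * g x) x) =
          L2_norm lebesgue (\<lambda>x. (vderiv g x - cutoff n x * vderiv g x) - vderiv (cutoff n) x * g x)"
        unfolding cutoff_mult_vderiv[OF sg] by (simp add: diff_diff_eq)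
      also have "\<dots> \<le> L2_norm lebesgue (\<lambda>x. vderiv g x - cutoff n x * vderiv g x) +
          L2_norm lebesgue (\<lambda>x. vderiv (cutoff n) x * g x)"
        by (rule L2_norm_triangle_ineq4[OF a b])
      also have "L2_norm lebesgue (\<lambda>x. vderiv (cutoff n) x * g x) \<le> C / real (Suc n) * L2_norm lebesgue g"
      proof (rule L2_norm_le_mult[OF gL b])
        show "0 \<le> C / real (Suc n)" using C by (simp del: of_nat_Suc)
        show "cmod (vderiv (cutoff n) x * g x) \<le> C / real (Suc n) * cmod (g x)" for x
          unfolding norm_mult by (rule mult_right_mono[OF C(2)]) simp
      qed
      finally show "norm (L2_norm lebesgue (\<lambda>x. vderiv g x - vderiv (\<lambda>x. cutoff n x * g x) x)) \<le>
        L2_norm lebesgue (\<lambda>x. vderiv g x - cutoff n x * vderiv g x) + C * L2_norm lebesgue g * (1 / real (Suc n))"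
        by simp
    qed
  qed
  have "\<forall>\<^sub>F n in sequentially. L2_norm (weighted_line \<tau>) (\<lambda>x. g x - cutoff n x * g x) < \<epsilon> \<and>
      L2_norm lebesgue (\<lambda>x. vderiv g x - vderiv (\<lambda>x. cutoff n x * g x) x) < \<epsilon>"
    using order_tendstoD(2)[OF l1 e] order_tendstoD(2)[OF l2 e] by eventually_elim simp
  then obtain n where "L2_norm (weighted_line \<tau>) (\<lambda>x. g x - cutoff n x * g x) < \<epsilon> \<and>
      L2_norm lebesgue (\<lambda>x. vderiv g x - vderiv (\<lambda>x. cutoff n x * g x) x) < \<epsilon>"
    by (auto simp: eventually_sequentially)
  then show ?thesis
    by (intro bexI[of _ "\<lambda>x. cutoff n x * g x"] test_functions_mult_smooth cutoff_test_function sg)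
qed

lemma laplace_closure_core:
  assumes "line_test \<subseteq> D" "D \<subseteq> line_core \<tau>"
  shows "closure_dom (weighted_line \<tau>) D laplace_form = closure_dom (weighted_line \<tau>) line_test laplace_form"
    and "u \<in> L2 (weighted_line \<tau>) \<Longrightarrow> v \<in> L2 (weighted_line \<tau>) \<Longrightarrow>
      closure_form (weighted_line \<tau>) D laplace_form u v =
      closure_form (weighted_line \<tau>) line_test laplace_form u v"
proof -
  interpret square_form "weighted_line \<tau>" lebesgue D vderiv laplace_form
    by (rule square_form_laplace[OF assms(2)])
  have dense: "\<exists>w\<in>line_test. L2_norm (weighted_line \<tau>) (\<lambda>x. u x - w x) < \<epsilon> \<and>
      L2_norm lebesgue (\<lambda>x. vderiv u x - vderiv w x) < \<epsilon>" if "u \<in> D" "0 < \<epsilon>" for u \<epsilon>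
    using test_functions_dense[of u \<tau> \<epsilon>] that assms(2) by blast
  note * = closure_core[OF assms(1) dense]
  show "closure_dom (weighted_line \<tau>) D laplace_form = closure_dom (weighted_line \<tau>) line_test laplace_form"
    by (rule *(1))
  show "u \<in> L2 (weighted_line \<tau>) \<Longrightarrow> v \<in> L2 (weighted_line \<tau>) \<Longrightarrow>
      closure_form (weighted_line \<tau>) D laplace_form u v =
      closure_form (weighted_line \<tau>) line_test laplace_form u v"
    by (rule *(2))
qed

section \<open>Pointwise and form bounds on the line\<close>

text \<open>The square of the form norm, for the weight of the Hardy operator.\<close>

definition energy :: "(real \<Rightarrow> complex) \<Rightarrow> real" where
  "energy g = (L2_norm lebesgue (vderiv g))\<^sup>2 + (L2_norm (weighted_line 2) g)\<^sup>2"

lemma energy_nonneg: "0 \<le> energy g"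
  by (simp add: energy_def)

lemma energy_ge: "(L2_norm lebesgue (vderiv g))\<^sup>2 \<le> energy g" "(L2_norm (weighted_line 2) g)\<^sup>2 \<le> energy g"
  by (simp_all add: energy_def)

lemma L2_norm_weighted_line:
  assumes "g \<in> borel_measurable lebesgue"
  shows "(L2_norm (weighted_line \<tau>) g)\<^sup>2 = (\<integral>y. exp (\<tau> * y) * (cmod (g y))\<^sup>2 \<partial>lebesgue)"
proof -
  have [measurable]: "g \<in> borel_measurable lebesgue" by (rule assms)
  show ?thesis unfolding L2_norm_square by (subst integral_weighted_line) (auto)
qed

lemma weighted_line_integrable_square:
  assumes "g \<in> L2 (weighted_line \<tau>)"
  shows "integrable lebesgue (\<lambda>y. exp (\<tau> * y) * (cmod (g y))\<^sup>2)"
proof -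
  have [measurable]: "g \<in> borel_measurable lebesgue"
    using L2_measurable[OF assms] by (simp add: borel_measurable_weighted_line)
  have "(\<lambda>y. (cmod (g y))\<^sup>2) \<in> borel_measurable lebesgue" by measurable
  from integrable_weighted_line[OF this, of \<tau>] show ?thesis
    using L2_integrable_square[OF assms] by simp
qed

lemma test_function_FTC:
  assumes F: "\<And>x. (F has_vector_derivative F' x) (at x)" and c: "continuous_on UNIV F'" and ab: "a \<le> b"
  shows "integrable lebesgue (\<lambda>x. indicator {a..b} x *\<^sub>R F' x)"
    and "F b - F a = (\<integral>x. indicator {a..b} x *\<^sub>R F' x \<partial>lebesgue :: complex)"
proof -
  have "F' absolutely_integrable_on {a..b}"
    by (intro absolutely_integrable_continuous_real continuous_on_subset[OF c]) auto
  then have i: "set_integrable lebesgue {a..b} F'" .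
  then show "integrable lebesgue (\<lambda>x. indicator {a..b} x *\<^sub>R F' x)" by (simp add: set_integrable_def)
  have "(F' has_integral (F b - F a)) {a..b}"
    by (rule fundamental_theorem_of_calculus[OF ab], rule has_vector_derivative_at_within[OF F])
  moreover have "(F' has_integral (LINT x:{a..b}|lebesgue. F' x)) {a..b}"
    by (rule has_integral_set_lebesgue[OF i])
  ultimately show "F b - F a = (\<integral>x. indicator {a..b} x *\<^sub>R F' x \<partial>lebesgue)"
    using has_integral_unique by (auto simp: set_lebesgue_integral_def)
qed

lemma indicator_L2: 
  assumes "a \<le> b"
  shows "(\<lambda>x. indicator {a..b} x :: complex) \<in> L2 lebesgue"
    and "L2_norm lebesgue (\<lambda>x. indicator {a..b} x :: complex) = sqrt (b - a)"
proof -
  have sq: "(cmod (indicator {a..b} x))\<^sup>2 = indicator {a..b} x" for x :: real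
    by (simp add: indicator_def)
  have "(\<lambda>x. indicator {a..b} x :: complex) \<in> borel_measurable lebesgue"
    by (intro borel_measurable_indicator) auto
  moreover
  have "integrable lebesgue (indicator {a..b} :: real \<Rightarrow> real)"
    by (intro integrable_real_indicator) (auto simp: emeasure_lborel_Icc_eq)
  ultimately show "(\<lambda>x. indicator {a..b} x :: complex) \<in> L2 lebesgue"
    by (simp add: L2_def sq)
  show "L2_norm lebesgue (\<lambda>x. indicator {a..b} x :: complex) = sqrt (b - a)"
    using assms by (simp add: L2_norm_def sq)
qed

lemma test_function_Holder:
  assumes g: "g \<in> line_test"
  shows "(cmod (g x - g y))\<^sup>2 \<le> \<bar>x - y\<bar> * (L2_norm lebesgue (vderiv g))\<^sup>2"
proof -
  have sg: "smooth_on UNIV g" by (rule test_functions_smooth[OF g])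
  note d = smooth_vderiv[OF sg]
  have g'L: "vderiv g \<in> L2 lebesgue" by (rule test_function_L2[OF vderiv_test_function[OF g]])
  have main: "(cmod (g b - g a))\<^sup>2 \<le> (b - a) * (L2_norm lebesgue (vderiv g))\<^sup>2" if ab: "a \<le> b" for a b
  proof -
    note ftc = test_function_FTC[OF d(1) smooth_on_continuous[OF d(2)] ab]
    have "cmod (g b - g a) \<le> (\<integral>x. cmod (indicator {a..b} x *\<^sub>R vderiv g x) \<partial>lebesgue)"
      unfolding ftc(2) by (rule integral_norm_bound)
    also have "\<dots> = (\<integral>x. cmod (indicator {a..b} x) * cmod (vderiv g x) \<partial>lebesgue)"
      by (intro Bochner_Integration.integral_cong) (auto simp: indicator_def)
    also have "\<dots> \<le> sqrt (b - a) * L2_norm lebesgue (vderiv g)"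
      using L2_Cauchy_Schwarz_abs[OF indicator_L2(1)[OF ab] g'L] by (simp add: indicator_L2(2)[OF ab])
    finally have "(cmod (g b - g a))\<^sup>2 \<le> (sqrt (b - a) * L2_norm lebesgue (vderiv g))\<^sup>2"
      by (intro power_mono) auto
    then show ?thesis using ab by (simp add: power_mult_distrib)
  qed
  show ?thesis
  proof (cases "x \<le> y")
    case True then show ?thesis using main[OF True] by (simp add: norm_minus_commute)
  next
    case False then show ?thesis using main[of y x] by simp
  qed
qed

lemma norm_sq_le: "(cmod a)\<^sup>2 \<le> 2 * (cmod b)\<^sup>2 + 2 * (cmod (a - b))\<^sup>2"
proof -
  have "cmod a \<le> cmod b + cmod (a - b)" using norm_triangle_ineq[of b "a - b"] by simp
  then have "(cmod a)\<^sup>2 \<le> (cmod b + cmod (a - b))\<^sup>2" by (intro power_mono) auto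
  also have "\<dots> \<le> 2 * (cmod b)\<^sup>2 + 2 * (cmod (a - b))\<^sup>2"
    using two_mult_le_squares[of "cmod b" "cmod (a - b)"] by (simp add: power2_sum)
  finally show ?thesis .
qed

text \<open>Compare \<open>g 0\<close> with the values of \<open>g\<close> on \<open>{0..1}\<close>, where the weight is at least \<open>1\<close>, and average. From
  there the kinetic energy alone bounds \<open>\<bar>g x\<bar>\<^sup>2\<close> by a linear function of \<open>\<bar>x\<bar>\<close>; in the variable \<open>exp x\<close>
  this is the logarithm that accompanies the critical Hardy inequality.\<close>

lemma test_function_pointwise:
  assumes g: "g \<in> line_test"
  shows "(cmod (g x))\<^sup>2 \<le> 4 * (1 + \<bar>x\<bar>) * energy g"
proof -
  define t where "t = (L2_norm lebesgue (vderiv g))\<^sup>2"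
  have t: "0 \<le> t" "t \<le> energy g" using energy_ge(1)[of g] by (simp_all add: t_def)
  have gN: "g \<in> L2 (weighted_line 2)" by (rule test_function_L2[OF g])
  have gm: "g \<in> borel_measurable lebesgue" by (intro smooth_lebesgue_measurable test_functions_smooth g)
  note H = test_function_Holder[OF g, folded t_def]
  have le: "(cmod (g x))\<^sup>2 \<le> 2 * (cmod (g y))\<^sup>2 + 2 * (\<bar>x - y\<bar> * t)" for x y
    using norm_sq_le[of "g x" "g y"] H[of x y] by linarith
  have i1: "integrable lebesgue (indicator {0..1::real} :: real \<Rightarrow> real)"
    by (intro integrable_real_indicator) auto
  have "(\<integral>y. (cmod (g 0))\<^sup>2 * indicator {0..1::real} y \<partial>lebesgue) \<le>
      (\<integral>y. 2 * (exp (2 * y) * (cmod (g y))\<^sup>2) + 2 * t * indicator {0..1} y \<partial>lebesgue)"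
  proof (rule integral_mono)
    show "integrable lebesgue (\<lambda>y. (cmod (g 0))\<^sup>2 * indicator {0..1::real} y)" using i1 by simp
    show "integrable lebesgue (\<lambda>y. 2 * (exp (2 * y) * (cmod (g y))\<^sup>2) + 2 * t * indicator {0..1} y)"
      using i1 weighted_line_integrable_square[OF gN] by simp
    fix y :: real
    show "(cmod (g 0))\<^sup>2 * indicator {0..1} y \<le> 2 * (exp (2 * y) * (cmod (g y))\<^sup>2) + 2 * t * indicator {0..1} y"
    proof (cases "y \<in> {0..1}")
      case True
      have "(cmod (g 0))\<^sup>2 \<le> 2 * (cmod (g y))\<^sup>2 + 2 * (y * t)" using le[of 0 y] True by simp
      moreover have "y * t \<le> t" using True t by (simp add: mult_left_le_one_le)
      moreover have "1 * (cmod (g y))\<^sup>2 \<le> exp (2 * y) * (cmod (g y))\<^sup>2"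
        using True by (intro mult_right_mono) auto
      ultimately show ?thesis using True by simp
    qed simp
  qed
  also have "\<dots> = 2 * (\<integral>y. exp (2 * y) * (cmod (g y))\<^sup>2 \<partial>lebesgue) + 2 * t"
    using i1 weighted_line_integrable_square[OF gN] by simp
  also have "\<dots> = 2 * energy g"
    using L2_norm_weighted_line[OF gm, of 2] by (simp add: energy_def t_def)
  finally have "(cmod (g 0))\<^sup>2 \<le> 2 * energy g" by simp
  moreover have "\<bar>x\<bar> * t \<le> \<bar>x\<bar> * energy g" using t by (intro mult_left_mono) auto
  ultimately have "(cmod (g x))\<^sup>2 \<le> 4 * energy g + 2 * (\<bar>x\<bar> * energy g)"
    using le[of x 0] by simp
  also have "\<dots> \<le> 4 * (1 + \<bar>x\<bar>) * energy g"
    using energy_nonneg[of g] by (simp add: algebra_simps)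
  finally show ?thesis .
qed

text \<open>Write \<open>\<bar>g x\<bar>\<^sup>2\<close> as the integral of its derivative over the half-line to the right of \<open>x\<close>, where
  \<open>exp x\<close> is at most \<open>exp y\<close>, and apply the Cauchy-Schwarz inequality to \<open>exp y * g y\<close> and \<open>g'\<close>.\<close>

lemma test_function_pointwise_exp:
  assumes g: "g \<in> line_test"
  shows "exp x * (cmod (g x))\<^sup>2 \<le> energy g"
proof -
  obtain R where R: "0 < R \<and> (\<forall>x. R \<le> \<bar>x\<bar> \<longrightarrow> g x = 0)" using test_functions_UNIV_support[OF g] ..
  \<comment> \<open>Beyond \<open>b\<close> the function vanishes, so nothing is lost at the right end.\<close>
  define b where "b = max x R"
  have gb: "g b = 0" using R by (simp add: b_def)
  have xb: "x \<le> b" by (simp add: b_def)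
  have sg: "smooth_on UNIV g" by (rule test_functions_smooth[OF g])
  note d = smooth_vderiv[OF sg]
  have g'L: "vderiv g \<in> L2 lebesgue" by (rule test_function_L2[OF vderiv_test_function[OF g]])
  let ?F' = "\<lambda>y. g y * cnj (vderiv g y) + vderiv g y * cnj (g y)"
  have F: "((\<lambda>y. g y * cnj (g y)) has_vector_derivative ?F' y) (at y)" for y
    by (intro has_vector_derivative_mult has_vector_derivative_cnj d)
  have c: "continuous_on UNIV ?F'"
    by (intro continuous_intros smooth_on_continuous d sg)
  note ftc = test_function_FTC[OF F c xb]
  let ?u = "\<lambda>y. complex_of_real (exp y) * g y"
  have u: "?u \<in> line_test"
    using test_functions_mult_smooth[OF g smooth_on_exp[of UNIV 1 0]] by (simp add: mult.commute)
  have uL: "?u \<in> L2 lebesgue" by (rule test_function_L2[OF u])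
  have un: "(L2_norm lebesgue ?u)\<^sup>2 = (L2_norm (weighted_line 2) g)\<^sup>2"
  proof -
    have "g \<in> borel_measurable lebesgue" by (rule smooth_lebesgue_measurable[OF sg])
    from L2_norm_weighted_line[OF this, of 2] show ?thesis
      by (simp add: L2_norm_square norm_mult power_mult_distrib exp_double)
  qed
  have ii: "integrable lebesgue (\<lambda>y. cmod (?u y) * cmod (vderiv g y))"
    using integrable_norm[OF L2_integrable_mult[OF uL g'L]] by (simp add: norm_mult)
  have "exp x * (cmod (g x))\<^sup>2 = exp x * cmod (g b * cnj (g b) - g x * cnj (g x))"
    by (simp add: gb norm_mult power2_eq_square)
  also have "\<dots> \<le> exp x * (\<integral>y. cmod (indicator {x..b} y *\<^sub>R ?F' y) \<partial>lebesgue)"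
    unfolding ftc(2) by (intro mult_left_mono integral_norm_bound) auto
  also have "\<dots> = (\<integral>y. exp x * cmod (indicator {x..b} y *\<^sub>R ?F' y) \<partial>lebesgue)" by simp
  also have "\<dots> \<le> (\<integral>y. 2 * (cmod (?u y) * cmod (vderiv g y)) \<partial>lebesgue)"
  proof (rule integral_mono)
    show "integrable lebesgue (\<lambda>y. exp x * cmod (indicator {x..b} y *\<^sub>R ?F' y))"
      using ftc(1) by (intro integrable_mult_right integrable_norm)
    show "integrable lebesgue (\<lambda>y. 2 * (cmod (?u y) * cmod (vderiv g y)))"
      using ii by (intro integrable_mult_right)
    fix y
    show "exp x * cmod (indicator {x..b} y *\<^sub>R ?F' y) \<le> 2 * (cmod (?u y) * cmod (vderiv g y))"
    proof (cases "y \<in> {x..b}")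
      case True
      have "cmod (?F' y) \<le> 2 * (cmod (g y) * cmod (vderiv g y))"
        using norm_triangle_ineq[of "g y * cnj (vderiv g y)" "vderiv g y * cnj (g y)"] by (simp add: norm_mult)
      moreover have "exp x \<le> exp y" using True by simp
      ultimately have "exp x * cmod (?F' y) \<le> exp y * (2 * (cmod (g y) * cmod (vderiv g y)))"
        by (intro mult_mono) auto
      then show ?thesis using True by (simp add: norm_mult mult_ac)
    qed simp
  qed
  also have "\<dots> = 2 * (\<integral>y. cmod (?u y) * cmod (vderiv g y) \<partial>lebesgue)" by simp
  also have "\<dots> \<le> 2 * (L2_norm lebesgue ?u * L2_norm lebesgue (vderiv g))"
    using L2_Cauchy_Schwarz_abs[OF uL g'L] by simp
  also have "\<dots> \<le> (L2_norm lebesgue ?u)\<^sup>2 + (L2_norm lebesgue (vderiv g))\<^sup>2" by (rule two_mult_le_squares)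
  also have "\<dots> = energy g" by (simp add: energy_def un)
  finally show ?thesis .
qed

lemma integrable_exp_abs:
  assumes c: "0 < c"
  shows "integrable lebesgue (\<lambda>x::real. exp (- c * \<bar>x\<bar>))"
proof -
  define f where "f x = (if 0 \<le> x then exp (- c * x) else 0)" for x :: real
  have "((\<lambda>x. exp (- c * x)) has_integral exp (- c * 0) / c) {0..}"
    by (rule has_integral_exp_minus_to_infinity[OF c])
  then have "(\<lambda>x. exp (- c * x)) absolutely_integrable_on {0..}"
    by (intro nonnegative_absolutely_integrable_1) (auto simp: integrable_on_def)
  then have "integrable lebesgue (\<lambda>x. indicator {0..} x *\<^sub>R exp (- c * x))" by (simp add: set_integrable_def)
  also have "(\<lambda>x. indicator {0..} x *\<^sub>R exp (- c * x)) = f" by (auto simp: f_def fun_eq_iff)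
  finally have i: "integrable lebesgue f" .
  have i': "integrable lebesgue (\<lambda>x. f (0 + (-1) * x))" by (rule lebesgue_integrable_real_affine[OF i]) simp
  show ?thesis
  proof (rule Bochner_Integration.integrable_bound)
    show "integrable lebesgue (\<lambda>x. f x + f (0 + (-1) * x))" by (rule Bochner_Integration.integrable_add[OF i i'])
    show "(\<lambda>x. exp (- c * \<bar>x\<bar>)) \<in> borel_measurable lebesgue"
      by (intro continuous_lebesgue_measurable continuous_intros)
    show "AE x in lebesgue. norm (exp (- c * \<bar>x\<bar>)) \<le> norm (f x + f (0 + - 1 * x))"
      by (rule AE_I2) (auto simp: f_def abs_if)
  qed
qed

lemma mult_exp_neg_le: "0 < c \<Longrightarrow> 0 \<le> x \<Longrightarrow> (1 + x) * exp (- (c * x)) \<le> 1 + 1 / c" for x c :: real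
proof -
  assume c: "0 < c" and x: "0 \<le> x"
  have "c * x \<le> exp (c * x)" using exp_ge_add_one_self[of "c * x"] by linarith
  then have "c * x * exp (- (c * x)) \<le> exp (c * x) * exp (- (c * x))" by (intro mult_right_mono) auto
  then have "c * x * exp (- (c * x)) \<le> 1" by (simp add: exp_minus)
  then have "x * exp (- (c * x)) \<le> 1 / c" using c by (simp add: field_simps)
  moreover have "exp (- (c * x)) \<le> 1" using c x by simp
  ultimately show ?thesis using distrib_right[of 1 x "exp (- (c * x))"] by linarith
qed

lemma integrable_linear_exp_abs:
  assumes c: "0 < c"
  shows "integrable lebesgue (\<lambda>x::real. (1 + \<bar>x\<bar>) * exp (- c * \<bar>x\<bar>))"
proof (rule Bochner_Integration.integrable_bound)
  have c2: "0 < c / 2" using c by simp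
  show "integrable lebesgue (\<lambda>x::real. (1 + 1 / (c / 2)) * exp (- (c / 2) * \<bar>x\<bar>))"
    by (intro integrable_mult_right integrable_exp_abs c2)
  show "(\<lambda>x::real. (1 + \<bar>x\<bar>) * exp (- c * \<bar>x\<bar>)) \<in> borel_measurable lebesgue"
    by (intro continuous_lebesgue_measurable continuous_intros)
  have "(1 + \<bar>x\<bar>) * exp (- c * \<bar>x\<bar>) \<le> (1 + 1 / (c / 2)) * exp (- (c / 2) * \<bar>x\<bar>)" for x :: real
  proof -
    have "(1 + \<bar>x\<bar>) * exp (- c * \<bar>x\<bar>) = ((1 + \<bar>x\<bar>) * exp (- (c / 2 * \<bar>x\<bar>))) * exp (- (c / 2) * \<bar>x\<bar>)"
      by (simp flip: exp_add)
    also have "\<dots> \<le> (1 + 1 / (c / 2)) * exp (- (c / 2) * \<bar>x\<bar>)"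
      by (intro mult_right_mono mult_exp_neg_le c2) auto
    finally show ?thesis .
  qed
  then show "AE x::real in lebesgue. norm ((1 + \<bar>x\<bar>) * exp (- c * \<bar>x\<bar>)) \<le> norm ((1 + 1 / (c / 2)) * exp (- (c / 2) * \<bar>x\<bar>))"
    using c by (intro AE_I2) (simp add: abs_mult)
qed

lemma integral_indicator_tendsto_0:
  fixes f :: "real \<Rightarrow> real"
  assumes f: "integrable lebesgue f" and S: "\<And>n::nat. S n \<in> sets lebesgue"
    and out: "\<And>x. \<forall>\<^sub>F n in sequentially. x \<notin> S n"
  shows "(\<lambda>n. \<integral>x. f x * indicator (S n) x \<partial>lebesgue) \<longlonglongrightarrow> 0"
proof -
  have [measurable]: "f \<in> borel_measurable lebesgue" using f by auto
  have "(\<lambda>n. \<integral>x. f x * indicator (S n) x \<partial>lebesgue) \<longlonglongrightarrow> (\<integral>x. 0 \<partial>(lebesgue :: real measure))"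
  proof (rule integral_dominated_convergence[where w="\<lambda>x. \<bar>f x\<bar>"])
    show "AE x in lebesgue. (\<lambda>n. f x * indicator (S n) x) \<longlonglongrightarrow> 0"
    proof (rule AE_I2)
      fix x
      have "\<forall>\<^sub>F n in sequentially. f x * indicator (S n) x = 0"
        using out[of x] by eventually_elim simp
      then show "(\<lambda>n. f x * indicator (S n) x) \<longlonglongrightarrow> 0" by (rule tendsto_eventually)
    qed
    show "(\<lambda>x. f x * indicator (S n) x) \<in> borel_measurable lebesgue" for n
      using S[of n] by measurable
  qed (use f in \<open>auto simp: indicator_def\<close>)
  then show ?thesis by simp
qed

text \<open>A potential below a multiple of this level is relatively bounded by the pointwise estimates alone:
  on the left half-line the product with the weight \<open>exp (2 * x)\<close> is \<open>exp (\<eta> * x)\<close>, which is integrable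
  against the linear growth of \<open>\<bar>g x\<bar>\<^sup>2\<close>.\<close>

definition level :: "real \<Rightarrow> real \<Rightarrow> real" where
  "level \<eta> x = (if 0 \<le> x then 1 else exp (- ((2 - \<eta>) * x)))"

lemma level_pos: "0 < level \<eta> x"
  by (simp add: level_def)

text \<open>Where the potential \<open>y\<close> does not exceed \<open>l * level \<eta> x\<close>, the first two terms control it: the weighted norm to the
  right of \<open>- R\<close> and the pointwise bound to the left. Where it is larger, \<open>y \<le> y powr p * level \<eta> x powr
  (1 - p)\<close>, and the pointwise bounds on \<open>g\<close> leave a constant times
  \<open>y powr p * exp ((a + 1) * x)\<close>. On the left half-line the exponents leave room of size \<open>2 * \<gamma>\<close>, of
  which \<open>\<eta> * (p - 1)\<close> is spent on the level and \<open>\<gamma>\<close> on the linear growth; this is why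
  \<open>\<eta> = \<gamma> / p\<close>.\<close>

lemma potential_pointwise_bound:
  assumes g: "g \<in> line_test" and l: "1 \<le> l" and R: "0 \<le> R"
    and \<gamma>: "0 < \<gamma>" and a: "0 \<le> a" and p: "p = \<gamma> + (1 + a) / 2" "1 \<le> p"
    and \<eta>: "\<eta> = \<gamma> / p" and y: "0 \<le> y"
  shows "exp (2 * x) * (y * (cmod (g x))\<^sup>2) \<le>
    l * exp (2 * R) * (exp (2 * x) * (cmod (g x))\<^sup>2) +
    4 * l * energy g * ((1 + \<bar>x\<bar>) * exp (- \<eta> * \<bar>x\<bar>) * indicator {..<-R} x) +
    4 * (1 + 1 / \<gamma>) * energy g * (y powr p * exp ((a + 1) * x) * of_bool (l * level \<eta> x < y))"
  (is "?L \<le> ?A + ?B + ?C")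
proof -
  note E = energy_nonneg[of g]
  have \<eta>0: "0 < \<eta>" "\<eta> \<le> 1" using \<gamma> a p by (auto simp: \<eta> field_simps)
  have \<eta>p: "\<eta> * (p - 1) \<le> \<gamma>" using \<gamma> p(2) by (simp add: \<eta> field_simps)
  have A: "0 \<le> ?A" using l by simp
  have B: "0 \<le> ?B" using l E by simp
  have C: "0 \<le> ?C" using \<gamma> E by simp
  show ?thesis
  proof (cases "l * level \<eta> x < y")
    case False
    then have "?L \<le> exp (2 * x) * ((l * level \<eta> x) * (cmod (g x))\<^sup>2)"
      by (intro mult_left_mono mult_right_mono) auto
    also have "\<dots> \<le> ?A + ?B"
    proof (cases "x < - R")
      case True
      then have x: "x < 0" using R by simp
      have "exp (2 * x) * ((l * level \<eta> x) * (cmod (g x))\<^sup>2) = l * (exp (- \<eta> * \<bar>x\<bar>) * (cmod (g x))\<^sup>2)"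
        using x by (simp add: level_def algebra_simps flip: exp_add)
      also have "\<dots> \<le> l * (exp (- \<eta> * \<bar>x\<bar>) * (4 * (1 + \<bar>x\<bar>) * energy g))"
        using l by (intro mult_left_mono test_function_pointwise[OF g]) auto
      also have "\<dots> = ?B" using True by (simp add: mult_ac)
      finally show ?thesis using A by linarith
    next
      case False
      have "level \<eta> x \<le> exp (2 * R)"
      proof (cases "0 \<le> x")
        case False
        have "- ((2 - \<eta>) * x) = (2 - \<eta>) * (- x)" by simp
        also have "\<dots> \<le> 2 * R"
          using False \<open>\<not> x < - R\<close> \<eta>0 by (intro mult_mono) auto
        finally show ?thesis using False by (simp add: level_def)
      qed (use R in \<open>simp add: level_def\<close>)
      then have "exp (2 * x) * ((l * level \<eta> x) * (cmod (g x))\<^sup>2) \<le> exp (2 * x) * ((l * exp (2 * R)) * (cmod (g x))\<^sup>2)"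
        using l by (intro mult_left_mono mult_right_mono) auto
      then show ?thesis using B by (simp add: mult_ac)
    qed
    finally show ?thesis using C by linarith
  next
    case True
    have wy: "level \<eta> x \<le> y"
      using True l level_pos[of \<eta> x] mult_right_mono[OF l, of "level \<eta> x"] by linarith
    have y0: "0 < y" using wy level_pos[of \<eta> x] by linarith
    have "y = y powr p * y powr (1 - p)" using y0 by (simp flip: powr_add)
    also have "\<dots> \<le> y powr p * level \<eta> x powr (1 - p)"
      using p(2) wy level_pos by (intro mult_left_mono powr_mono2') auto
    finally have y_le: "y \<le> y powr p * level \<eta> x powr (1 - p)" .
    have key: "level \<eta> x powr (1 - p) * (exp (2 * x) * (cmod (g x))\<^sup>2) \<le> 4 * (1 + 1 / \<gamma>) * energy g * exp ((a + 1) * x)"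
    proof (cases "0 \<le> x")
      case True
      have "level \<eta> x powr (1 - p) * (exp (2 * x) * (cmod (g x))\<^sup>2) = exp x * (exp x * (cmod (g x))\<^sup>2)"
        using True by (simp add: level_def exp_double power2_eq_square)
      also have "\<dots> \<le> exp ((a + 1) * x) * energy g"
        using True a by (intro mult_mono test_function_pointwise_exp[OF g]) (auto simp: algebra_simps)
      also have "\<dots> \<le> (4 * (1 + 1 / \<gamma>)) * (exp ((a + 1) * x) * energy g)"
      proof -
        have "1 \<le> 4 * (1 + 1 / \<gamma>)" using \<gamma> by simp
        from mult_right_mono[OF this, of "exp ((a + 1) * x) * energy g"] show ?thesis using E by simp
      qed
      finally show ?thesis by (simp add: mult_ac)
    next
      case False
      then have x: "x < 0" by simp
      have e: "level \<eta> x powr (1 - p) * exp (2 * x) = exp ((a + 1) * x) * exp ((2 * \<gamma> - \<eta> * (p - 1)) * x)"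
      proof -
        have "level \<eta> x powr (1 - p) * exp (2 * x) = exp ((2 - \<eta>) * (p - 1) * x + 2 * x)"
          using x by (simp add: level_def powr_def algebra_simps flip: exp_add)
        also have "(2 - \<eta>) * (p - 1) * x + 2 * x = (a + 1) * x + (2 * \<gamma> - \<eta> * (p - 1)) * x"
        proof -
          have "2 * p = 2 * \<gamma> + a + 1" using p(1) by simp
          then have "(2 - \<eta>) * (p - 1) + 2 = (a + 1) + (2 * \<gamma> - \<eta> * (p - 1))" by (simp add: algebra_simps)
          then have "((2 - \<eta>) * (p - 1) + 2) * x = ((a + 1) + (2 * \<gamma> - \<eta> * (p - 1))) * x" by simp
          then show ?thesis by (simp add: distrib_right)
        qed
        finally show ?thesis by (simp add: exp_add)
      qed
      have "(2 * \<gamma> - \<eta> * (p - 1)) * x \<le> \<gamma> * x"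
        using \<eta>p x by (intro mult_right_mono_neg) auto
      then have "exp ((2 * \<gamma> - \<eta> * (p - 1)) * x) \<le> exp (- (\<gamma> * \<bar>x\<bar>))" using x by simp
      then have "exp ((2 * \<gamma> - \<eta> * (p - 1)) * x) * (cmod (g x))\<^sup>2 \<le> exp (- (\<gamma> * \<bar>x\<bar>)) * (4 * (1 + \<bar>x\<bar>) * energy g)"
        by (intro mult_mono test_function_pointwise[OF g]) auto
      also have "\<dots> = (4 * energy g) * ((1 + \<bar>x\<bar>) * exp (- (\<gamma> * \<bar>x\<bar>)))" by (simp add: mult_ac)
      also have "\<dots> \<le> (4 * energy g) * (1 + 1 / \<gamma>)"
        using E by (intro mult_left_mono mult_exp_neg_le \<gamma>) auto
      finally have f: "exp ((2 * \<gamma> - \<eta> * (p - 1)) * x) * (cmod (g x))\<^sup>2 \<le> (4 * energy g) * (1 + 1 / \<gamma>)" .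
      have "level \<eta> x powr (1 - p) * (exp (2 * x) * (cmod (g x))\<^sup>2) =
          exp ((a + 1) * x) * (exp ((2 * \<gamma> - \<eta> * (p - 1)) * x) * (cmod (g x))\<^sup>2)"
        using e by (simp add: mult.assoc[symmetric])
      also have "\<dots> \<le> exp ((a + 1) * x) * ((4 * energy g) * (1 + 1 / \<gamma>))"
        by (intro mult_left_mono f) auto
      finally show ?thesis by (simp add: mult_ac)
    qed
    have "?L = y * (exp (2 * x) * (cmod (g x))\<^sup>2)" by simp
    also have "\<dots> \<le> (y powr p * level \<eta> x powr (1 - p)) * (exp (2 * x) * (cmod (g x))\<^sup>2)"
      by (intro mult_right_mono y_le) auto
    also have "\<dots> = y powr p * (level \<eta> x powr (1 - p) * (exp (2 * x) * (cmod (g x))\<^sup>2))" by simp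
    also have "\<dots> \<le> y powr p * (4 * (1 + 1 / \<gamma>) * energy g * exp ((a + 1) * x))"
      by (intro mult_left_mono key) auto
    also have "\<dots> = ?C" using True by (simp add: mult_ac)
    finally show ?thesis using A B by linarith
  qed
qed

lemma integral_combination:
  fixes f g h :: "'a \<Rightarrow> real"
  assumes "integrable M f" "integrable M g" "integrable M h"
  shows "(\<integral>x. a * f x + b * g x + c * h x \<partial>M) = a * (\<integral>x. f x \<partial>M) + b * (\<integral>x. g x \<partial>M) + c * (\<integral>x. h x \<partial>M)"
  using assms by simp

text \<open>In the pointwise bound first let \<open>l\<close> be so large that the part of the potential above the level has
  a small integral, then \<open>R\<close> so large that the second term is small. What remains is a multiple of the
  weighted norm.\<close>

lemma potential_form_bound:
  fixes Y :: "real \<Rightarrow> real"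
  assumes Ym: "Y \<in> borel_measurable lebesgue"
    and \<gamma>: "0 < \<gamma>" and a: "0 \<le> a" and p: "p = \<gamma> + (1 + a) / 2" "1 \<le> p"
    and Z: "integrable lebesgue (\<lambda>x. max (Y x) 0 powr p * exp ((a + 1) * x))"
  shows "\<exists>K\<ge>0. \<forall>g\<in>line_test.
    integrable (weighted_line 2) (\<lambda>x. max (Y x) 0 * (cmod (g x))\<^sup>2) \<and>
    (\<integral>x. max (Y x) 0 * (cmod (g x))\<^sup>2 \<partial>weighted_line 2) \<le>
      1 / 2 * (L2_norm lebesgue (vderiv g))\<^sup>2 + K * (L2_norm (weighted_line 2) g)\<^sup>2"
proof -
  have [measurable]: "Y \<in> borel_measurable lebesgue" by (rule Ym)
  define \<eta> where "\<eta> = \<gamma> / p"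
  have \<eta>0: "0 < \<eta>" using \<gamma> p by (simp add: \<eta>_def)
  let ?Z = "\<lambda>x. max (Y x) 0 powr p * exp ((a + 1) * x)"
  let ?C = "4 * (1 + 1 / \<gamma>)"
  define S where "S n = {x. real (Suc n) * level \<eta> x < max (Y x) 0}" for n
  have level_m [measurable]: "level \<eta> \<in> borel_measurable lebesgue"
  proof -
    have "(\<lambda>x. if 0 \<le> x then 1 else exp (- ((2 - \<eta>) * x))) \<in> borel_measurable borel" by measurable
    then have "level \<eta> \<in> borel_measurable lborel" by (simp add: level_def[abs_def])
    then show ?thesis by (rule measurable_completion)
  qed
  have S: "S n \<in> sets lebesgue" for n
  proof -
    have "{x \<in> space lebesgue. real (Suc n) * level \<eta> x < max (Y x) 0} \<in> sets lebesgue" by measurable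
    then show ?thesis by (simp add: S_def del: of_nat_Suc)
  qed
  have "(\<lambda>n. \<integral>x. ?Z x * indicator (S n) x \<partial>lebesgue) \<longlonglongrightarrow> 0"
  proof (rule integral_indicator_tendsto_0[OF Z S])
    fix x
    obtain N :: nat where N: "max (Y x) 0 / level \<eta> x \<le> real N" using real_arch_simple by blast
    have "x \<notin> S n" if "n \<ge> N" for n
    proof -
      have "max (Y x) 0 \<le> real N * level \<eta> x" using N level_pos[of \<eta> x] by (simp add: field_simps)
      also have "\<dots> \<le> real (Suc n) * level \<eta> x" using that level_pos[of \<eta> x] by (intro mult_right_mono) auto
      finally have "\<not> real (Suc n) * level \<eta> x < max (Y x) 0" by (rule leD)
      then show ?thesis unfolding S_def mem_Collect_eq .
    qed
    then show "\<forall>\<^sub>F n in sequentially. x \<notin> S n" by (rule eventually_sequentiallyI)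
  qed
  from tendsto_mult_left[OF this, of ?C]
  have "(\<lambda>n. ?C * (\<integral>x. ?Z x * indicator (S n) x \<partial>lebesgue)) \<longlonglongrightarrow> 0" by simp
  from order_tendstoD(2)[OF this, of "1 / 4"] obtain n
    where n: "?C * (\<integral>x. ?Z x * indicator (S n) x \<partial>lebesgue) < 1 / 4"
    by (auto simp: eventually_sequentially)
  \<comment> \<open>The level is high enough for the part of the potential above it to be small.\<close>
  define l where "l = real (Suc n)"
  have l: "1 \<le> l" by (simp add: l_def)
  let ?f = "\<lambda>x. (1 + \<bar>x\<bar>) * exp (- \<eta> * \<bar>x\<bar>)"
  note fi = integrable_linear_exp_abs[OF \<eta>0]
  have "(\<lambda>k. \<integral>x. ?f x * indicator {..<- real k} x \<partial>lebesgue) \<longlonglongrightarrow> 0"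
  proof (rule integral_indicator_tendsto_0[OF fi])
    fix x :: real
    obtain N :: nat where N: "\<bar>x\<bar> \<le> real N" using real_arch_simple by blast
    have "x \<notin> {..<- real k}" if "k \<ge> N" for k using that N by auto
    then show "\<forall>\<^sub>F n in sequentially. x \<notin> {..<- real n}" by (rule eventually_sequentiallyI)
  qed auto
  from tendsto_mult_left[OF this, of "4 * l"]
  have "(\<lambda>k. 4 * l * (\<integral>x. ?f x * indicator {..<- real k} x \<partial>lebesgue)) \<longlonglongrightarrow> 0" by simp
  from order_tendstoD(2)[OF this, of "1 / 4"] obtain k
    where k: "4 * l * (\<integral>x. ?f x * indicator {..<- real k} x \<partial>lebesgue) < 1 / 4"
    by (auto simp: eventually_sequentially)
  \<comment> \<open>The summand \<open>1 / 2\<close> comes from the two small terms, which are multiples of the full energy.\<close>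
  define K where "K = l * exp (2 * real k) + 1 / 2"
  have K0: "0 \<le> K" using l by (simp add: K_def)
  have iS: "integrable lebesgue (\<lambda>x. ?Z x * indicator (S n) x)"
    using integrable_mult_indicator[OF S Z, of n] by (simp add: mult.commute)
  have iR: "integrable lebesgue (\<lambda>x. ?f x * indicator {..<- real k} x)"
    using integrable_mult_indicator[OF _ fi, of "{..<- real k}"] by (simp add: mult.commute)
  have "integrable (weighted_line 2) (\<lambda>x. max (Y x) 0 * (cmod (g x))\<^sup>2) \<and>
    (\<integral>x. max (Y x) 0 * (cmod (g x))\<^sup>2 \<partial>weighted_line 2) \<le>
      1 / 2 * (L2_norm lebesgue (vderiv g))\<^sup>2 + K * (L2_norm (weighted_line 2) g)\<^sup>2"
    if g: "g \<in> line_test" for g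
  proof -
    have gm [measurable]: "g \<in> borel_measurable lebesgue" by (intro smooth_lebesgue_measurable test_functions_smooth g)
    have gN: "g \<in> L2 (weighted_line 2)" by (rule test_function_L2[OF g])
    note ig = weighted_line_integrable_square[OF gN]
    define h where "h x = l * exp (2 * real k) * (exp (2 * x) * (cmod (g x))\<^sup>2) +
        4 * l * energy g * (?f x * indicator {..<- real k} x) + ?C * energy g * (?Z x * indicator (S n) x)" for x
    have hi: "integrable lebesgue h"
      unfolding h_def by (intro Bochner_Integration.integrable_add integrable_mult_right ig iR iS)
    have le: "exp (2 * x) * (max (Y x) 0 * (cmod (g x))\<^sup>2) \<le> h x" for x
      using potential_pointwise_bound[OF g l, of "real k" \<gamma> a p \<eta> "max (Y x) 0" x] \<gamma> a p
      by (simp add: h_def S_def l_def \<eta>_def indicator_def mult.assoc of_bool_def del: of_nat_Suc)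
    have m: "(\<lambda>x. max (Y x) 0 * (cmod (g x))\<^sup>2) \<in> borel_measurable lebesgue" by measurable
    have i: "integrable lebesgue (\<lambda>x. exp (2 * x) * (max (Y x) 0 * (cmod (g x))\<^sup>2))"
    proof (rule Bochner_Integration.integrable_bound[OF hi])
      show "(\<lambda>x. exp (2 * x) * (max (Y x) 0 * (cmod (g x))\<^sup>2)) \<in> borel_measurable lebesgue" by measurable
      show "AE x in lebesgue. norm (exp (2 * x) * (max (Y x) 0 * (cmod (g x))\<^sup>2)) \<le> norm (h x)"
      proof (rule AE_I2)
        fix x
        have "0 \<le> exp (2 * x) * (max (Y x) 0 * (cmod (g x))\<^sup>2)" by simp
        then show "norm (exp (2 * x) * (max (Y x) 0 * (cmod (g x))\<^sup>2)) \<le> norm (h x)"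
          using le[of x] by (simp only: real_norm_def)
      qed
    qed
    have "(\<integral>x. max (Y x) 0 * (cmod (g x))\<^sup>2 \<partial>weighted_line 2) =
        (\<integral>x. exp (2 * x) * (max (Y x) 0 * (cmod (g x))\<^sup>2) \<partial>lebesgue)"
      using integral_weighted_line[OF m, of 2] by simp
    also have "\<dots> \<le> (\<integral>x. h x \<partial>lebesgue)" by (intro integral_mono i hi le)
    also have "\<dots> = l * exp (2 * real k) * (\<integral>x. exp (2 * x) * (cmod (g x))\<^sup>2 \<partial>lebesgue) +
        4 * l * energy g * (\<integral>x. ?f x * indicator {..<- real k} x \<partial>lebesgue) +
        ?C * energy g * (\<integral>x. ?Z x * indicator (S n) x \<partial>lebesgue)"
      unfolding h_def
      by (rule integral_combination[OF ig iR iS])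
    also have "\<dots> = l * exp (2 * real k) * (L2_norm (weighted_line 2) g)\<^sup>2 +
        energy g * (4 * l * (\<integral>x. ?f x * indicator {..<- real k} x \<partial>lebesgue)) +
        energy g * (?C * (\<integral>x. ?Z x * indicator (S n) x \<partial>lebesgue))"
      by (simp only: L2_norm_weighted_line[OF gm] mult_ac)
    also have "\<dots> \<le> l * exp (2 * real k) * (L2_norm (weighted_line 2) g)\<^sup>2 + energy g * (1 / 4) + energy g * (1 / 4)"
      using mult_left_mono[OF less_imp_le[OF n] energy_nonneg[of g]]
        mult_left_mono[OF less_imp_le[OF k] energy_nonneg[of g]] by linarith
    also have "\<dots> = 1 / 2 * (L2_norm lebesgue (vderiv g))\<^sup>2 + K * (L2_norm (weighted_line 2) g)\<^sup>2"
      by (simp add: energy_def K_def algebra_simps)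
    finally have "(\<integral>x. max (Y x) 0 * (cmod (g x))\<^sup>2 \<partial>weighted_line 2) \<le>
      1 / 2 * (L2_norm lebesgue (vderiv g))\<^sup>2 + K * (L2_norm (weighted_line 2) g)\<^sup>2" .
    then show ?thesis using i integrable_weighted_line[OF m, of 2] by simp
  qed
  then show ?thesis using K0 by blast
qed

section \<open>Limits of Cauchy sequences in the energy norm\<close>

lemma L2_Fatou:
  assumes f: "\<And>n. f n \<in> L2 M" and F: "F \<in> borel_measurable M"
    and lim: "AE x in M. (\<lambda>n. f n x) \<longlonglongrightarrow> F x"
    and B: "\<forall>\<^sub>F n in sequentially. L2_norm M (f n) \<le> B" and B0: "0 \<le> B"
  shows "F \<in> L2 M" "L2_norm M F \<le> B"
proof -
  have [measurable]: "f n \<in> borel_measurable M" "F \<in> borel_measurable M" for n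
    using L2_measurable[OF f] F by auto
  have eq: "(\<integral>\<^sup>+x. ennreal ((cmod (f n x))\<^sup>2) \<partial>M) = ennreal ((L2_norm M (f n))\<^sup>2)" for n
    using nn_integral_eq_integral[OF L2_integrable_square[OF f[of n]]] by (simp add: L2_norm_square)
  have "(\<integral>\<^sup>+x. ennreal ((cmod (F x))\<^sup>2) \<partial>M) = (\<integral>\<^sup>+x. liminf (\<lambda>n. ennreal ((cmod (f n x))\<^sup>2)) \<partial>M)"
  proof (rule nn_integral_cong_AE)
    show "AE x in M. ennreal ((cmod (F x))\<^sup>2) = liminf (\<lambda>n. ennreal ((cmod (f n x))\<^sup>2))"
      using lim
    proof eventually_elim
      fix x assume "(\<lambda>n. f n x) \<longlonglongrightarrow> F x"
      then have "(\<lambda>n. ennreal ((cmod (f n x))\<^sup>2)) \<longlonglongrightarrow> ennreal ((cmod (F x))\<^sup>2)"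
        by (intro tendsto_ennrealI tendsto_power tendsto_norm)
      then show "ennreal ((cmod (F x))\<^sup>2) = liminf (\<lambda>n. ennreal ((cmod (f n x))\<^sup>2))"
        using lim_imp_Liminf[OF trivial_limit_sequentially] by metis
    qed
  qed
  also have "\<dots> \<le> liminf (\<lambda>n. \<integral>\<^sup>+x. ennreal ((cmod (f n x))\<^sup>2) \<partial>M)"
    by (rule nn_integral_liminf) measurable
  also have "\<dots> \<le> ennreal (B\<^sup>2)"
  proof (rule Liminf_le)
    show "\<forall>\<^sub>F n in sequentially. (\<integral>\<^sup>+x. ennreal ((cmod (f n x))\<^sup>2) \<partial>M) \<le> ennreal (B\<^sup>2)"
      using B unfolding eq by eventually_elim (auto intro!: ennreal_leI power_mono)
  qed simp
  finally have le: "(\<integral>\<^sup>+x. ennreal ((cmod (F x))\<^sup>2) \<partial>M) \<le> ennreal (B\<^sup>2)" .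
  have i: "integrable M (\<lambda>x. (cmod (F x))\<^sup>2)"
  proof (rule integrableI_bounded)
    show "(\<integral>\<^sup>+x. ennreal (norm ((cmod (F x))\<^sup>2)) \<partial>M) < \<infinity>"
      using le by (simp add: le_less_trans)
  qed measurable
  then show "F \<in> L2 M" using F by (simp add: L2_def)
  have "ennreal ((L2_norm M F)\<^sup>2) \<le> ennreal (B\<^sup>2)"
    using le nn_integral_eq_integral[OF i] by (simp add: L2_norm_square)
  then have "(L2_norm M F)\<^sup>2 \<le> B\<^sup>2" by simp
  then show "L2_norm M F \<le> B" using B0 by (rule power2_le_imp_le)
qed

interpretation line: square_form "weighted_line 2" lebesgue "line_test" vderiv laplace_form
  by (rule square_form_laplace[OF test_functions_line_core])

lemma energy_diff:
  assumes "g \<in> line_test" "h \<in> line_test"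
  shows "energy (\<lambda>x. g x - h x) =
    (L2_norm lebesgue (\<lambda>x. vderiv g x - vderiv h x))\<^sup>2 + (L2_norm (weighted_line 2) (\<lambda>x. g x - h x))\<^sup>2"
  unfolding energy_def line.d_diff[OF assms] ..

lemma energy_Cauchy:
  assumes a: "form_approx (weighted_line 2) line_test laplace_form un u" and u: "u \<in> L2 (weighted_line 2)"
    and e: "0 < \<epsilon>"
  shows "\<exists>N. \<forall>m\<ge>N. \<forall>n\<ge>N. energy (\<lambda>x. un m x - un n x) < \<epsilon>"
proof -
  note U = line.form_approxD[OF a]
  have L: "un n \<in> L2 (weighted_line 2)" for n using U(1) by (intro test_function_L2)
  define d where "d = sqrt (\<epsilon> / 2) / 2"
  have d: "0 < d" "d\<^sup>2 + (2 * d)\<^sup>2 \<le> 5 / 8 * \<epsilon>" using e by (simp_all add: d_def power_divide power_mult_distrib)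
  obtain N1 where N1: "\<And>m n. m \<ge> N1 \<Longrightarrow> n \<ge> N1 \<Longrightarrow> L2_norm lebesgue (\<lambda>y. vderiv (un m) y - vderiv (un n) y) < d"
    using U(3)[OF d(1)] by auto
  obtain N2 where N2: "\<And>n. n \<ge> N2 \<Longrightarrow> L2_norm (weighted_line 2) (\<lambda>x. un n x - u x) < d"
    using LIMSEQ_D[OF U(2) d(1)] by auto
  have "energy (\<lambda>x. un m x - un n x) < \<epsilon>" if mn: "m \<ge> max N1 N2" "n \<ge> max N1 N2" for m n
  proof -
    have "L2_norm (weighted_line 2) (\<lambda>x. un m x - un n x) \<le>
        L2_norm (weighted_line 2) (\<lambda>x. un m x - u x) + L2_norm (weighted_line 2) (\<lambda>x. u x - un n x)"
      by (rule L2_norm_triangle_diff[OF L u L])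
    also have "\<dots> \<le> 2 * d"
      using N2[of m] N2[of n] mn by (simp add: L2_norm_minus_commute[of _ u])
    finally have "(L2_norm (weighted_line 2) (\<lambda>x. un m x - un n x))\<^sup>2 \<le> (2 * d)\<^sup>2" by (intro power_mono) auto
    moreover have "(L2_norm lebesgue (\<lambda>y. vderiv (un m) y - vderiv (un n) y))\<^sup>2 \<le> d\<^sup>2"
      using N1[of m n] mn by (intro power_mono) auto
    ultimately show ?thesis unfolding energy_diff[OF U(1) U(1)] using d(2) e by linarith
  qed
  then show ?thesis by blast
qed

text \<open>The pointwise bound, applied to differences, turns a Cauchy sequence for the form norm into one
  for uniform convergence on compact sets. Its limit is a representative of \<open>u\<close>.\<close>

lemma form_approx_locally_uniform:
  assumes a: "form_approx (weighted_line 2) line_test laplace_form un u" and u: "u \<in> L2 (weighted_line 2)"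
  obtains v where "\<And>x. (\<lambda>n. un n x) \<longlonglongrightarrow> v x" "AE x in lebesgue. u x = v x" "v \<in> borel_measurable lebesgue"
    "\<And>\<delta>. 0 < \<delta> \<Longrightarrow> \<exists>N. \<forall>n\<ge>N. \<forall>x. (cmod (un n x - v x))\<^sup>2 \<le> 4 * (1 + \<bar>x\<bar>) * \<delta>"
proof -
  note U = line.form_approxD[OF a]
  have pw: "(cmod (un m x - un n x))\<^sup>2 \<le> 4 * (1 + \<bar>x\<bar>) * energy (\<lambda>x. un m x - un n x)" for m n x
    by (rule test_function_pointwise[OF test_functions_diff[OF U(1) U(1)]])
  have "Cauchy (\<lambda>n. un n x)" for x
  proof (rule metric_CauchyI)
    fix e :: real assume e: "0 < e"
    define c where "c = 4 * (1 + \<bar>x\<bar>)"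
    have c: "0 < c" by (simp add: c_def)
    obtain N where N: "\<And>m n. m \<ge> N \<Longrightarrow> n \<ge> N \<Longrightarrow> energy (\<lambda>x. un m x - un n x) < e\<^sup>2 / c"
      using energy_Cauchy[OF a u, of "e\<^sup>2 / c"] e c by auto
    have "dist (un m x) (un n x) < e" if "m \<ge> N" "n \<ge> N" for m n
    proof -
      have "(cmod (un m x - un n x))\<^sup>2 \<le> c * energy (\<lambda>x. un m x - un n x)" using pw by (simp add: c_def)
      also have "\<dots> < c * (e\<^sup>2 / c)" using N[OF that] c by (intro mult_strict_left_mono)
      also have "\<dots> = e\<^sup>2" using c by simp
      finally show ?thesis using e by (simp add: dist_norm power2_less_imp_less)
    qed
    then show "\<exists>N. \<forall>m\<ge>N. \<forall>n\<ge>N. dist (un m x) (un n x) < e" by blast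
  qed
  then have "\<forall>x. \<exists>l. (\<lambda>n. un n x) \<longlonglongrightarrow> l" by (simp add: Cauchy_convergent_iff convergent_def)
  then obtain v where v: "\<And>x. (\<lambda>n. un n x) \<longlonglongrightarrow> v x" by metis
  have um: "un n \<in> borel_measurable lebesgue" for n
    by (intro smooth_lebesgue_measurable test_functions_smooth U(1))
  have vm: "v \<in> borel_measurable lebesgue"
    by (rule borel_measurable_LIMSEQ_metric[OF um v])
  have unif: "\<exists>N. \<forall>n\<ge>N. \<forall>x. (cmod (un n x - v x))\<^sup>2 \<le> 4 * (1 + \<bar>x\<bar>) * \<delta>" if \<delta>: "0 < \<delta>" for \<delta>
  proof -
    obtain N where N: "\<And>m n. m \<ge> N \<Longrightarrow> n \<ge> N \<Longrightarrow> energy (\<lambda>x. un m x - un n x) < \<delta>"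
      using energy_Cauchy[OF a u \<delta>] by auto
    have "(cmod (un n x - v x))\<^sup>2 \<le> 4 * (1 + \<bar>x\<bar>) * \<delta>" if n: "n \<ge> N" for n x
    proof (rule LIMSEQ_le_const2)
      show "(\<lambda>m. (cmod (un n x - un m x))\<^sup>2) \<longlonglongrightarrow> (cmod (un n x - v x))\<^sup>2"
        by (intro tendsto_power tendsto_norm tendsto_diff tendsto_const v)
      have "(cmod (un n x - un m x))\<^sup>2 \<le> 4 * (1 + \<bar>x\<bar>) * \<delta>" if m: "m \<ge> N" for m
      proof -
        have "4 * (1 + \<bar>x\<bar>) * energy (\<lambda>x. un n x - un m x) \<le> 4 * (1 + \<bar>x\<bar>) * \<delta>"
          using N[OF n m] by (intro mult_left_mono) auto
        then show ?thesis using pw[of n x m] by linarith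
      qed
      then show "\<exists>N. \<forall>m\<ge>N. (cmod (un n x - un m x))\<^sup>2 \<le> 4 * (1 + \<bar>x\<bar>) * \<delta>" by blast
    qed
    then show ?thesis by blast
  qed
  have "u \<in> borel_measurable lebesgue" using L2_measurable[OF u] by (simp add: borel_measurable_weighted_line)
  then have dm: "(\<lambda>x. v x - u x) \<in> borel_measurable (weighted_line 2)"
    using vm by (simp add: borel_measurable_weighted_line)
  have uL: "(\<lambda>x. un n x - u x) \<in> L2 (weighted_line 2)" for n
    by (intro L2_diff test_function_L2 U(1) u)
  have le: "(\<lambda>x. v x - u x) \<in> L2 (weighted_line 2) \<and> L2_norm (weighted_line 2) (\<lambda>x. v x - u x) \<le> e" if e: "0 < e" for e
  proof -
    have ev: "\<forall>\<^sub>F n in sequentially. L2_norm (weighted_line 2) (\<lambda>x. un n x - u x) \<le> e"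
      using order_tendstoD(2)[OF U(2) e] by eventually_elim simp
    have "AE x in weighted_line 2. (\<lambda>n. un n x - u x) \<longlonglongrightarrow> v x - u x"
      by (intro AE_I2 tendsto_diff v tendsto_const)
    from L2_Fatou[OF uL dm this ev] e show ?thesis by simp
  qed
  have "L2_norm (weighted_line 2) (\<lambda>x. v x - u x) \<le> 0"
    by (rule field_le_epsilon) (use le in auto)
  then have "L2_norm (weighted_line 2) (\<lambda>x. v x - u x) = 0" using L2_norm_nonneg[of "weighted_line 2"] by (simp add: order_antisym)
  then have "AE x in weighted_line 2. v x - u x = 0"
    using L2_norm_eq_0_iff[OF conjunct1[OF le[OF zero_less_one]]] by simp
  then have "AE x in lebesgue. v x = u x" by (simp add: AE_weighted_line)
  then have "AE x in lebesgue. u x = v x" by eventually_elim simp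
  from that[OF v this vm unif] show ?thesis .
qed

lemma laplace_by_parts:
  assumes g: "g \<in> line_test" and h: "h \<in> line_test"
  shows "L2_inner lebesgue (vderiv g) (vderiv h) = - L2_inner lebesgue (vderiv (vderiv g)) h"
proof -
  note g' = vderiv_test_function[OF g] and h' = vderiv_test_function[OF h]
  note g'' = vderiv_test_function[OF g']
  note sm = test_functions_smooth
  let ?F' = "\<lambda>x. vderiv g x * cnj (vderiv h x) + vderiv (vderiv g) x * cnj (h x)"
  have i1: "integrable lebesgue (\<lambda>x. vderiv g x * cnj (vderiv h x))"
    by (intro L2_integrable_inner test_function_L2 g' h')
  have i2: "integrable lebesgue (\<lambda>x. vderiv (vderiv g) x * cnj (h x))"
    by (intro L2_integrable_inner test_function_L2 g'' h)
  have "(\<integral>x. ?F' x \<partial>lebesgue) = 0"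
  proof (rule integral_derivative_eq_0)
    show "((\<lambda>x. vderiv g x * cnj (h x)) has_vector_derivative ?F' x) (at x)" for x
      by (intro has_vector_derivative_mult has_vector_derivative_cnj smooth_vderiv(1) sm g' h)
    show "continuous_on UNIV ?F'"
      by (intro continuous_intros smooth_on_continuous sm g' g'' h h')
    show "integrable lebesgue (\<lambda>x. vderiv g x * cnj (h x))"
      by (intro L2_integrable_inner test_function_L2 g' h)
    show "integrable lebesgue ?F'" by (rule Bochner_Integration.integrable_add[OF i1 i2])
  qed
  then show ?thesis
    using Bochner_Integration.integral_add[OF i1 i2] by (simp add: L2_inner_def eq_neg_iff_add_eq_0)
qed

text \<open>For a fixed member \<open>w\<close> of the sequence, \<open>\<langle>w', wn m'\<rangle> = - \<langle>w'', wn m\<rangle>\<close> tends to \<open>0\<close> as \<open>m\<close> grows, because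
  \<open>wn m\<close> does and \<open>w''\<close> has compact support, while \<open>w' - wn m'\<close> is small.\<close>

lemma laplace_closable:
  assumes a: "form_approx (weighted_line 2) line_test laplace_form wn (\<lambda>_. 0)"
  shows "(\<lambda>n. L2_norm lebesgue (vderiv (wn n))) \<longlonglongrightarrow> 0"
proof (rule LIMSEQ_I)
  fix e :: real assume e: "0 < e"
  note W = line.form_approxD[OF a]
  obtain N where N: "\<And>m n. m \<ge> N \<Longrightarrow> n \<ge> N \<Longrightarrow> L2_norm lebesgue (\<lambda>y. vderiv (wn m) y - vderiv (wn n) y) < e / 2"
    using W(3)[of "e / 2"] e by auto
  have "L2_norm lebesgue (vderiv (wn n)) < e" if n: "n \<ge> N" for n
  proof -
    define x where "x = L2_norm lebesgue (vderiv (wn n))"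
    note w' = vderiv_test_function[OF W(1)]
    have w'L: "vderiv (wn m) \<in> L2 lebesgue" for m by (intro test_function_L2 w')
    note w'' = vderiv_test_function[OF w'[of n]]
    \<comment> \<open>The factor \<open>exp (- 2 * x)\<close> turns the unweighted inner product with \<open>w''\<close> into a weighted one.\<close>
    define k where "k = (\<lambda>x. vderiv (vderiv (wn n)) x * complex_of_real (exp ((-2) * x + 0)))"
    have k: "k \<in> line_test" unfolding k_def by (intro test_functions_mult_smooth w'' smooth_on_exp)
    have kL: "k \<in> L2 (weighted_line 2)" by (rule test_function_L2[OF k])
    have wL: "wn m \<in> L2 (weighted_line 2)" for m by (rule test_function_L2[OF W(1)])
    have inner: "L2_inner lebesgue (vderiv (vderiv (wn n))) (wn m) = L2_inner (weighted_line 2) k (wn m)" for m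
    proof -
      have "(\<lambda>x. k x * cnj (wn m x)) \<in> borel_measurable lebesgue"
        using L2_integrable_inner[OF kL wL[of m]] by (auto simp: borel_measurable_weighted_line)
      from integral_weighted_line[OF this, of 2]
      have "L2_inner (weighted_line 2) k (wn m) = (\<integral>x. exp (2 * x) *\<^sub>R (k x * cnj (wn m x)) \<partial>lebesgue)"
        by (simp add: L2_inner_def)
      also have "\<dots> = L2_inner lebesgue (vderiv (vderiv (wn n))) (wn m)"
        unfolding L2_inner_def k_def
        by (intro Bochner_Integration.integral_cong refl)
           (simp add: scaleR_conv_of_real exp_minus exp_of_real field_simps flip: exp_of_real)
      finally show ?thesis by simp
    qed
    have step: "x\<^sup>2 \<le> x * (e / 2) + L2_norm (weighted_line 2) k * L2_norm (weighted_line 2) (\<lambda>x. wn m x - 0)" if m: "m \<ge> N" for m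
    proof -
      have "complex_of_real (x\<^sup>2) = L2_inner lebesgue (vderiv (wn n)) (vderiv (wn n))"
        by (simp add: x_def L2_inner_self)
      also have "\<dots> = L2_inner lebesgue (vderiv (wn n)) (\<lambda>y. vderiv (wn n) y - vderiv (wn m) y)
          + L2_inner lebesgue (vderiv (wn n)) (vderiv (wn m))"
        by (simp add: L2_inner_diff_right w'L)
      also have "L2_inner lebesgue (vderiv (wn n)) (vderiv (wn m)) = - L2_inner (weighted_line 2) k (wn m)"
        by (simp add: laplace_by_parts[OF W(1) W(1)] inner)
      finally have "cmod (complex_of_real (x\<^sup>2)) \<le>
          cmod (L2_inner lebesgue (vderiv (wn n)) (\<lambda>y. vderiv (wn n) y - vderiv (wn m) y)) +
          cmod (L2_inner (weighted_line 2) k (wn m))"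
        by (simp add: norm_triangle_ineq4 del: of_real_power)
      also have "\<dots> \<le> x * L2_norm lebesgue (\<lambda>y. vderiv (wn n) y - vderiv (wn m) y) +
          L2_norm (weighted_line 2) k * L2_norm (weighted_line 2) (wn m)"
        unfolding x_def by (intro add_mono L2_Cauchy_Schwarz L2_diff w'L kL wL)
      also have "\<dots> \<le> x * (e / 2) + L2_norm (weighted_line 2) k * L2_norm (weighted_line 2) (wn m)"
        using N[OF n m] by (intro add_mono mult_left_mono) (auto simp: x_def)
      finally show ?thesis by (simp add: norm_power)
    qed
    have "x\<^sup>2 \<le> x * (e / 2)"
    proof (rule LIMSEQ_le_const)
      show "(\<lambda>m. x * (e / 2) + L2_norm (weighted_line 2) k * L2_norm (weighted_line 2) (\<lambda>x. wn m x - 0)) \<longlonglongrightarrow> x * (e / 2)"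
        using tendsto_add[OF tendsto_const tendsto_mult_left[OF W(2), of "L2_norm (weighted_line 2) k"], of "x * (e / 2)"]
        by simp
      show "\<exists>N. \<forall>m\<ge>N. x\<^sup>2 \<le> x * (e / 2) + L2_norm (weighted_line 2) k * L2_norm (weighted_line 2) (\<lambda>x. wn m x - 0)"
        using step by blast
    qed
    moreover have "0 \<le> x" by (simp add: x_def)
    ultimately have "x \<le> e / 2"
      by (cases "x = 0") (use e in \<open>simp_all add: power2_eq_square\<close>)
    then show ?thesis using e by (simp add: x_def)
  qed
  then show "\<exists>no. \<forall>n\<ge>no. norm (L2_norm lebesgue (vderiv (wn n)) - 0) < e" by auto
qed

section \<open>Form sums with a form-bounded potential\<close>

text \<open>The derivative of the cut-off at scale \<open>R\<close> is of order \<open>1 / R\<close> on an interval of length \<open>4 * R\<close>, where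
  \<open>\<bar>g x\<bar>\<^sup>2\<close> is of order \<open>R\<close> times the energy. So the powers of \<open>R\<close> cancel, and cut-offs at linear scale are
  bounded in the form norm although \<open>\<bar>g\<bar>\<^sup>2\<close> may grow.\<close>

lemma cutoff_mult_energy_bound:
  "\<exists>C\<ge>0. \<forall>n. \<forall>g\<in>line_test. L2_norm lebesgue (vderiv (\<lambda>x. cutoff n x * g x)) \<le> C * sqrt (energy g)"
proof -
  obtain C where C0: "0 < C \<and> (\<forall>n x. cmod (vderiv (cutoff n) x) \<le> C / real (Suc n)) \<and>
      (\<forall>n x. 2 * real (Suc n) < \<bar>x\<bar> \<longrightarrow> vderiv (cutoff n) x = 0)"
    using cutoff_derivative_bound ..
  note C = conjunct1[OF C0] conjunct1[OF conjunct2[OF C0], rule_format] conjunct2[OF conjunct2[OF C0], rule_format]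
  have "L2_norm lebesgue (vderiv (\<lambda>x. cutoff n x * g x)) \<le> (1 + sqrt (48 * C\<^sup>2)) * sqrt (energy g)"
    if g: "g \<in> line_test" for n g
  proof -
    note E = energy_nonneg[of g]
    define R where "R = real (Suc n)"
    have R: "1 \<le> R" by (simp add: R_def)
    have sg: "smooth_on UNIV g" by (rule test_functions_smooth[OF g])
    have gL: "vderiv g \<in> L2 lebesgue" by (rule test_function_L2[OF vderiv_test_function[OF g]])
    have a: "(\<lambda>x. cutoff n x * vderiv g x) \<in> L2 lebesgue"
      by (intro test_function_L2 test_functions_mult_smooth cutoff_test_function smooth_vderiv sg)
    have b: "(\<lambda>x. vderiv (cutoff n) x * g x) \<in> L2 lebesgue"
      by (intro test_function_L2 test_functions_mult_smooth vderiv_test_function cutoff_test_function sg)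
    have "L2_norm lebesgue (vderiv (\<lambda>x. cutoff n x * g x)) =
        L2_norm lebesgue (\<lambda>x. cutoff n x * vderiv g x + vderiv (cutoff n) x * g x)"
      unfolding cutoff_mult_vderiv[OF sg] ..
    also have "\<dots> \<le> L2_norm lebesgue (\<lambda>x. cutoff n x * vderiv g x) + L2_norm lebesgue (\<lambda>x. vderiv (cutoff n) x * g x)"
      by (rule L2_norm_triangle[OF a b])
    also have "L2_norm lebesgue (\<lambda>x. cutoff n x * vderiv g x) \<le> 1 * L2_norm lebesgue (vderiv g)"
      by (rule L2_norm_le_mult[OF gL a]) (use cutoff_le_1 in \<open>auto simp: norm_mult mult_left_le_one_le\<close>)
    also have "1 * L2_norm lebesgue (vderiv g) \<le> sqrt (energy g)"
      using real_sqrt_le_mono[OF energy_ge(1)[of g]] by simp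
    also have "L2_norm lebesgue (\<lambda>x. vderiv (cutoff n) x * g x) \<le> sqrt (48 * C\<^sup>2) * sqrt (energy g)"
    proof -
      let ?w = "\<lambda>x. (C / R)\<^sup>2 * (4 * (1 + 2 * R) * energy g) * indicator {- (2 * R)..2 * R} x"
      have iI: "integrable lebesgue (indicator {- (2 * R)..2 * R} :: real \<Rightarrow> real)"
        by (intro integrable_real_indicator) (auto simp: emeasure_lborel_Icc_eq)
      have "(L2_norm lebesgue (\<lambda>x. vderiv (cutoff n) x * g x))\<^sup>2 \<le> (\<integral>x. ?w x \<partial>lebesgue)"
        unfolding L2_norm_square
      proof (rule integral_mono)
        show "integrable lebesgue (\<lambda>x. (cmod (vderiv (cutoff n) x * g x))\<^sup>2)" by (rule L2_integrable_square[OF b])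
        show "integrable lebesgue ?w" using iI by (intro integrable_mult_right)
        fix x
        show "(cmod (vderiv (cutoff n) x * g x))\<^sup>2 \<le> ?w x"
        proof (cases "\<bar>x\<bar> \<le> 2 * R")
          case False
          then have "vderiv (cutoff n) x = 0" using C(3) by (simp add: R_def del: of_nat_Suc)
          moreover have "0 \<le> ?w x" using R E by simp
          ultimately show ?thesis by simp
        next
          case True
          have "(cmod (vderiv (cutoff n) x))\<^sup>2 \<le> (C / R)\<^sup>2"
            unfolding R_def by (intro power_mono C(2)) auto
          moreover have "(cmod (g x))\<^sup>2 \<le> 4 * (1 + 2 * R) * energy g"
          proof -
            have "4 * (1 + \<bar>x\<bar>) * energy g \<le> 4 * (1 + 2 * R) * energy g"
              using True E by (intro mult_right_mono mult_left_mono) auto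
            then show ?thesis using test_function_pointwise[OF g, of x] by linarith
          qed
          ultimately have "(cmod (vderiv (cutoff n) x))\<^sup>2 * (cmod (g x))\<^sup>2 \<le> (C / R)\<^sup>2 * (4 * (1 + 2 * R) * energy g)"
            by (intro mult_mono) auto
          then show ?thesis using True by (simp add: norm_mult power_mult_distrib indicator_def abs_le_iff)
        qed
      qed
      also have "\<dots> = (C / R)\<^sup>2 * (4 * (1 + 2 * R) * energy g) * (4 * R)"
        using R by simp
      also have "\<dots> = (16 * C\<^sup>2 * energy g) * ((1 + 2 * R) / R)"
        using R by (simp add: power2_eq_square field_simps)
      also have "\<dots> \<le> (16 * C\<^sup>2 * energy g) * 3"
        using R E by (intro mult_left_mono) (auto simp: field_simps)
      finally have "(L2_norm lebesgue (\<lambda>x. vderiv (cutoff n) x * g x))\<^sup>2 \<le> 48 * C\<^sup>2 * energy g" by simp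
      from real_sqrt_le_mono[OF this] show ?thesis by (simp add: real_sqrt_mult)
    qed
    finally show ?thesis by (simp add: distrib_right)
  qed
  moreover have "0 \<le> 1 + sqrt (48 * C\<^sup>2)" by simp
  ultimately show ?thesis by blast
qed

locale form_bounded_potential =
  fixes Y :: "real \<Rightarrow> real" and K :: real
  assumes Y_measurable: "Y \<in> borel_measurable lebesgue"
    and Y_local: "\<And>R. integrable lebesgue (\<lambda>x. indicator {-R..R} x * \<bar>Y x\<bar>)"
    and K_nonneg: "0 \<le> K"
    and pos_integrable: "\<And>g. g \<in> line_test \<Longrightarrow> integrable (weighted_line 2) (\<lambda>x. max (Y x) 0 * (cmod (g x))\<^sup>2)"
    and pos_bound: "\<And>g. g \<in> line_test \<Longrightarrow> (\<integral>x. max (Y x) 0 * (cmod (g x))\<^sup>2 \<partial>weighted_line 2) \<le>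
      1 / 2 * (L2_norm lebesgue (vderiv g))\<^sup>2 + K * (L2_norm (weighted_line 2) g)\<^sup>2"
begin

text \<open>Being in the domain of the potential is membership in the \<open>L2\<close> space of this measure.\<close>

definition P :: "real measure" where "P = density (weighted_line 2) (\<lambda>x. ennreal \<bar>Y x\<bar>)"

abbreviation q where "q \<equiv> minus_potential_form (weighted_line 2) laplace_form Y"

lemma Ym [measurable]: "Y \<in> borel_measurable lebesgue" "Y \<in> borel_measurable (weighted_line 2)"
  using Y_measurable by (auto simp: borel_measurable_weighted_line)

lemma borel_measurable_P: "borel_measurable P = borel_measurable lebesgue"
  by (rule measurable_cong_sets) (simp_all add: P_def)

lemma integrable_P:
  fixes f :: "real \<Rightarrow> 'b::{banach, second_countable_topology}"
  assumes "f \<in> borel_measurable lebesgue"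
  shows "integrable P f \<longleftrightarrow> integrable (weighted_line 2) (\<lambda>x. \<bar>Y x\<bar> *\<^sub>R f x)"
proof -
  have [measurable]: "f \<in> borel_measurable (weighted_line 2)" using assms by (simp add: borel_measurable_weighted_line)
  show ?thesis unfolding P_def by (intro integrable_density) auto
qed

lemma integral_P:
  fixes f :: "real \<Rightarrow> 'b::{banach, second_countable_topology}"
  assumes "f \<in> borel_measurable lebesgue"
  shows "(\<integral>x. f x \<partial>P) = (\<integral>x. \<bar>Y x\<bar> *\<^sub>R f x \<partial>weighted_line 2)"
proof -
  have [measurable]: "f \<in> borel_measurable (weighted_line 2)" using assms by (simp add: borel_measurable_weighted_line)
  show ?thesis unfolding P_def by (intro integral_density) auto
qed

lemma AE_P: "AE x in lebesgue. Q x \<Longrightarrow> AE x in P. Q x"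
  unfolding P_def by (subst AE_density) (auto simp: AE_weighted_line)

lemma P_L2_iff: "u \<in> borel_measurable lebesgue \<Longrightarrow>
    u \<in> L2 P \<longleftrightarrow> integrable (weighted_line 2) (\<lambda>x. \<bar>Y x\<bar> * (cmod (u x))\<^sup>2)"
proof -
  assume [measurable]: "u \<in> borel_measurable lebesgue"
  have "(\<lambda>x. (cmod (u x))\<^sup>2) \<in> borel_measurable lebesgue" by measurable
  from integrable_P[OF this] show ?thesis by (simp add: L2_def borel_measurable_P)
qed

lemma P_norm: "u \<in> borel_measurable lebesgue \<Longrightarrow>
    (L2_norm P u)\<^sup>2 = (\<integral>x. \<bar>Y x\<bar> * (cmod (u x))\<^sup>2 \<partial>weighted_line 2)"
proof -
  assume [measurable]: "u \<in> borel_measurable lebesgue"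
  have "(\<lambda>x. (cmod (u x))\<^sup>2) \<in> borel_measurable lebesgue" by measurable
  from integral_P[OF this] show ?thesis by (simp add: L2_norm_square)
qed

lemma potential_inner:
  assumes "u \<in> borel_measurable lebesgue" "v \<in> borel_measurable lebesgue"
  shows "(\<integral>x. complex_of_real (Y x) * (u x * cnj (v x)) \<partial>weighted_line 2) =
    L2_inner P (\<lambda>x. complex_of_real (sgn (Y x)) * u x) v"
proof -
  have [measurable]: "(\<lambda>x. cnj (v x)) \<in> borel_measurable lebesgue"
    using borel_measurable_continuous_on[OF continuous_on_cnj[OF continuous_on_id] assms(2)] .
  have [measurable]: "(\<lambda>x. sgn (Y x)) \<in> borel_measurable lebesgue"
    using measurable_comp[OF Ym(1) borel_measurable_sgn] by (simp add: o_def)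
  have m: "(\<lambda>x. complex_of_real (sgn (Y x)) * u x * cnj (v x)) \<in> borel_measurable lebesgue"
    using assms(1) by measurable
  show ?thesis
    unfolding L2_inner_def integral_P[OF m]
    by (intro Bochner_Integration.integral_cong refl)
       (simp add: scaleR_conv_of_real abs_sgn mult_ac flip: of_real_mult)
qed

lemma sgn_L2: "u \<in> L2 P \<Longrightarrow> (\<lambda>x. complex_of_real (sgn (Y x)) * u x) \<in> L2 P"
proof (rule L2_bounded_mult[where C=1])
  have "(\<lambda>x. sgn (Y x)) \<in> borel_measurable lebesgue"
    using measurable_comp[OF Ym(1) borel_measurable_sgn] by (simp add: o_def)
  then show "(\<lambda>x. complex_of_real (sgn (Y x))) \<in> borel_measurable P"
    unfolding borel_measurable_P by measurable
qed (auto simp: sgn_real_def)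

lemma sgn_norm_le:
  assumes "u \<in> L2 P"
  shows "L2_norm P (\<lambda>x. complex_of_real (sgn (Y x)) * u x) \<le> L2_norm P u"
  using L2_norm_le_mult[OF assms sgn_L2[OF assms], of 1] by (simp add: norm_mult sgn_real_def)

lemma local_integrable_weighted:
  assumes "continuous_on UNIV f"
  shows "integrable (weighted_line 2) (\<lambda>x. \<bar>Y x\<bar> * (indicator {-R..R} x * (f x :: real)))"
proof -
  have fm [measurable]: "f \<in> borel_measurable lebesgue" by (rule continuous_lebesgue_measurable[OF assms])
  have "compact ((\<lambda>x. exp (2 * x) * f x) ` {-R..R})"
    by (intro compact_continuous_image continuous_intros continuous_on_subset[OF assms]) auto
  from compact_imp_bounded[OF this]
  obtain C where C0: "\<forall>y\<in>(\<lambda>x. exp (2 * x) * f x) ` {-R..R}. norm y \<le> C"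
    unfolding bounded_iff by blast
  have C: "norm (exp (2 * x) * f x) \<le> C" if "x \<in> {-R..R}" for x
    using bspec[OF C0 imageI[OF that]] .
  have [measurable]: "(\<lambda>x. indicator {-R..R} x :: real) \<in> borel_measurable lebesgue"
    by (intro borel_measurable_indicator) auto
  have "integrable lebesgue (\<lambda>x. exp (2 * x) * (\<bar>Y x\<bar> * (indicator {-R..R} x * f x)))"
  proof (rule Bochner_Integration.integrable_bound)
    show "integrable lebesgue (\<lambda>x. C * (indicator {-R..R} x * \<bar>Y x\<bar>))" by (intro integrable_mult_right Y_local)
    show "(\<lambda>x. exp (2 * x) * (\<bar>Y x\<bar> * (indicator {-R..R} x * f x))) \<in> borel_measurable lebesgue" by measurable
    show "AE x in lebesgue. norm (exp (2 * x) * (\<bar>Y x\<bar> * (indicator {-R..R} x * f x))) \<le> norm (C * (indicator {-R..R} x * \<bar>Y x\<bar>))"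
    proof (rule AE_I2)
      fix x
      show "norm (exp (2 * x) * (\<bar>Y x\<bar> * (indicator {-R..R} x * f x))) \<le> norm (C * (indicator {-R..R} x * \<bar>Y x\<bar>))"
      proof (cases "x \<in> {-R..R}")
        case True
        then have c: "\<bar>exp (2 * x) * f x\<bar> \<le> C" using C[of x] by (simp only: real_norm_def)
        have "norm (exp (2 * x) * (\<bar>Y x\<bar> * (indicator {-R..R} x * f x))) = \<bar>exp (2 * x) * f x\<bar> * \<bar>Y x\<bar>"
          using True by (simp add: abs_mult)
        also have "\<dots> \<le> C * \<bar>Y x\<bar>" using c by (intro mult_right_mono) auto
        also have "\<dots> \<le> \<bar>C * \<bar>Y x\<bar>\<bar>" by (rule abs_ge_self)
        finally show ?thesis using True by simp
      qed simp
    qed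
  qed
  then show ?thesis by (subst integrable_weighted_line) (simp_all, measurable)
qed

lemma test_P_L2:
  assumes g: "g \<in> line_test"
  shows "g \<in> L2 P"
proof -
  obtain R where R: "0 < R \<and> (\<forall>x. R \<le> \<bar>x\<bar> \<longrightarrow> g x = 0)" using test_functions_UNIV_support[OF g] ..
  have c: "continuous_on UNIV g" by (intro smooth_on_continuous test_functions_smooth g)
  have "integrable (weighted_line 2) (\<lambda>x. \<bar>Y x\<bar> * (indicator {-R..R} x * (cmod (g x))\<^sup>2))"
    by (intro local_integrable_weighted continuous_intros c)
  moreover have "indicator {-R..R} x * (cmod (g x))\<^sup>2 = (cmod (g x))\<^sup>2" for x
  proof (cases "x \<in> {-R..R}")
    case False
    then have "R \<le> \<bar>x\<bar>" by auto
    then have "g x = 0" using R by blast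
    then show ?thesis by simp
  qed simp
  ultimately show ?thesis
    using P_L2_iff[OF continuous_lebesgue_measurable[OF c]] by simp
qed

lemma test_measurable: "g \<in> line_test \<Longrightarrow> g \<in> borel_measurable lebesgue"
  by (intro smooth_lebesgue_measurable test_functions_smooth)

text \<open>The form \<open>q\<close> is indefinite. Half of the kinetic energy absorbs the positive part of the potential, so
  that on test functions the form norms of \<open>q\<close> and of the sum of the kinetic energy and the
  absolute value of the potential are equivalent.\<close>

lemma q_test_bounds:
  assumes g: "g \<in> line_test"
  shows "(L2_norm lebesgue (vderiv g))\<^sup>2 + (L2_norm P g)\<^sup>2 \<le> 4 * cmod (q g g) + 5 * K * (L2_norm (weighted_line 2) g)\<^sup>2"
    and "cmod (q g g) \<le> (L2_norm lebesgue (vderiv g))\<^sup>2 + (L2_norm P g)\<^sup>2"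
proof -
  let ?N = "weighted_line 2"
  define t n Vp Va where defs: "t = (L2_norm lebesgue (vderiv g))\<^sup>2" "n = (L2_norm ?N g)\<^sup>2"
    "Vp = (\<integral>x. max (Y x) 0 * (cmod (g x))\<^sup>2 \<partial>?N)" "Va = (L2_norm P g)\<^sup>2"
  note gm = test_measurable[OF g]
  have gm' [measurable]: "g \<in> borel_measurable ?N" using gm by (simp add: borel_measurable_weighted_line)
  have ia: "integrable ?N (\<lambda>x. \<bar>Y x\<bar> * (cmod (g x))\<^sup>2)" using P_L2_iff[OF gm] test_P_L2[OF g] by simp
  note ip = pos_integrable[OF g]
  have Va: "Va = (\<integral>x. \<bar>Y x\<bar> * (cmod (g x))\<^sup>2 \<partial>?N)" by (simp add: defs P_norm[OF gm])
  have eq: "Y x * (cmod (g x))\<^sup>2 = 2 * (max (Y x) 0 * (cmod (g x))\<^sup>2) - \<bar>Y x\<bar> * (cmod (g x))\<^sup>2" for x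
    by (simp add: max_def abs_if)
  have V: "(\<integral>x. Y x * (cmod (g x))\<^sup>2 \<partial>?N) = 2 * Vp - Va"
    unfolding eq Va defs(3) by (subst Bochner_Integration.integral_diff) (use ia ip in auto)
  have "(\<integral>x. complex_of_real (Y x) * (g x * cnj (g x)) \<partial>?N) = (\<integral>x. complex_of_real (Y x * (cmod (g x))\<^sup>2) \<partial>?N)"
    by (intro Bochner_Integration.integral_cong refl) (simp add: complex_norm_square del: of_real_power)
  also have "\<dots> = complex_of_real (2 * Vp - Va)" by (simp only: integral_complex_of_real V)
  finally have "q g g = complex_of_real (t - (2 * Vp - Va))"
    by (simp add: minus_potential_form_def laplace_form_eq L2_inner_self defs)
  then have Q: "cmod (q g g) = \<bar>t - (2 * Vp - Va)\<bar>" by (simp only: norm_of_real)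
  have nn: "0 \<le> t" "0 \<le> n" "0 \<le> Vp" "0 \<le> Va" by (auto simp: defs)
  have le: "Vp \<le> Va" unfolding Va defs(3) by (intro integral_mono ia ip) (auto intro!: mult_right_mono)
  have pb: "Vp \<le> 1 / 2 * t + K * n" using pos_bound[OF g] by (simp add: defs)
  have Kn: "0 \<le> K * n" using K_nonneg nn by simp
  show "(L2_norm lebesgue (vderiv g))\<^sup>2 + (L2_norm P g)\<^sup>2 \<le> 4 * cmod (q g g) + 5 * K * (L2_norm ?N g)\<^sup>2"
    unfolding defs[symmetric] Q using pb Kn le nn by (auto simp: abs_if algebra_simps)
  show "cmod (q g g) \<le> (L2_norm lebesgue (vderiv g))\<^sup>2 + (L2_norm P g)\<^sup>2"
    unfolding defs[symmetric] Q using le nn by (auto simp: abs_if)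
qed

end

context form_bounded_potential
begin

lemma q_approx_imp:
  assumes a: "form_approx (weighted_line 2) line_test q un u" and u: "u \<in> L2 (weighted_line 2)"
  shows "form_approx (weighted_line 2) line_test laplace_form un u"
    and "0 < \<epsilon> \<Longrightarrow> \<exists>M. \<forall>m\<ge>M. \<forall>n\<ge>M. L2_norm P (\<lambda>x. un m x - un n x) < \<epsilon>"
proof -
  let ?N = "weighted_line 2"
  have uT: "un n \<in> line_test" for n using a by (simp add: form_approx_def)
  have lim: "(\<lambda>n. L2_norm ?N (\<lambda>x. un n x - u x)) \<longlonglongrightarrow> 0" using a by (simp add: form_approx_def)
  have qC: "\<exists>M. \<forall>m\<ge>M. \<forall>n\<ge>M. cmod (q (\<lambda>x. un m x - un n x) (\<lambda>x. un m x - un n x)) < e" if "0 < e" for e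
    using a that by (simp add: form_approx_def)
  have L: "un n \<in> L2 ?N" for n by (intro test_function_L2 uT)
  have main: "\<exists>M. \<forall>m\<ge>M. \<forall>n\<ge>M. L2_norm lebesgue (\<lambda>y. vderiv (un m) y - vderiv (un n) y) < e \<and>
      L2_norm P (\<lambda>x. un m x - un n x) < e" if e: "0 < e" for e
  proof -
    \<comment> \<open>Chosen such that the term with \<open>5 * K\<close> in \<open>q_test_bounds\<close> takes at most half of \<open>e\<^sup>2\<close>.\<close>
    define \<delta> where "\<delta> = e / sqrt (10 * (K + 1)) / 2"
    have s0: "0 < sqrt (10 * (K + 1))" using K_nonneg by simp
    have \<delta>: "0 < \<delta>" using e s0 by (simp add: \<delta>_def)
    have "(2 * \<delta>)\<^sup>2 = e\<^sup>2 / (10 * (K + 1))" using K_nonneg by (simp add: \<delta>_def power_divide)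
    then have "\<delta>\<^sup>2 * 40 + K * (\<delta>\<^sup>2 * 40) = e\<^sup>2" using K_nonneg by (simp add: field_simps)
    then have "K * (\<delta>\<^sup>2 * 40) \<le> e\<^sup>2" using zero_le_power2[of \<delta>] by linarith
    then have \<delta>2: "5 * K * (2 * \<delta>)\<^sup>2 \<le> e\<^sup>2 / 2" by (simp add: power_mult_distrib)
    have e8: "0 < e\<^sup>2 / 8" using e by simp
    obtain M1 where M1: "\<And>m n. m \<ge> M1 \<Longrightarrow> n \<ge> M1 \<Longrightarrow> cmod (q (\<lambda>x. un m x - un n x) (\<lambda>x. un m x - un n x)) < e\<^sup>2 / 8"
      using qC[OF e8] by auto
    obtain M2 where M2: "\<And>n. n \<ge> M2 \<Longrightarrow> L2_norm ?N (\<lambda>x. un n x - u x) < \<delta>"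
      using LIMSEQ_D[OF lim \<delta>] by auto
    have "L2_norm lebesgue (\<lambda>y. vderiv (un m) y - vderiv (un n) y) < e \<and> L2_norm P (\<lambda>x. un m x - un n x) < e"
      if mn: "m \<ge> max M1 M2" "n \<ge> max M1 M2" for m n
    proof -
      let ?d = "\<lambda>x. un m x - un n x"
      have d: "?d \<in> line_test" by (intro test_functions_diff uT)
      have "L2_norm ?N ?d \<le> L2_norm ?N (\<lambda>x. un m x - u x) + L2_norm ?N (\<lambda>x. u x - un n x)"
        by (rule L2_norm_triangle_diff[OF L u L])
      also have "\<dots> \<le> 2 * \<delta>" using M2[of m] M2[of n] mn by (simp add: L2_norm_minus_commute[of _ u])
      finally have "(L2_norm ?N ?d)\<^sup>2 \<le> (2 * \<delta>)\<^sup>2" by (intro power_mono) auto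
      then have "5 * K * (L2_norm ?N ?d)\<^sup>2 \<le> 5 * K * (2 * \<delta>)\<^sup>2"
        using K_nonneg by (intro mult_left_mono) auto
      then have "5 * K * (L2_norm ?N ?d)\<^sup>2 \<le> e\<^sup>2 / 2" using \<delta>2 by linarith
      moreover have "4 * cmod (q ?d ?d) < e\<^sup>2 / 2" using M1[of m n] mn by simp
      ultimately have s: "(L2_norm lebesgue (vderiv ?d))\<^sup>2 + (L2_norm P ?d)\<^sup>2 < e\<^sup>2"
        using q_test_bounds(1)[OF d] by linarith
      have "(L2_norm lebesgue (vderiv ?d))\<^sup>2 < e\<^sup>2" "(L2_norm P ?d)\<^sup>2 < e\<^sup>2"
        using s zero_le_power2[of "L2_norm lebesgue (vderiv ?d)"] zero_le_power2[of "L2_norm P ?d"] by linarith+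
      then have "L2_norm lebesgue (vderiv ?d) < e" "L2_norm P ?d < e"
        using e power2_less_imp_less[of _ e] by (auto intro: power2_less_imp_less)
      then show ?thesis unfolding line.d_diff[OF uT uT] by simp
    qed
    then show ?thesis by blast
  qed
  show "form_approx ?N line_test laplace_form un u"
    unfolding line.form_approx_iff using uT lim main by blast
  show "0 < \<epsilon> \<Longrightarrow> \<exists>M. \<forall>m\<ge>M. \<forall>n\<ge>M. L2_norm P (\<lambda>x. un m x - un n x) < \<epsilon>"
    using main by blast
qed

lemma q_approxI:
  assumes a: "form_approx (weighted_line 2) line_test laplace_form un u"
    and c: "\<And>\<epsilon>. 0 < \<epsilon> \<Longrightarrow> \<exists>M. \<forall>m\<ge>M. \<forall>n\<ge>M. L2_norm P (\<lambda>x. un m x - un n x) < \<epsilon>"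
  shows "form_approx (weighted_line 2) line_test q un u"
proof -
  note U = line.form_approxD[OF a]
  have "\<exists>M. \<forall>m\<ge>M. \<forall>n\<ge>M. cmod (q (\<lambda>x. un m x - un n x) (\<lambda>x. un m x - un n x)) < e" if e: "0 < e" for e
  proof -
    define \<delta> where "\<delta> = sqrt (e / 2)"
    have \<delta>: "0 < \<delta>" "\<delta>\<^sup>2 = e / 2" using e by (simp_all add: \<delta>_def)
    obtain M1 where M1: "\<And>m n. m \<ge> M1 \<Longrightarrow> n \<ge> M1 \<Longrightarrow> L2_norm lebesgue (\<lambda>y. vderiv (un m) y - vderiv (un n) y) < \<delta>"
      using U(3)[OF \<delta>(1)] by auto
    obtain M2 where M2: "\<And>m n. m \<ge> M2 \<Longrightarrow> n \<ge> M2 \<Longrightarrow> L2_norm P (\<lambda>x. un m x - un n x) < \<delta>"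
      using c[OF \<delta>(1)] by auto
    have "cmod (q (\<lambda>x. un m x - un n x) (\<lambda>x. un m x - un n x)) < e" if mn: "m \<ge> max M1 M2" "n \<ge> max M1 M2" for m n
    proof -
      let ?d = "\<lambda>x. un m x - un n x"
      have d: "?d \<in> line_test" by (intro test_functions_diff U(1))
      have "(L2_norm lebesgue (vderiv ?d))\<^sup>2 < \<delta>\<^sup>2"
        unfolding line.d_diff[OF U(1) U(1)] using M1[of m n] mn by (intro power_strict_mono) auto
      moreover have "(L2_norm P ?d)\<^sup>2 < \<delta>\<^sup>2" using M2[of m n] mn by (intro power_strict_mono) auto
      ultimately show ?thesis using q_test_bounds(2)[OF d] \<delta>(2) by linarith
    qed
    then show ?thesis by blast
  qed
  then show ?thesis using U(1,2) by (simp add: form_approx_def)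
qed

lemma P_limit:
  assumes a: "form_approx (weighted_line 2) line_test laplace_form un u" and u: "u \<in> L2 (weighted_line 2)"
    and c: "\<And>\<epsilon>. 0 < \<epsilon> \<Longrightarrow> \<exists>M. \<forall>m\<ge>M. \<forall>n\<ge>M. L2_norm P (\<lambda>x. un m x - un n x) < \<epsilon>"
  shows "u \<in> L2 P" "(\<lambda>n. L2_norm P (\<lambda>x. un n x - u x)) \<longlonglongrightarrow> 0"
proof -
  note U = line.form_approxD[OF a]
  obtain v where v: "\<And>x. (\<lambda>n. un n x) \<longlonglongrightarrow> v x" "AE x in lebesgue. u x = v x"
    using form_approx_locally_uniform[OF a u] by metis
  have uP: "un n \<in> L2 P" for n by (rule test_P_L2[OF U(1)])
  have um: "u \<in> borel_measurable P"
    using L2_measurable[OF u] by (simp add: borel_measurable_P borel_measurable_weighted_line)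
  \<comment> \<open>Fatou's lemma along \<open>m\<close> for fixed \<open>n\<close> passes from \<open>un m - un n\<close> to \<open>u - un n\<close>.\<close>
  have main: "\<exists>M. \<forall>n\<ge>M. (\<lambda>x. u x - un n x) \<in> L2 P \<and> L2_norm P (\<lambda>x. u x - un n x) \<le> e" if e: "0 < e" for e
  proof -
    obtain M where M: "\<And>m n. m \<ge> M \<Longrightarrow> n \<ge> M \<Longrightarrow> L2_norm P (\<lambda>x. un m x - un n x) < e"
      using c[OF e] by auto
    have "(\<lambda>x. u x - un n x) \<in> L2 P \<and> L2_norm P (\<lambda>x. u x - un n x) \<le> e" if n: "n \<ge> M" for n
    proof -
      have f: "(\<lambda>x. un m x - un n x) \<in> L2 P" for m by (intro L2_diff uP)
      have F: "(\<lambda>x. u x - un n x) \<in> borel_measurable P" using um L2_measurable[OF uP[of n]] by measurable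
      have lim: "AE x in P. (\<lambda>m. un m x - un n x) \<longlonglongrightarrow> u x - un n x"
        using AE_P[OF v(2)]
      proof eventually_elim
        fix x assume "u x = v x"
        then show "(\<lambda>m. un m x - un n x) \<longlonglongrightarrow> u x - un n x"
          using tendsto_diff[OF v(1)[of x] tendsto_const[of "un n x"]] by simp
      qed
      have ev: "\<forall>\<^sub>F m in sequentially. L2_norm P (\<lambda>x. un m x - un n x) \<le> e"
        by (rule eventually_sequentiallyI[of M]) (use M n in \<open>auto intro: less_imp_le\<close>)
      from L2_Fatou[OF f F lim ev] e show ?thesis by simp
    qed
    then show ?thesis by blast
  qed
  obtain n where n: "(\<lambda>x. u x - un n x) \<in> L2 P" using main[of 1] by auto
  show uL: "u \<in> L2 P" using L2_add[OF n uP[of n]] by simp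
  show "(\<lambda>n. L2_norm P (\<lambda>x. un n x - u x)) \<longlonglongrightarrow> 0"
  proof (rule LIMSEQ_I)
    fix e :: real assume e: "0 < e"
    then have "0 < e / 2" by simp
    from main[OF this] obtain M where M: "\<And>n. n \<ge> M \<Longrightarrow> L2_norm P (\<lambda>x. u x - un n x) \<le> e / 2" by blast
    have "norm (L2_norm P (\<lambda>x. un n x - u x) - 0) < e" if "n \<ge> M" for n
      using M[OF that] e L2_norm_minus_commute[of P u "un n"] by simp
    then show "\<exists>no. \<forall>n\<ge>no. norm (L2_norm P (\<lambda>x. un n x - u x) - 0) < e" by blast
  qed
qed

lemma q_limit:
  assumes u: "u \<in> L2 (weighted_line 2)" and v: "v \<in> L2 (weighted_line 2)"
    and a: "form_approx (weighted_line 2) line_test q un u" and b: "form_approx (weighted_line 2) line_test q vn v"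
  shows "(\<lambda>n. q (un n) (vn n)) \<longlonglongrightarrow>
    minus_potential_form (weighted_line 2) (closure_form (weighted_line 2) line_test laplace_form) Y u v"
proof -
  note A = q_approx_imp[OF a u] and B = q_approx_imp[OF b v]
  note PA = P_limit[OF A(1) u A(2)] and PB = P_limit[OF B(1) v B(2)]
  have uT: "un n \<in> line_test" "vn n \<in> line_test" for n
    using a b by (simp_all add: form_approx_def)
  have m: "w \<in> borel_measurable lebesgue" if "w \<in> L2 (weighted_line 2)" for w
    using L2_measurable[OF that] by (simp add: borel_measurable_weighted_line)
  have "(\<lambda>n. laplace_form (un n) (vn n)) \<longlonglongrightarrow> closure_form (weighted_line 2) line_test laplace_form u v"
    by (rule line.closure_form_limit[OF laplace_closable test_functions_diff u v A(1) B(1)])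
  moreover have "(\<lambda>n. L2_inner P (\<lambda>x. complex_of_real (sgn (Y x)) * un n x) (vn n)) \<longlonglongrightarrow>
      L2_inner P (\<lambda>x. complex_of_real (sgn (Y x)) * u x) v"
  proof (rule L2_inner_tendsto)
    show "(\<lambda>x. complex_of_real (sgn (Y x)) * un n x) \<in> L2 P" for n by (intro sgn_L2 test_P_L2 uT)
    show "vn n \<in> L2 P" for n by (intro test_P_L2 uT)
    show "(\<lambda>x. complex_of_real (sgn (Y x)) * u x) \<in> L2 P" by (intro sgn_L2 PA)
    show "v \<in> L2 P" by (rule PB(1))
    show "(\<lambda>n. L2_norm P (\<lambda>x. vn n x - v x)) \<longlonglongrightarrow> 0" by (rule PB(2))
    show "(\<lambda>n. L2_norm P (\<lambda>x. complex_of_real (sgn (Y x)) * un n x - complex_of_real (sgn (Y x)) * u x)) \<longlonglongrightarrow> 0"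
    proof (rule Lim_null_comparison[OF always_eventually PA(2)], rule allI)
      fix n
      have "(\<lambda>x. un n x - u x) \<in> L2 P" by (intro L2_diff test_P_L2 uT PA)
      from sgn_norm_le[OF this]
      show "norm (L2_norm P (\<lambda>x. complex_of_real (sgn (Y x)) * un n x - complex_of_real (sgn (Y x)) * u x)) \<le>
          L2_norm P (\<lambda>x. un n x - u x)" by (simp add: right_diff_distrib)
    qed
  qed
  ultimately have "(\<lambda>n. laplace_form (un n) (vn n) - L2_inner P (\<lambda>x. complex_of_real (sgn (Y x)) * un n x) (vn n)) \<longlonglongrightarrow>
      closure_form (weighted_line 2) line_test laplace_form u v - L2_inner P (\<lambda>x. complex_of_real (sgn (Y x)) * u x) v"
    by (rule tendsto_diff)
  then show ?thesis
    unfolding minus_potential_form_def potential_inner[OF m[OF u] m[OF v]]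
      potential_inner[OF test_measurable[OF uT(1)] test_measurable[OF uT(2)]] .
qed

text \<open>The approximant is \<open>cutoff j * gn n\<close>. Take \<open>N0\<close> such that \<open>gn\<close> varies little in energy beyond
  \<open>N0\<close>. Then take \<open>j\<close> such that \<open>cutoff j\<close> fixes \<open>gn N0\<close> and changes \<open>u\<close> little in \<open>L2 P\<close>: as multiplication by
  \<open>cutoff j\<close> is bounded in energy, uniformly in \<open>j\<close>, \<open>cutoff j * gn n\<close> stays close to \<open>gn n\<close>. Finally take
  \<open>n\<close> depending on \<open>j\<close>, such that \<open>gn n\<close> is uniformly close to \<open>u\<close> on the support of \<open>cutoff j\<close>, where the
  potential is integrable.\<close>

lemma cutoff_approximant:
  assumes a: "form_approx (weighted_line 2) line_test laplace_form gn u" and u: "u \<in> L2 (weighted_line 2)"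
    and uP: "u \<in> L2 P" and e: "0 < \<epsilon>"
  shows "\<exists>k\<in>line_test. L2_norm P (\<lambda>x. k x - u x) < \<epsilon> \<and>
    (\<exists>M. \<forall>m\<ge>M. L2_norm lebesgue (\<lambda>x. vderiv k x - vderiv (gn m) x) < \<epsilon> \<and>
       L2_norm (weighted_line 2) (\<lambda>x. k x - gn m x) < \<epsilon>)"
proof -
  let ?N = "weighted_line 2"
  note U = line.form_approxD[OF a]
  obtain C where C: "0 \<le> C" "\<And>n g. g \<in> line_test \<Longrightarrow> L2_norm lebesgue (vderiv (\<lambda>x. cutoff n x * g x)) \<le> C * sqrt (energy g)"
    using cutoff_mult_energy_bound by blast
  \<comment> \<open>Small enough for \<open>C * \<delta> + \<delta> < \<epsilon>\<close> and \<open>\<delta> + \<delta> < \<epsilon>\<close>.\<close>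
  define \<delta> where "\<delta> = \<epsilon> / (C + 3)"
  have \<delta>: "0 < \<delta>" using e C(1) by (simp add: \<delta>_def)
  have \<delta>e: "C * \<delta> + \<delta> < \<epsilon>" "\<delta> + \<delta> < \<epsilon>"
  proof -
    have "\<epsilon> = (C + 3) * \<delta>" using C(1) by (simp add: \<delta>_def)
    then have "\<epsilon> = C * \<delta> + 3 * \<delta>" by (simp add: distrib_right)
    then show "C * \<delta> + \<delta> < \<epsilon>" "\<delta> + \<delta> < \<epsilon>" using \<delta> mult_nonneg_nonneg[OF C(1) less_imp_le[OF \<delta>]] by linarith+
  qed
  have mc: "cutoff n \<in> borel_measurable M" if "borel_measurable M = (borel_measurable lebesgue :: (real \<Rightarrow> complex) set)" for n M
    unfolding that by (intro smooth_lebesgue_measurable smooth_cutoff)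
  obtain N0 where N0: "\<And>m n. m \<ge> N0 \<Longrightarrow> n \<ge> N0 \<Longrightarrow> energy (\<lambda>x. gn m x - gn n x) < \<delta>\<^sup>2"
    using energy_Cauchy[OF a u, of "\<delta>\<^sup>2"] \<delta> by auto
  have sE: "sqrt (energy (\<lambda>x. gn m x - gn n x)) \<le> \<delta>" if "m \<ge> N0" "n \<ge> N0" for m n
    using real_sqrt_le_mono[OF less_imp_le[OF N0[OF that]]] \<delta> by simp
  have small: "L2_norm lebesgue (\<lambda>x. vderiv (gn m) x - vderiv (gn n) x) \<le> \<delta>" "L2_norm ?N (\<lambda>x. gn m x - gn n x) \<le> \<delta>"
    if "m \<ge> N0" "n \<ge> N0" for m n
  proof -
    let ?d = "\<lambda>x. gn m x - gn n x"
    have "L2_norm lebesgue (vderiv ?d) \<le> sqrt (energy ?d)" "L2_norm ?N ?d \<le> sqrt (energy ?d)"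
      using real_sqrt_le_mono[OF energy_ge(1)[of ?d]] real_sqrt_le_mono[OF energy_ge(2)[of ?d]] by simp_all
    then show "L2_norm lebesgue (\<lambda>x. vderiv (gn m) x - vderiv (gn n) x) \<le> \<delta>" "L2_norm ?N ?d \<le> \<delta>"
      using sE[OF that] unfolding line.d_diff[OF U(1) U(1)] by linarith+
  qed
  obtain R where R: "0 < R \<and> (\<forall>x. R \<le> \<bar>x\<bar> \<longrightarrow> gn N0 x = 0)" using test_functions_UNIV_support[OF U(1)] ..
  have lim: "(\<lambda>n. L2_norm P (\<lambda>x. u x - cutoff n x * u x)) \<longlonglongrightarrow> 0"
    by (rule L2_cutoff_tendsto[OF uP mc[OF borel_measurable_P]])
  have "\<forall>\<^sub>F j in sequentially. L2_norm P (\<lambda>x. u x - cutoff j x * u x) < \<epsilon> / 2 \<and> R \<le> real (Suc j)"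
  proof (rule eventually_conj)
    show "\<forall>\<^sub>F j in sequentially. L2_norm P (\<lambda>x. u x - cutoff j x * u x) < \<epsilon> / 2"
      using order_tendstoD(2)[OF lim, of "\<epsilon> / 2"] e by simp
    obtain N :: nat where N: "R \<le> real N" using real_arch_simple by blast
    show "\<forall>\<^sub>F j in sequentially. R \<le> real (Suc j)"
      by (rule eventually_sequentiallyI[of N]) (use N in linarith)
  qed
  then obtain j where j: "L2_norm P (\<lambda>x. u x - cutoff j x * u x) < \<epsilon> / 2" "R \<le> real (Suc j)"
    by (auto simp: eventually_sequentially)
  define Q where "Q = 2 * real (Suc j)"
  have cutoff_id: "cutoff j x * gn N0 x = gn N0 x" for x
  proof (cases "\<bar>x\<bar> \<le> real (Suc j)")
    case True then show ?thesis using cutoff_eq_1 by simp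
  next
    case False
    then have "gn N0 x = 0" using R j(2) by auto
    then show ?thesis by simp
  qed
  obtain v where v: "AE x in lebesgue. u x = v x"
    "\<And>\<delta>. 0 < \<delta> \<Longrightarrow> \<exists>N. \<forall>n\<ge>N. \<forall>x. (cmod (gn n x - v x))\<^sup>2 \<le> 4 * (1 + \<bar>x\<bar>) * \<delta>"
    using form_approx_locally_uniform[OF a u] by metis
  define A where "A = (\<integral>x. \<bar>Y x\<bar> * (indicator {-Q..Q} x * (4 * (1 + \<bar>x\<bar>))) \<partial>?N)"
  have Ai: "integrable ?N (\<lambda>x. \<bar>Y x\<bar> * (indicator {-Q..Q} x * (4 * (1 + \<bar>x\<bar>))))"
    by (intro local_integrable_weighted continuous_intros)
  have A0: "0 \<le> A" unfolding A_def by (intro Bochner_Integration.integral_nonneg) simp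
  \<comment> \<open>The denominator is increased by \<open>1\<close> because \<open>A = 0\<close> is possible.\<close>
  define \<eta> where "\<eta> = (\<epsilon> / 4)\<^sup>2 / (A + 1)"
  have \<eta>: "0 < \<eta>" using e A0 by (simp add: \<eta>_def)
  have \<eta>A: "\<eta> * A \<le> (\<epsilon> / 4)\<^sup>2"
  proof -
    have "\<eta> * A \<le> \<eta> * (A + 1)" using \<eta> by (intro mult_left_mono) auto
    also have "\<dots> = (\<epsilon> / 4)\<^sup>2" using A0 by (simp add: \<eta>_def)
    finally show ?thesis .
  qed
  obtain N1 where N1: "\<And>n x. n \<ge> N1 \<Longrightarrow> (cmod (gn n x - v x))\<^sup>2 \<le> 4 * (1 + \<bar>x\<bar>) * \<eta>"
    using v(2)[OF \<eta>] by blast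
  define n where "n = max N0 N1"
  define k where "k = (\<lambda>x. cutoff j x * gn n x)"
  have kT: "k \<in> line_test"
    unfolding k_def by (intro test_functions_mult_smooth cutoff_test_function test_functions_smooth U(1))
  have P1: "(\<lambda>x. cutoff j x * (gn n x - u x)) \<in> L2 P"
    by (rule L2_bounded_mult[where C=1, OF L2_diff[OF test_P_L2[OF U(1)] uP] mc[OF borel_measurable_P] cutoff_le_1])
  have "(L2_norm P (\<lambda>x. cutoff j x * (gn n x - u x)))\<^sup>2 =
      (\<integral>x. \<bar>Y x\<bar> * (cmod (cutoff j x * (gn n x - u x)))\<^sup>2 \<partial>?N)"
    using L2_measurable[OF P1] by (intro P_norm) (simp add: borel_measurable_P)
  also have "\<dots> \<le> (\<integral>x. \<eta> * (\<bar>Y x\<bar> * (indicator {-Q..Q} x * (4 * (1 + \<bar>x\<bar>)))) \<partial>?N)"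
  proof (rule integral_mono_AE)
    show "integrable ?N (\<lambda>x. \<bar>Y x\<bar> * (cmod (cutoff j x * (gn n x - u x)))\<^sup>2)"
      using P1 L2_measurable[OF P1] P_L2_iff by (simp add: borel_measurable_P)
    show "integrable ?N (\<lambda>x. \<eta> * (\<bar>Y x\<bar> * (indicator {-Q..Q} x * (4 * (1 + \<bar>x\<bar>)))))"
      by (intro integrable_mult_right Ai)
    have "AE x in ?N. u x = v x" using v(1) by (simp add: AE_weighted_line)
    then show "AE x in ?N. \<bar>Y x\<bar> * (cmod (cutoff j x * (gn n x - u x)))\<^sup>2 \<le>
        \<eta> * (\<bar>Y x\<bar> * (indicator {-Q..Q} x * (4 * (1 + \<bar>x\<bar>))))"
    proof eventually_elim
      fix x assume uv: "u x = v x"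
      have "(cmod (cutoff j x * (gn n x - u x)))\<^sup>2 \<le> indicator {-Q..Q} x * (4 * (1 + \<bar>x\<bar>) * \<eta>)"
      proof (cases "\<bar>x\<bar> \<le> Q")
        case True
        have "cmod (cutoff j x * (gn n x - u x)) \<le> cmod (gn n x - v x)"
          using cutoff_le_1[of j x] by (simp add: uv norm_mult mult_left_le_one_le)
        then have "(cmod (cutoff j x * (gn n x - u x)))\<^sup>2 \<le> (cmod (gn n x - v x))\<^sup>2" by (intro power_mono) auto
        also have "\<dots> \<le> 4 * (1 + \<bar>x\<bar>) * \<eta>" by (rule N1) (simp add: n_def)
        finally show ?thesis using True by (simp add: indicator_def abs_le_iff)
      next
        case False
        then have "cutoff j x = 0" by (intro cutoff_eq_0) (simp add: Q_def)
        then show ?thesis using \<eta> by (simp add: indicator_def)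
      qed
      then have "\<bar>Y x\<bar> * (cmod (cutoff j x * (gn n x - u x)))\<^sup>2 \<le> \<bar>Y x\<bar> * (indicator {-Q..Q} x * (4 * (1 + \<bar>x\<bar>) * \<eta>))"
        by (intro mult_left_mono) auto
      then show "\<bar>Y x\<bar> * (cmod (cutoff j x * (gn n x - u x)))\<^sup>2 \<le>
        \<eta> * (\<bar>Y x\<bar> * (indicator {-Q..Q} x * (4 * (1 + \<bar>x\<bar>))))" by (simp only: mult_ac)
    qed
  qed
  also have "\<dots> = \<eta> * A" by (simp add: A_def)
  also have "\<dots> \<le> (\<epsilon> / 4)\<^sup>2" by (rule \<eta>A)
  finally have n1: "L2_norm P (\<lambda>x. cutoff j x * (gn n x - u x)) \<le> \<epsilon> / 4"
    by (rule power2_le_imp_le) (use e in simp)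
  have P2: "(\<lambda>x. u x - cutoff j x * u x) \<in> L2 P"
    by (rule L2_diff[OF uP L2_bounded_mult[where C=1, OF uP mc[OF borel_measurable_P] cutoff_le_1]])
  have "L2_norm P (\<lambda>x. k x - u x) = L2_norm P (\<lambda>x. cutoff j x * (gn n x - u x) - (u x - cutoff j x * u x))"
    unfolding k_def right_diff_distrib by simp
  also have "\<dots> \<le> L2_norm P (\<lambda>x. cutoff j x * (gn n x - u x)) + L2_norm P (\<lambda>x. u x - cutoff j x * u x)"
    by (rule L2_norm_triangle_ineq4[OF P1 P2])
  also have "\<dots> < \<epsilon>" using n1 j(1) e by linarith
  finally have kP: "L2_norm P (\<lambda>x. k x - u x) < \<epsilon>" .
  have "L2_norm lebesgue (\<lambda>x. vderiv k x - vderiv (gn m) x) < \<epsilon> \<and> L2_norm ?N (\<lambda>x. k x - gn m x) < \<epsilon>" if m: "m \<ge> N0" for m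
  proof -
    let ?d = "\<lambda>x. gn n x - gn N0 x"
    let ?c = "\<lambda>x. cutoff j x * ?d x"
    let ?r = "\<lambda>x. gn m x - gn N0 x"
    have n0: "n \<ge> N0" by (simp add: n_def)
    have d: "?d \<in> line_test" and r: "?r \<in> line_test" by (intro test_functions_diff U(1))+
    have c: "?c \<in> line_test"
      by (intro test_functions_mult_smooth cutoff_test_function test_functions_smooth d)
    have eq: "(\<lambda>x. k x - gn m x) = (\<lambda>x. ?c x - ?r x)"
      by (rule ext) (simp add: k_def right_diff_distrib cutoff_id)
    have "L2_norm lebesgue (\<lambda>x. vderiv k x - vderiv (gn m) x) = L2_norm lebesgue (vderiv (\<lambda>x. k x - gn m x))"
      unfolding line.d_diff[OF kT U(1)] ..
    also have "\<dots> = L2_norm lebesgue (\<lambda>x. vderiv ?c x - vderiv ?r x)"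
      unfolding eq line.d_diff[OF c r] ..
    also have "\<dots> \<le> L2_norm lebesgue (vderiv ?c) + L2_norm lebesgue (vderiv ?r)"
      by (intro L2_norm_triangle_ineq4 line.d_L2 c r)
    also have "\<dots> \<le> C * \<delta> + \<delta>"
    proof (rule add_mono)
      have "L2_norm lebesgue (vderiv ?c) \<le> C * sqrt (energy ?d)" by (rule C(2)[OF d])
      also have "\<dots> \<le> C * \<delta>" using sE[OF n0 order_refl] C(1) by (intro mult_left_mono)
      finally show "L2_norm lebesgue (vderiv ?c) \<le> C * \<delta>" .
      show "L2_norm lebesgue (vderiv ?r) \<le> \<delta>"
        unfolding line.d_diff[OF U(1) U(1)] by (rule small(1)[OF m order_refl])
    qed
    finally have 1: "L2_norm lebesgue (\<lambda>x. vderiv k x - vderiv (gn m) x) < \<epsilon>" using \<delta>e by linarith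
    have "L2_norm ?N (\<lambda>x. k x - gn m x) \<le> L2_norm ?N ?c + L2_norm ?N ?r"
      unfolding eq by (intro L2_norm_triangle_ineq4 test_function_L2 c r)
    also have "L2_norm ?N ?c \<le> 1 * L2_norm ?N ?d"
      by (rule L2_norm_le_mult[OF test_function_L2(2)[OF d] test_function_L2(2)[OF c]])
         (use cutoff_le_1 in \<open>auto simp: norm_mult mult_left_le_one_le\<close>)
    finally have "L2_norm ?N (\<lambda>x. k x - gn m x) \<le> \<delta> + \<delta>"
      using small(2)[OF n0 order_refl] small(2)[OF m order_refl] by linarith
    then have 2: "L2_norm ?N (\<lambda>x. k x - gn m x) < \<epsilon>" using \<delta>e by linarith
    from 1 2 show ?thesis by blast
  qed
  then show ?thesis using kT kP by blast
qed

lemma q_approx_exists: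
  assumes ud: "u \<in> closure_dom (weighted_line 2) line_test laplace_form" and uP: "u \<in> L2 P"
  shows "\<exists>un. form_approx (weighted_line 2) line_test q un u"
proof -
  let ?N = "weighted_line 2"
  from ud obtain gn where u: "u \<in> L2 ?N" and a: "form_approx ?N line_test laplace_form gn u"
    by (auto simp: closure_dom_def)
  note U = line.form_approxD[OF a]
  define good where "good i k \<longleftrightarrow> k \<in> line_test \<and> L2_norm P (\<lambda>x. k x - u x) < 1 / real (Suc i) \<and>
    (\<exists>M. \<forall>m\<ge>M. L2_norm lebesgue (\<lambda>x. vderiv k x - vderiv (gn m) x) < 1 / real (Suc i) \<and>
       L2_norm ?N (\<lambda>x. k x - gn m x) < 1 / real (Suc i))" for i k
  have "\<exists>k. good i k" for i
    using cutoff_approximant[OF a u uP, of "1 / real (Suc i)"] unfolding good_def Bex_def by simp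
  then obtain k where good: "\<And>i. good i (k i)" by metis
  have k: "\<And>i. k i \<in> line_test" "\<And>i. L2_norm P (\<lambda>x. k i x - u x) < 1 / real (Suc i)"
    and kM: "\<And>i. \<exists>M. \<forall>m\<ge>M. L2_norm lebesgue (\<lambda>x. vderiv (k i) x - vderiv (gn m) x) < 1 / real (Suc i) \<and>
       L2_norm ?N (\<lambda>x. k i x - gn m x) < 1 / real (Suc i)"
    using good unfolding good_def by simp_all
  have lim0: "(\<lambda>n. 1 / real (Suc n)) \<longlonglongrightarrow> 0"
    using LIMSEQ_inverse_real_of_nat by (simp add: inverse_eq_divide)
  have limN: "(\<lambda>i. L2_norm ?N (\<lambda>x. k i x - u x)) \<longlonglongrightarrow> 0"
  proof (rule Lim_null_comparison[OF always_eventually lim0], rule allI)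
    fix i
    obtain M where M: "\<And>m. m \<ge> M \<Longrightarrow> L2_norm ?N (\<lambda>x. k i x - gn m x) < 1 / real (Suc i)" using kM[of i] by blast
    have "L2_norm ?N (\<lambda>x. k i x - u x) \<le> 1 / real (Suc i)"
    proof (rule LIMSEQ_le_const)
      show "(\<lambda>m. 1 / real (Suc i) + L2_norm ?N (\<lambda>x. gn m x - u x)) \<longlonglongrightarrow> 1 / real (Suc i)"
        using tendsto_add[OF tendsto_const U(2), of "1 / real (Suc i)"] by simp
      have "L2_norm ?N (\<lambda>x. k i x - u x) \<le> 1 / real (Suc i) + L2_norm ?N (\<lambda>x. gn m x - u x)" if "m \<ge> M" for m
        using L2_norm_triangle_diff[OF test_function_L2(2)[OF k(1)] test_function_L2(2)[OF U(1)] u, of i m] M[OF that] by linarith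
      then show "\<exists>N. \<forall>m\<ge>N. L2_norm ?N (\<lambda>x. k i x - u x) \<le> 1 / real (Suc i) + L2_norm ?N (\<lambda>x. gn m x - u x)" by blast
    qed
    then show "norm (L2_norm ?N (\<lambda>x. k i x - u x)) \<le> 1 / real (Suc i)" by simp
  qed
  have small: "\<exists>M. \<forall>i\<ge>M. 1 / real (Suc i) < e" if "0 < e" for e
    using order_tendstoD(2)[OF lim0 that] by (simp add: eventually_sequentially)
  have "form_approx ?N line_test laplace_form k u"
    unfolding line.form_approx_iff
  proof (intro conjI allI impI)
    fix e :: real assume "0 < e"
    then have "0 < e / 2" by simp
    from small[OF this] obtain M where M: "\<And>i. i \<ge> M \<Longrightarrow> 1 / real (Suc i) < e / 2" by blast
    have "L2_norm lebesgue (\<lambda>x. vderiv (k i) x - vderiv (k j) x) < e" if ij: "i \<ge> M" "j \<ge> M" for i j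
    proof -
      obtain M1 where M1: "\<And>m. m \<ge> M1 \<Longrightarrow> L2_norm lebesgue (\<lambda>x. vderiv (k i) x - vderiv (gn m) x) < 1 / real (Suc i)"
        using kM[of i] by blast
      obtain M2 where M2: "\<And>m. m \<ge> M2 \<Longrightarrow> L2_norm lebesgue (\<lambda>x. vderiv (k j) x - vderiv (gn m) x) < 1 / real (Suc j)"
        using kM[of j] by blast
      let ?m = "max M1 M2"
      have "L2_norm lebesgue (\<lambda>x. vderiv (k i) x - vderiv (k j) x) \<le>
          L2_norm lebesgue (\<lambda>x. vderiv (k i) x - vderiv (gn ?m) x) + L2_norm lebesgue (\<lambda>x. vderiv (gn ?m) x - vderiv (k j) x)"
        by (intro L2_norm_triangle_diff line.d_L2 k U(1))
      also have "L2_norm lebesgue (\<lambda>x. vderiv (gn ?m) x - vderiv (k j) x) = L2_norm lebesgue (\<lambda>x. vderiv (k j) x - vderiv (gn ?m) x)"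
        by (rule L2_norm_minus_commute)
      finally show ?thesis using M1[of ?m] M2[of ?m] M[OF ij(1)] M[OF ij(2)] by simp
    qed
    then show "\<exists>N. \<forall>m\<ge>N. \<forall>n\<ge>N. L2_norm lebesgue (\<lambda>y. vderiv (k m) y - vderiv (k n) y) < e" by blast
  qed (rule k limN)+
  moreover have "\<exists>M. \<forall>m\<ge>M. \<forall>n\<ge>M. L2_norm P (\<lambda>x. k m x - k n x) < e" if "0 < e" for e
  proof -
    have "0 < e / 2" using that by simp
    from small[OF this] obtain M where M: "\<And>i. i \<ge> M \<Longrightarrow> 1 / real (Suc i) < e / 2" by blast
    have "L2_norm P (\<lambda>x. k m x - k n x) < e" if mn: "m \<ge> M" "n \<ge> M" for m n
    proof -
      have "L2_norm P (\<lambda>x. k m x - k n x) \<le> L2_norm P (\<lambda>x. k m x - u x) + L2_norm P (\<lambda>x. u x - k n x)"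
        by (intro L2_norm_triangle_diff test_P_L2 k uP)
      then show ?thesis
        using k(2)[of m] k(2)[of n] M[OF mn(1)] M[OF mn(2)] L2_norm_minus_commute[of P u "k n"] by linarith
    qed
    then show ?thesis by blast
  qed
  ultimately show ?thesis using q_approxI by blast
qed

text \<open>By \<open>q_test_bounds\<close> a sequence is a Cauchy sequence for \<open>q\<close> if and only if it is one for the kinetic
  energy and for the absolute value of the potential. Approximation by cut-offs shows that no function
  of the form sum is missing, and closability of the kinetic energy identifies the forms.\<close>

theorem closure_eq_form_sum:
  shows "closure_dom (weighted_line 2) line_test q =
      minus_potential_dom (weighted_line 2) (closure_dom (weighted_line 2) line_test laplace_form) Y"
    and "u \<in> closure_dom (weighted_line 2) line_test q \<Longrightarrow> v \<in> closure_dom (weighted_line 2) line_test q \<Longrightarrow>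
      closure_form (weighted_line 2) line_test q u v =
      minus_potential_form (weighted_line 2) (closure_form (weighted_line 2) line_test laplace_form) Y u v"
proof -
  let ?N = "weighted_line 2"
  have L: "w \<in> borel_measurable lebesgue" if "w \<in> L2 ?N" for w
    using L2_measurable[OF that] by (simp add: borel_measurable_weighted_line)
  show "closure_dom ?N line_test q = minus_potential_dom ?N (closure_dom ?N line_test laplace_form) Y"
  proof (intro set_eqI iffI)
    fix u assume "u \<in> closure_dom ?N line_test q"
    then obtain un where u: "u \<in> L2 ?N" and a: "form_approx ?N line_test q un u" by (auto simp: closure_dom_def)
    note A = q_approx_imp[OF a u]
    have "u \<in> closure_dom ?N line_test laplace_form" using u A(1) unfolding closure_dom_def by blast
    moreover have "u \<in> L2 P" by (rule P_limit(1)[OF A(1) u A(2)])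
    ultimately show "u \<in> minus_potential_dom ?N (closure_dom ?N line_test laplace_form) Y"
      using P_L2_iff[OF L[OF u]] by (simp add: minus_potential_dom_def)
  next
    fix u assume "u \<in> minus_potential_dom ?N (closure_dom ?N line_test laplace_form) Y"
    then have ud: "u \<in> closure_dom ?N line_test laplace_form"
      and i: "integrable ?N (\<lambda>x. \<bar>Y x\<bar> * (cmod (u x))\<^sup>2)" by (auto simp: minus_potential_dom_def)
    then have u: "u \<in> L2 ?N" by (simp add: closure_dom_def)
    have "u \<in> L2 P" using P_L2_iff[OF L[OF u]] i by simp
    from q_approx_exists[OF ud this] show "u \<in> closure_dom ?N line_test q"
      using u unfolding closure_dom_def by blast
  qed
  assume "u \<in> closure_dom ?N line_test q" "v \<in> closure_dom ?N line_test q"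
  then obtain un vn where u: "u \<in> L2 ?N" "form_approx ?N line_test q un u"
    and v: "v \<in> L2 ?N" "form_approx ?N line_test q vn v" by (auto simp: closure_dom_def)
  show "closure_form ?N line_test q u v =
      minus_potential_form ?N (closure_form ?N line_test laplace_form) Y u v"
    unfolding closure_form_def[of _ _ q]
  proof (rule the_equality)
    show "\<forall>un vn. form_approx ?N line_test q un u \<longrightarrow> form_approx ?N line_test q vn v \<longrightarrow>
        (\<lambda>n. q (un n) (vn n)) \<longlonglongrightarrow> minus_potential_form ?N (closure_form ?N line_test laplace_form) Y u v"
      using q_limit[OF u(1) v(1)] by blast
    fix c assume "\<forall>un vn. form_approx ?N line_test q un u \<longrightarrow> form_approx ?N line_test q vn v \<longrightarrow>
        (\<lambda>n. q (un n) (vn n)) \<longlonglongrightarrow> c"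
    then have "(\<lambda>n. q (un n) (vn n)) \<longlonglongrightarrow> c" using u(2) v(2) by blast
    then show "c = minus_potential_form ?N (closure_form ?N line_test laplace_form) Y u v"
      using q_limit[OF u(1) v(1) u(2) v(2)] LIMSEQ_unique by blast
  qed
qed

end

section \<open>The forms on the half-line in logarithmic coordinates\<close>

lemma test_functions_diff_general:
  assumes "u \<in> test_functions S" "v \<in> test_functions S"
  shows "(\<lambda>x. u x - v x) \<in> test_functions S"
proof -
  obtain K where K: "compact K" "K \<subseteq> S" "\<forall>x\<in>S - K. u x = 0" using assms(1) by (auto simp: test_functions_def)
  obtain L where L: "compact L" "L \<subseteq> S" "\<forall>x\<in>S - L. v x = 0" using assms(2) by (auto simp: test_functions_def)
  have "smooth_on S (\<lambda>x. u x - v x)" using assms by (intro smooth_on_diff test_functions_smooth)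
  moreover have "compact (K \<union> L)" "K \<union> L \<subseteq> S" "\<forall>x\<in>S - (K \<union> L). u x - v x = 0"
    using K L by auto
  ultimately show ?thesis unfolding test_functions_def by blast
qed

lemma h_dom_diff: "u \<in> h_dom \<sigma> \<Longrightarrow> v \<in> h_dom \<sigma> \<Longrightarrow> (\<lambda>x. u x - v x) \<in> h_dom \<sigma>"
  by (auto simp: h_dom_def intro: test_functions_diff_general split: if_splits)

lemma h_dom_smooth:
  assumes "u \<in> h_dom \<sigma>"
  shows "smooth_on {0<..} u"
proof (cases "\<sigma> \<le> 1")
  case True then show ?thesis using assms by (auto simp: h_dom_def intro: test_functions_smooth)
next
  case False
  then have "smooth_on {0..} u" using assms by (auto simp: h_dom_def intro: test_functions_smooth)
  then show ?thesis by (rule smooth_on_subset) auto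
qed

lemma smooth_vderiv_halfline:
  assumes "smooth_on {0<..} u"
  shows "0 < r \<Longrightarrow> (u has_vector_derivative vderiv u r) (at r)" "continuous_on {0<..} (vderiv u)"
proof -
  obtain u' where u': "smooth_on {0<..} u'" "\<And>r. r \<in> {0<..} \<Longrightarrow> (u has_vector_derivative u' r) (at r within {0<..})"
    using smooth_on_derivative[OF assms] by blast
  have at: "(u has_vector_derivative u' r) (at r)" if "0 < r" for r
    using u'(2)[of r] that by (simp add: at_within_open[of r "{0<..}"])
  then have eq: "vderiv u r = u' r" if "0 < r" for r using vector_derivative_at that by blast
  show "0 < r \<Longrightarrow> (u has_vector_derivative vderiv u r) (at r)" using at eq by simp
  show "continuous_on {0<..} (vderiv u)"
    using smooth_on_continuous[OF u'(1)] by (rule continuous_on_eq) (simp add: eq)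
qed

lemma continuous_halfline_measurable:
  fixes f :: "real \<Rightarrow> complex"
  assumes "continuous_on {0<..} f"
  shows "f \<in> borel_measurable halfline"
  by (rule continuous_imp_measurable_on_sets_lebesgue[OF assms]) simp

lemma h_dom_measurable: "u \<in> h_dom \<sigma> \<Longrightarrow> u \<in> borel_measurable halfline"
  by (intro continuous_halfline_measurable smooth_on_continuous h_dom_smooth)

lemma exp_decay_L2:
  assumes c: "continuous_on UNIV g" and d: "0 < c" and b: "\<And>y. cmod (g y) \<le> C * exp (- c * \<bar>y\<bar>)"
  shows "g \<in> L2 lebesgue"
proof -
  have gm: "g \<in> borel_measurable lebesgue" by (rule continuous_lebesgue_measurable[OF c])
  have "integrable lebesgue (\<lambda>y. (cmod (g y))\<^sup>2)"
  proof (rule Bochner_Integration.integrable_bound)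
    show "integrable lebesgue (\<lambda>y. C\<^sup>2 * exp (- (2 * c) * \<bar>y\<bar>))"
      using d by (intro integrable_mult_right integrable_exp_abs) simp
    show "(\<lambda>y. (cmod (g y))\<^sup>2) \<in> borel_measurable lebesgue" using gm by measurable
    have "(cmod (g y))\<^sup>2 \<le> C\<^sup>2 * exp (- (2 * c) * \<bar>y\<bar>)" for y
    proof -
      have "(cmod (g y))\<^sup>2 \<le> (C * exp (- c * \<bar>y\<bar>))\<^sup>2" by (intro power_mono b) auto
      also have "\<dots> = C\<^sup>2 * exp (- (2 * c) * \<bar>y\<bar>)" by (simp add: power_mult_distrib flip: exp_double)
      finally show ?thesis .
    qed
    then show "AE y in lebesgue. norm ((cmod (g y))\<^sup>2) \<le> norm (C\<^sup>2 * exp (- (2 * c) * \<bar>y\<bar>))" by simp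
  qed
  then show ?thesis using gm by (simp add: L2_def)
qed

context log_unitary
begin

lemma G_smooth:
  assumes "smooth_on {0<..} u"
  shows "smooth_on UNIV (G u)"
proof -
  have e: "smooth_on UNIV (\<lambda>y. complex_of_real (exp (\<kappa> * (m * y + d)) / sqrt \<bar>m\<bar>))"
    using smooth_on_mult[OF smooth_on_exp[of UNIV "\<kappa> * m" "\<kappa> * d"] smooth_on_const[of UNIV "complex_of_real (1 / sqrt \<bar>m\<bar>)"]]
    by (simp add: algebra_simps)
  have "smooth_on UNIV (\<lambda>y. complex_of_real (m * \<phi> y))"
    using smooth_on_mult[OF smooth_on_const[of UNIV "complex_of_real m"] smooth_on_exp[of UNIV m d]]
    by (simp add: \<phi>_def)
  moreover have "(\<phi> has_vector_derivative m * \<phi> y) (at y)" for y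
    using phi_deriv by (simp add: has_real_derivative_iff_has_vector_derivative)
  ultimately have "smooth_on UNIV (\<lambda>y. u (\<phi> y))"
    by (intro smooth_on_compose[OF assms, where T'="\<lambda>y. m * \<phi> y"]) auto
  from smooth_on_mult[OF e this] show ?thesis by (simp add: G_def[abs_def])
qed

lemma G_vderiv:
  assumes "smooth_on {0<..} u"
  shows "vderiv (G u) y = complex_of_real m * (complex_of_real \<kappa> * G u y +
    complex_of_real (exp ((\<kappa> + 1) * (m * y + d)) / sqrt \<bar>m\<bar>) * vderiv u (\<phi> y))"
proof -
  note ud = smooth_vderiv_halfline(1)[OF assms]
  have e: "((\<lambda>y. complex_of_real (exp (\<kappa> * (m * y + d)) / sqrt \<bar>m\<bar>)) has_vector_derivative
      complex_of_real (\<kappa> * m * (exp (\<kappa> * (m * y + d)) / sqrt \<bar>m\<bar>))) (at y)"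
  proof (rule has_vector_derivative_of_real)
    have "((\<lambda>y. exp (\<kappa> * (m * y + d))) has_real_derivative \<kappa> * m * exp (\<kappa> * (m * y + d))) (at y)"
      by (auto intro!: derivative_eq_intros)
    from DERIV_cdivide[OF this, of "sqrt \<bar>m\<bar>"]
    show "((\<lambda>y. exp (\<kappa> * (m * y + d)) / sqrt \<bar>m\<bar>) has_real_derivative
        \<kappa> * m * (exp (\<kappa> * (m * y + d)) / sqrt \<bar>m\<bar>)) (at y)" by simp
  qed
  have "(\<phi> has_vector_derivative m * \<phi> y) (at y)"
    using phi_deriv by (simp add: has_real_derivative_iff_has_vector_derivative)
  from vector_diff_chain_at[OF this ud[OF phi_pos]]
  have "((\<lambda>y. u (\<phi> y)) has_vector_derivative complex_of_real (m * \<phi> y) * vderiv u (\<phi> y)) (at y)"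
    by (simp add: o_def scaleR_conv_of_real)
  from has_vector_derivative_mult[OF e this]
  have "(G u has_vector_derivative
      complex_of_real (exp (\<kappa> * (m * y + d)) / sqrt \<bar>m\<bar>) * (complex_of_real (m * \<phi> y) * vderiv u (\<phi> y)) +
      complex_of_real (\<kappa> * m * (exp (\<kappa> * (m * y + d)) / sqrt \<bar>m\<bar>)) * u (\<phi> y)) (at y)"
    unfolding G_def[abs_def] .
  from vector_derivative_at[OF this]
  have "vderiv (G u) y = complex_of_real (exp (\<kappa> * (m * y + d)) / sqrt \<bar>m\<bar>) * (complex_of_real (m * \<phi> y) * vderiv u (\<phi> y)) +
      complex_of_real (\<kappa> * m * (exp (\<kappa> * (m * y + d)) / sqrt \<bar>m\<bar>)) * u (\<phi> y)" .
  also have "\<dots> = complex_of_real m * (complex_of_real \<kappa> * G u y +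
      complex_of_real (exp (\<kappa> * (m * y + d)) * \<phi> y / sqrt \<bar>m\<bar>) * vderiv u (\<phi> y))"
    by (simp add: G_def distrib_left mult_ac)
  also have "exp (\<kappa> * (m * y + d)) * \<phi> y = exp ((\<kappa> + 1) * (m * y + d))"
    by (simp add: \<phi>_def distrib_right flip: exp_add)
  finally show ?thesis .
qed

lemma G_test_functions:
  assumes u: "u \<in> test_functions {0<..}"
  shows "G u \<in> line_test"
proof -
  obtain K where K: "compact K" "K \<subseteq> {0<..}" "\<And>x. 0 < x \<Longrightarrow> x \<notin> K \<Longrightarrow> u x = 0"
    using u by (auto simp: test_functions_def)
  have "compact (\<psi> ` K)"
  proof (rule compact_continuous_image[OF _ K(1)])
    show "continuous_on K \<psi>"
      unfolding \<psi>_def using K(2) m_nz by (intro continuous_intros) auto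
  qed
  from compact_imp_bounded[OF this] obtain B where B: "\<forall>y\<in>\<psi> ` K. norm y \<le> B" unfolding bounded_iff by blast
  show ?thesis
  proof (rule test_functions_UNIV_I[where R=B])
    show "smooth_on UNIV (G u)" by (rule G_smooth[OF test_functions_smooth[OF u]])
    fix y assume y: "B < \<bar>y\<bar>"
    have "\<phi> y \<notin> K"
    proof
      assume "\<phi> y \<in> K"
      then have "\<psi> (\<phi> y) \<in> \<psi> ` K" by (rule imageI)
      then show False using B y by auto
    qed
    then show "G u y = 0" using K(3)[OF phi_pos] by (simp add: G_def)
  qed
qed

lemma H_test_functions:
  assumes g: "g \<in> line_test"
  shows "H g \<in> test_functions {0<..}" "H g \<in> test_functions {0..}"
proof -
  obtain R where R: "0 < R \<and> (\<forall>x. R \<le> \<bar>x\<bar> \<longrightarrow> g x = 0)" using test_functions_UNIV_support[OF g] ..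
  define L where "L = \<bar>m\<bar> * R + \<bar>d\<bar>"
  have zero: "H g r = 0" if "r \<notin> {exp (- L)..exp L}" for r
  proof (cases "0 < r")
    case True
    have "L < \<bar>ln r\<bar>"
      using that True ln_less_cancel_iff[of r "exp (- L)"] ln_less_cancel_iff[of "exp L" r] by auto
    then have "\<bar>m\<bar> * R < \<bar>ln r - d\<bar>" by (simp add: L_def)
    then have "R \<le> \<bar>\<psi> r\<bar>" using m_nz by (simp add: \<psi>_def abs_divide pos_le_divide_eq mult.commute less_imp_le)
    then have "g (\<psi> r) = 0" using R by blast
    then show ?thesis by (simp add: H_def)
  qed (simp add: H_def)
  have s: "smooth_on {0<..} (H g)"
  proof -
    have p: "smooth_on {0<..} (\<lambda>r. complex_of_real (sqrt \<bar>m\<bar> * r powr (- \<kappa>)))"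
      using smooth_on_mult[OF smooth_on_const[of "{0<..}" "complex_of_real (sqrt \<bar>m\<bar>)"] smooth_on_powr[of "- \<kappa>"]] by simp
    have "smooth_on {0<..} (\<lambda>r. complex_of_real (1 / m * r powr (-1)))"
      using smooth_on_mult[OF smooth_on_const[of "{0<..}" "complex_of_real (1 / m)"] smooth_on_powr[of "- 1"]] by simp
    then have d: "smooth_on {0<..} (\<lambda>r. complex_of_real (1 / (m * r)))"
      by (rule smooth_on_cong) (use m_nz in \<open>simp add: powr_minus divide_inverse\<close>)
    have "(\<psi> has_vector_derivative 1 / (m * r)) (at r within {0<..})" if "r \<in> {0<..}" for r
      using psi_deriv that by (simp add: has_real_derivative_iff_has_vector_derivative)
    then have "smooth_on {0<..} (\<lambda>r. g (\<psi> r))"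
      by (intro smooth_on_compose[OF test_functions_smooth[OF g] _ _ d]) auto
    from smooth_on_mult[OF p this] show ?thesis
      by (rule smooth_on_cong) (simp add: H_def)
  qed
  have K: "compact {exp (- L)..exp L}" "{exp (- L)..exp L} \<subseteq> {0<..}" "{exp (- L)..exp L} \<subseteq> {0..}"
    using less_le_trans[OF exp_gt_zero[of "- L"]] by (auto intro: less_imp_le)
  show "H g \<in> test_functions {0<..}"
    unfolding test_functions_def using s K zero by blast
  have "smooth_on {0..} (H g)"
    by (rule smooth_on_extend_zero[OF s exp_gt_zero[of "- L"]]) (rule zero, simp)
  then show "H g \<in> test_functions {0..}"
    unfolding test_functions_def using K zero by blast
qed

lemma test_functions_subset_G: "line_test \<subseteq> G ` h_dom \<sigma>"
proof
  fix g assume "g \<in> line_test"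
  from H_test_functions[OF this] have "H g \<in> h_dom \<sigma>" by (simp add: h_dom_def)
  then show "g \<in> G ` h_dom \<sigma>" by (rule rev_image_eqI) (simp add: G_H)
qed

text \<open>Near \<open>r = 0\<close> the function \<open>u\<close> and its derivative are bounded, so \<open>G u\<close> and its derivative are
  \<open>O(exp (\<kappa> * x))\<close> at \<open>x = - \<infinity>\<close>, and \<open>\<sigma> > 1\<close> means \<open>\<kappa> > 0\<close>. They vanish for large \<open>x\<close>.\<close>

lemma G_line_core_of_smooth_at_0:
  assumes u: "u \<in> test_functions {0..}" and \<sigma>: "1 < \<sigma>"
  shows "G u \<in> L2 lebesgue" "vderiv (G u) \<in> L2 lebesgue" "u \<in> L2 halfline"
proof -
  have \<kappa>: "0 < \<kappa>" using \<sigma> by (simp add: \<kappa>_def)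
  have s0: "smooth_on {0..} u" by (rule test_functions_smooth[OF u])
  have s: "smooth_on {0<..} u" by (rule smooth_on_subset[OF s0]) auto
  obtain K where K: "compact K" "K \<subseteq> {0..}" "\<And>x. 0 \<le> x \<Longrightarrow> x \<notin> K \<Longrightarrow> u x = 0"
    using u by (auto simp: test_functions_def)
  from compact_imp_bounded[OF K(1)] obtain B0 where B0: "\<forall>r\<in>K. norm r \<le> B0" unfolding bounded_iff by blast
  define B where "B = max B0 1"
  have B: "1 \<le> B" by (simp add: B_def)
  have u0: "u r = 0" if "B < r" for r
    using K(3)[of r] that B B0 by (force simp: B_def)
  have u'0: "vderiv u r = 0" if "B < r" for r
  proof -
    have "((\<lambda>_. 0) has_vector_derivative (0::complex)) (at r)" by simp
    then have "(u has_vector_derivative 0) (at r)"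
      by (rule has_vector_derivative_transform_within_open[where S="{B<..}"]) (use that u0 in auto)
    then show ?thesis by (rule vector_derivative_at)
  qed
  obtain u' where u': "smooth_on {0..} u'" "\<And>r. r \<in> {0..} \<Longrightarrow> (u has_vector_derivative u' r) (at r within {0..})"
    using smooth_on_derivative[OF s0] by blast
  have u'eq: "vderiv u r = u' r" if "0 < r" for r
  proof -
    have "r \<in> interior {0..}" using that by (simp add: interior_real_atLeast)
    then have "(u has_vector_derivative u' r) (at r)"
      using u'(2)[of r] that at_within_interior[of r "{0..}"] by simp
    then show ?thesis by (rule vector_derivative_at)
  qed
  have bd: "\<exists>C. \<forall>r\<in>{0..B}. cmod (f r) \<le> C" if "smooth_on {0..} f" for f
  proof -
    have "compact (f ` {0..B})"
      by (intro compact_continuous_image continuous_on_subset[OF smooth_on_continuous[OF that]]) auto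
    from compact_imp_bounded[OF this] show ?thesis unfolding bounded_iff by blast
  qed
  obtain C1 where C1: "\<forall>r\<in>{0..B}. cmod (u r) \<le> C1" using bd[OF s0] by blast
  obtain C2 where C2: "\<forall>r\<in>{0..B}. cmod (u' r) \<le> C2" using bd[OF u'(1)] by blast
  define C where "C = max (max C1 C2) 0"
  have C0: "0 \<le> C" by (simp add: C_def)
  have bu: "cmod (u r) \<le> C" "cmod (vderiv u r) \<le> C" if "0 < r" "r \<le> B" for r
    using C1 C2 that u'eq[OF that(1)] by (auto simp: C_def le_max_iff_disj)
  define l where "l = ln B"
  have l: "0 \<le> l" using B by (simp add: l_def)
  have phiB: "\<phi> y \<le> B \<longleftrightarrow> m * y + d \<le> l" for y
  proof -
    have "\<phi> y \<le> B \<longleftrightarrow> exp (m * y + d) \<le> exp l" using B by (simp add: \<phi>_def l_def)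
    then show ?thesis by simp
  qed
  define s' where "s' = 1 / sqrt \<bar>m\<bar>"
  have s'0: "0 \<le> s'" by (simp add: s'_def)
  have decay: "exp (\<kappa> * (m * y + d)) \<le> exp (2 * \<kappa> * l + \<kappa> * \<bar>d\<bar>) * exp (- (\<kappa> * \<bar>m\<bar>) * \<bar>y\<bar>)" if x: "m * y + d \<le> l" for y
  proof -
    have "\<bar>m\<bar> * \<bar>y\<bar> \<le> \<bar>m * y + d\<bar> + \<bar>d\<bar>" using abs_triangle_ineq4[of "m * y + d" d] by (simp add: abs_mult)
    moreover have "m * y + d + \<bar>m * y + d\<bar> \<le> 2 * l" using x l by linarith
    ultimately have "m * y + d \<le> 2 * l + \<bar>d\<bar> - \<bar>m\<bar> * \<bar>y\<bar>" by linarith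
    then have "\<kappa> * (m * y + d) \<le> \<kappa> * (2 * l + \<bar>d\<bar> - \<bar>m\<bar> * \<bar>y\<bar>)" using \<kappa> by (intro mult_left_mono) auto
    then show ?thesis by (simp add: algebra_simps flip: exp_add)
  qed
  define D where "D = exp (2 * \<kappa> * l + \<kappa> * \<bar>d\<bar>)"
  have D0: "0 \<le> D" by (simp add: D_def)
  have km: "0 < \<kappa> * \<bar>m\<bar>" using \<kappa> m_nz by simp
  note decay = decay[folded D_def]
  have bG: "cmod (G u y) \<le> (s' * C * D) * exp (- (\<kappa> * \<bar>m\<bar>) * \<bar>y\<bar>)" for y
  proof (cases "m * y + d \<le> l")
    case True
    have "cmod (G u y) = s' * (exp (\<kappa> * (m * y + d)) * cmod (u (\<phi> y)))"
      by (simp add: G_def norm_mult norm_divide s'_def)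
    also have "\<dots> \<le> s' * ((D * exp (- (\<kappa> * \<bar>m\<bar>) * \<bar>y\<bar>)) * C)"
      using True D0 s'0 by (intro mult_left_mono mult_mono decay bu) (auto simp: phiB)
    finally show ?thesis by (simp add: mult_ac)
  next
    case False
    then have "G u y = 0" using u0[of "\<phi> y"] phiB[of y] by (simp add: G_def)
    then show ?thesis using s'0 C0 D0 by simp
  qed
  define E where "E = \<bar>m\<bar> * (\<kappa> * (s' * C * D) + exp l * (s' * C * D))"
  have bG': "cmod (vderiv (G u) y) \<le> E * exp (- (\<kappa> * \<bar>m\<bar>) * \<bar>y\<bar>)" for y
  proof -
    let ?e = "exp (- (\<kappa> * \<bar>m\<bar>) * \<bar>y\<bar>)"
    let ?w = "complex_of_real (exp ((\<kappa> + 1) * (m * y + d)) / sqrt \<bar>m\<bar>) * vderiv u (\<phi> y)"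
    have "cmod ?w \<le> exp l * (s' * C * D) * ?e"
    proof (cases "m * y + d \<le> l")
      case True
      have "cmod ?w = s' * ((exp (m * y + d) * exp (\<kappa> * (m * y + d))) * cmod (vderiv u (\<phi> y)))"
        by (simp add: norm_mult norm_divide s'_def distrib_right mult_ac flip: exp_add)
      also have "\<dots> \<le> s' * ((exp l * (D * ?e)) * C)"
        using True D0 s'0 by (intro mult_left_mono mult_mono decay bu) (auto simp: phiB)
      finally show ?thesis by (simp add: mult_ac)
    next
      case False
      then have "vderiv u (\<phi> y) = 0" using u'0[of "\<phi> y"] phiB[of y] by linarith
      then have "cmod ?w = 0" by simp
      then show ?thesis using s'0 C0 D0 by (simp only:) simp
    qed
    moreover have "cmod (complex_of_real \<kappa> * G u y) \<le> \<kappa> * ((s' * C * D) * ?e)"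
      unfolding norm_mult using \<kappa> bG[of y] by simp
    ultimately have "cmod (complex_of_real \<kappa> * G u y + ?w) \<le> \<kappa> * ((s' * C * D) * ?e) + exp l * (s' * C * D) * ?e"
      using norm_triangle_ineq[of "complex_of_real \<kappa> * G u y" ?w] by linarith
    then have "\<bar>m\<bar> * cmod (complex_of_real \<kappa> * G u y + ?w) \<le> \<bar>m\<bar> * (\<kappa> * ((s' * C * D) * ?e) + exp l * (s' * C * D) * ?e)"
      by (rule mult_left_mono) simp
    also have "\<dots> = E * ?e" by (simp add: E_def algebra_simps)
    finally show ?thesis unfolding G_vderiv[OF s] norm_mult by simp
  qed
  note sG = G_smooth[OF s]
  show "G u \<in> L2 lebesgue" by (rule exp_decay_L2[OF smooth_on_continuous[OF sG] km bG])
  show "vderiv (G u) \<in> L2 lebesgue" by (rule exp_decay_L2[OF smooth_on_continuous[OF smooth_vderiv(2)[OF sG]] km bG'])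
  have um: "u \<in> borel_measurable halfline" by (intro continuous_halfline_measurable smooth_on_continuous s)
  have "integrable halfline (\<lambda>r. (cmod (u r))\<^sup>2)"
  proof (rule Bochner_Integration.integrable_bound)
    show "integrable halfline (\<lambda>r. C\<^sup>2 * indicator {0<..B} r)"
    proof (intro integrable_mult_right integrable_real_indicator)
      have "{0<..B} \<in> sets lebesgue" by simp
      then show "{0<..B} \<in> sets halfline" by (auto simp: sets_halfline)
      then show "emeasure halfline {0<..B} < \<infinity>" using B by (subst emeasure_restrict_space) (auto simp: emeasure_lborel_Ioc)
    qed
    show "(\<lambda>r. (cmod (u r))\<^sup>2) \<in> borel_measurable halfline" using um by measurable
    show "AE r in halfline. norm ((cmod (u r))\<^sup>2) \<le> norm (C\<^sup>2 * indicator {0<..B} r)"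
    proof (rule AE_I2)
      fix r assume "r \<in> space halfline"
      then have r: "0 < r" by simp
      show "norm ((cmod (u r))\<^sup>2) \<le> norm (C\<^sup>2 * indicator {0<..B} r)"
      proof (cases "r \<le> B")
        case True
        then show ?thesis using bu(1)[OF r True] r by (simp add: power_mono)
      next
        case False
        then show ?thesis using u0[of r] by simp
      qed
    qed
  qed
  then show "u \<in> L2 halfline" using um by (simp add: L2_def)
qed

lemma G_h_dom_subset: "G ` h_dom \<sigma> \<subseteq> line_core \<tau>"
proof
  fix g assume "g \<in> G ` h_dom \<sigma>"
  then obtain u where u: "u \<in> h_dom \<sigma>" and g: "g = G u" by blast
  show "g \<in> line_core \<tau>"
  proof (cases "\<sigma> \<le> 1")
    case True
    then have "u \<in> test_functions {0<..}" using u by (simp add: h_dom_def)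
    then show ?thesis using G_test_functions test_functions_line_core g by blast
  next
    case False
    then have "u \<in> test_functions {0..}" "1 < \<sigma>" using u by (simp_all add: h_dom_def)
    note * = G_line_core_of_smooth_at_0[OF this]
    show ?thesis
      unfolding line_core_def g using * G_L2[OF *(3)] G_smooth[OF h_dom_smooth[OF u]] by simp
  qed
qed

lemma h_dom_L2: "h_dom \<sigma> \<subseteq> L2 halfline"
proof
  fix u assume u: "u \<in> h_dom \<sigma>"
  then have "G u \<in> line_core \<tau>" using G_h_dom_subset by blast
  then have "G u \<in> L2 (weighted_line \<tau>)" by (simp add: line_core_def)
  then show "u \<in> L2 halfline" using G_L2_iff[OF h_dom_measurable[OF u]] by simp
qed

definition h_integrand :: "(real \<Rightarrow> complex) \<Rightarrow> (real \<Rightarrow> complex) \<Rightarrow> real \<Rightarrow> complex" where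
  "h_integrand u v r = complex_of_real (r powr \<sigma>) * (vderiv u r * cnj (vderiv v r))
     - complex_of_real ((\<sigma> - 1)\<^sup>2 / (4 * r powr (2 - \<sigma>))) * (u r * cnj (v r))"

text \<open>Differentiation of \<open>G u\<close> expresses \<open>u'\<close> by \<open>(G u)' - m * \<kappa> * G u\<close>. In the product the square of the
  second term is the Hardy term, and the mixed terms are the derivative of \<open>G u * cnj (G v)\<close>.\<close>

lemma h_integrand_transform:
  assumes u: "smooth_on {0<..} u" and v: "smooth_on {0<..} v"
  shows "(\<bar>m\<bar> * \<phi> y) *\<^sub>R h_integrand u v (\<phi> y) =
    vderiv (G u) y * cnj (vderiv (G v) y)
    - complex_of_real (m * \<kappa>) * (G u y * cnj (vderiv (G v) y) + vderiv (G u) y * cnj (G v y))"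
proof -
  define x where "x = m * y + d"
  define c where "c = 1 / sqrt \<bar>m\<bar>"
  \<comment> \<open>The part of \<open>(G u)'\<close> that contains \<open>u'\<close>.\<close>
  define A where "A = complex_of_real (c * exp ((\<kappa> + 1) * x)) * vderiv u (\<phi> y)"
  define B where "B = complex_of_real (c * exp ((\<kappa> + 1) * x)) * vderiv v (\<phi> y)"
  have c2: "\<bar>m\<bar> * c\<^sup>2 = 1" using m_nz by (simp add: c_def power_divide)
  have g: "G w y = complex_of_real (c * exp (\<kappa> * x)) * w (\<phi> y)" for w by (simp add: G_def c_def x_def)
  have g': "vderiv (G u) y = complex_of_real m * (complex_of_real \<kappa> * G u y + A)"
    "vderiv (G v) y = complex_of_real m * (complex_of_real \<kappa> * G v y + B)"
    unfolding G_vderiv[OF u] G_vderiv[OF v] by (simp_all add: A_def B_def c_def x_def)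
  have s1: "\<bar>m\<bar> * \<phi> y * \<phi> y powr \<sigma> = m\<^sup>2 * (c * exp ((\<kappa> + 1) * x))\<^sup>2"
  proof -
    have "\<phi> y * \<phi> y powr \<sigma> = exp ((\<sigma> + 1) * x)"
      by (simp add: \<phi>_def x_def powr_def distrib_right flip: exp_add)
    also have "(\<sigma> + 1) * x = 2 * ((\<kappa> + 1) * x)" by (simp add: \<kappa>_def field_simps)
    finally have "\<phi> y * \<phi> y powr \<sigma> = (exp ((\<kappa> + 1) * x))\<^sup>2" by (simp only: exp_double)
    moreover have "\<bar>m\<bar> = m\<^sup>2 * c\<^sup>2"
      using c2 by (metis abs_mult_self_eq mult.assoc mult.right_neutral power2_eq_square)
    ultimately show ?thesis by (simp add: power_mult_distrib mult.assoc)
  qed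
  have s2: "\<bar>m\<bar> * \<phi> y * ((\<sigma> - 1)\<^sup>2 / (4 * \<phi> y powr (2 - \<sigma>))) = m\<^sup>2 * \<kappa>\<^sup>2 * (c * exp (\<kappa> * x))\<^sup>2"
  proof -
    have "\<phi> y / \<phi> y powr (2 - \<sigma>) = exp ((\<sigma> - 1) * x)"
      by (simp add: \<phi>_def x_def powr_def algebra_simps flip: exp_diff)
    also have "(\<sigma> - 1) * x = 2 * (\<kappa> * x)" by (simp add: \<kappa>_def)
    finally have e: "\<phi> y / \<phi> y powr (2 - \<sigma>) = (exp (\<kappa> * x))\<^sup>2" by (simp only: exp_double)
    have m: "\<bar>m\<bar> = m\<^sup>2 * c\<^sup>2"
      using c2 by (metis abs_mult_self_eq mult.assoc mult.right_neutral power2_eq_square)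
    have "\<bar>m\<bar> * \<phi> y * ((\<sigma> - 1)\<^sup>2 / (4 * \<phi> y powr (2 - \<sigma>))) = \<bar>m\<bar> * \<kappa>\<^sup>2 * (\<phi> y / \<phi> y powr (2 - \<sigma>))"
      by (simp add: \<kappa>_def power_divide)
    then show ?thesis unfolding e by (simp add: m power_mult_distrib mult_ac)
  qed
  have "(\<bar>m\<bar> * \<phi> y) *\<^sub>R h_integrand u v (\<phi> y) =
      complex_of_real (\<bar>m\<bar> * \<phi> y * \<phi> y powr \<sigma>) * (vderiv u (\<phi> y) * cnj (vderiv v (\<phi> y)))
      - complex_of_real (\<bar>m\<bar> * \<phi> y * ((\<sigma> - 1)\<^sup>2 / (4 * \<phi> y powr (2 - \<sigma>)))) * (u (\<phi> y) * cnj (v (\<phi> y)))"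
    unfolding h_integrand_def scaleR_conv_of_real right_diff_distrib of_real_mult by (simp only: mult.assoc)
  also have "\<dots> = complex_of_real m ^ 2 * (A * cnj B) - complex_of_real m ^ 2 * complex_of_real \<kappa> ^ 2 * (G u y * cnj (G v y))"
    unfolding s1 s2 g A_def B_def by (simp add: power2_eq_square mult_ac)
  also have "\<dots> = vderiv (G u) y * cnj (vderiv (G v) y)
    - complex_of_real (m * \<kappa>) * (G u y * cnj (vderiv (G v) y) + vderiv (G u) y * cnj (G v y))"
    unfolding g' by (simp add: power2_eq_square algebra_simps)
  finally show ?thesis .
qed

lemma h_integrand_measurable:
  assumes u: "smooth_on {0<..} u" and v: "smooth_on {0<..} v"
  shows "h_integrand u v \<in> borel_measurable halfline"
proof -
  note c = smooth_vderiv_halfline(2)[OF u] smooth_vderiv_halfline(2)[OF v] smooth_on_continuous[OF u] smooth_on_continuous[OF v]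
  show ?thesis
    unfolding h_integrand_def[abs_def]
    by (intro continuous_halfline_measurable continuous_intros c) auto
qed

lemma h_form_eq_laplace:
  assumes u: "u \<in> h_dom \<sigma>" and v: "v \<in> h_dom \<sigma>"
  shows "integrable halfline (h_integrand u v)" "h_form \<sigma> u v = laplace_form (G u) (G v)"
proof -
  note su = h_dom_smooth[OF u] and sv = h_dom_smooth[OF v]
  have "G u \<in> line_core \<tau>" "G v \<in> line_core \<tau>" using G_h_dom_subset u v by blast+
  then have g: "G u \<in> L2 lebesgue" "vderiv (G u) \<in> L2 lebesgue" "smooth_on UNIV (G u)"
    and h: "G v \<in> L2 lebesgue" "vderiv (G v) \<in> L2 lebesgue" "smooth_on UNIV (G v)"
    by (auto simp: line_core_def)
  let ?F = "\<lambda>y. G u y * cnj (G v y)"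
  let ?F' = "\<lambda>y. G u y * cnj (vderiv (G v) y) + vderiv (G u) y * cnj (G v y)"
  have i1: "integrable lebesgue (\<lambda>y. vderiv (G u) y * cnj (vderiv (G v) y))" by (rule L2_integrable_inner[OF g(2) h(2)])
  have i2: "integrable lebesgue ?F'"
    by (intro Bochner_Integration.integrable_add L2_integrable_inner g h)
  have z: "(\<integral>y. ?F' y \<partial>lebesgue) = 0"
  proof (rule integral_derivative_eq_0[OF _ _ _ i2])
    show "(?F has_vector_derivative ?F' y) (at y)" for y
      by (intro has_vector_derivative_mult has_vector_derivative_cnj smooth_vderiv(1) g h)
    show "continuous_on UNIV ?F'"
      by (intro continuous_intros smooth_on_continuous smooth_vderiv(2) g h)
    show "integrable lebesgue ?F" by (rule L2_integrable_inner[OF g(1) h(1)])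
  qed
  note m = h_integrand_measurable[OF su sv]
  note t = h_integrand_transform[OF su sv]
  show "integrable halfline (h_integrand u v)"
    unfolding integrable_halfline[OF m] t
    by (intro Bochner_Integration.integrable_diff integrable_mult_right i1 i2)
  have "h_form \<sigma> u v = (\<integral>r. h_integrand u v r \<partial>halfline)"
    by (simp add: h_form_def h_integrand_def)
  also have "\<dots> = (\<integral>y. vderiv (G u) y * cnj (vderiv (G v) y) - complex_of_real (m * \<kappa>) * ?F' y \<partial>lebesgue)"
    unfolding integral_halfline[OF m] t ..
  also have "\<dots> = (\<integral>y. vderiv (G u) y * cnj (vderiv (G v) y) \<partial>lebesgue) - complex_of_real (m * \<kappa>) * (\<integral>y. ?F' y \<partial>lebesgue)"
    by (subst Bochner_Integration.integral_diff[OF i1 integrable_mult_right[OF i2]]) (simp only: integral_mult_right_zero)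
  also have "\<dots> = laplace_form (G u) (G v)" by (simp add: z laplace_form_def)
  finally show "h_form \<sigma> u v = laplace_form (G u) (G v)" .
qed

end

section \<open>Reduction to operators on the weighted line\<close>

definition line_model :: "real \<Rightarrow> (real \<Rightarrow> real) \<Rightarrow> real operator" where
  "line_model \<tau> Y =
     form_operator (weighted_line \<tau>)
       (minus_potential_dom (weighted_line \<tau>) (closure_dom (weighted_line \<tau>) line_test laplace_form) Y)
       (minus_potential_form (weighted_line \<tau>) (closure_form (weighted_line \<tau>) line_test laplace_form) Y)"

lemma form_operator_cong:
  assumes "D = D'" "\<And>u v. u \<in> D' \<Longrightarrow> v \<in> D' \<Longrightarrow> q u v = q' u v"
  shows "form_operator M D q = form_operator M D' q'"
  using assms unfolding form_operator_def by auto

context log_unitary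
begin

text \<open>The image of the domain lies between the test functions on the line and \<open>line_core\<close>, and all of these have
  the same closure.\<close>

lemma h_closure:
  shows "closure_dom halfline (h_dom \<sigma>) (h_form \<sigma>) =
      {u \<in> L2 halfline. G u \<in> closure_dom (weighted_line \<tau>) line_test laplace_form}"
    and "u \<in> L2 halfline \<Longrightarrow> v \<in> L2 halfline \<Longrightarrow> closure_form halfline (h_dom \<sigma>) (h_form \<sigma>) u v =
      closure_form (weighted_line \<tau>) line_test laplace_form (G u) (G v)"
proof -
  have qd: "h_form \<sigma> (\<lambda>x. u x - v x) (\<lambda>x. u x - v x) = laplace_form (\<lambda>y. G u y - G v y) (\<lambda>y. G u y - G v y)"
    if "u \<in> h_dom \<sigma>" "v \<in> h_dom \<sigma>" for u v
    using h_form_eq_laplace(2)[OF h_dom_diff[OF that] h_dom_diff[OF that]] by (simp add: G_diff)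
  note core = laplace_closure_core[OF test_functions_subset_G G_h_dom_subset]
  note t = closure_transport[where q="h_form \<sigma>" and q'=laplace_form, OF h_dom_L2]
  have 1: "closure_dom halfline (h_dom \<sigma>) (h_form \<sigma>) =
      {u \<in> L2 halfline. G u \<in> closure_dom (weighted_line \<tau>) (G ` h_dom \<sigma>) laplace_form}"
    by (rule t(1)) (rule qd h_form_eq_laplace(2); assumption)+
  show "closure_dom halfline (h_dom \<sigma>) (h_form \<sigma>) =
      {u \<in> L2 halfline. G u \<in> closure_dom (weighted_line \<tau>) line_test laplace_form}"
    unfolding 1 core(1) ..
  assume u: "u \<in> L2 halfline" and v: "v \<in> L2 halfline"
  have "closure_form halfline (h_dom \<sigma>) (h_form \<sigma>) u v =
      closure_form (weighted_line \<tau>) (G ` h_dom \<sigma>) laplace_form (G u) (G v)"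
    by (rule t(2)[OF _ _ u v]) (rule qd h_form_eq_laplace(2); assumption)+
  then show "closure_form halfline (h_dom \<sigma>) (h_form \<sigma>) u v =
      closure_form (weighted_line \<tau>) line_test laplace_form (G u) (G v)"
    by (simp add: core(2)[OF G_L2[OF u] G_L2[OF v]])
qed

theorem H_minus_neg_part_trace:
  assumes V: "V \<in> borel_measurable halfline"
  shows "neg_part_trace halfline (H_minus \<sigma> V) \<gamma> =
    neg_part_trace (weighted_line \<tau>) (line_model \<tau> (\<lambda>y. V (\<phi> y))) \<gamma>"
  unfolding H_minus_def line_model_def
proof (rule form_operator_neg_part_trace[OF G_H])
  have [measurable]: "V \<in> borel_measurable halfline" by (rule V)
  let ?N = "weighted_line \<tau>"
  let ?D = "closure_dom ?N line_test laplace_form"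
  let ?D' = "closure_dom halfline (h_dom \<sigma>) (h_form \<sigma>)"
  show "minus_potential_dom ?N ?D (\<lambda>y. V (\<phi> y)) \<subseteq> L2 ?N"
    by (auto simp: minus_potential_dom_def closure_dom_def)
  have i: "integrable halfline (\<lambda>x. \<bar>V x\<bar> * (cmod (u x))\<^sup>2) \<longleftrightarrow>
      integrable ?N (\<lambda>y. \<bar>V (\<phi> y)\<bar> * (cmod (G u y))\<^sup>2)" if "u \<in> L2 halfline" for u
    using G_weighted_integrable_norm[of "\<lambda>r. \<bar>V r\<bar>" u] L2_measurable[OF that] by simp
  show "minus_potential_dom halfline ?D' V = {u \<in> L2 halfline. G u \<in> minus_potential_dom ?N ?D (\<lambda>y. V (\<phi> y))}"
    unfolding minus_potential_dom_def h_closure(1) using i by auto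
  fix u v assume "u \<in> minus_potential_dom halfline ?D' V" "v \<in> minus_potential_dom halfline ?D' V"
  then have uv: "u \<in> L2 halfline" "v \<in> L2 halfline" by (auto simp: minus_potential_dom_def closure_dom_def)
  show "minus_potential_form halfline (closure_form halfline (h_dom \<sigma>) (h_form \<sigma>)) V u v =
      minus_potential_form ?N (closure_form ?N line_test laplace_form) (\<lambda>y. V (\<phi> y)) (G u) (G v)"
    unfolding minus_potential_form_def h_closure(2)[OF uv]
    using G_weighted_integral[of "\<lambda>r. complex_of_real (V r)" u v] uv[THEN L2_measurable] by simp
qed

end

lemma (in form_bounded_potential) potential_integrable:
  assumes g: "g \<in> line_test" and h: "h \<in> line_test"
  shows "integrable (weighted_line 2) (\<lambda>x. complex_of_real (Y x) * (g x * cnj (h x)))"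
proof -
  have i: "integrable P (\<lambda>x. complex_of_real (sgn (Y x)) * g x * cnj (h x))"
    by (intro L2_integrable_inner sgn_L2 test_P_L2 g h)
  then have "integrable (weighted_line 2) (\<lambda>x. \<bar>Y x\<bar> *\<^sub>R (complex_of_real (sgn (Y x)) * g x * cnj (h x)))"
    using integrable_P[of "\<lambda>x. complex_of_real (sgn (Y x)) * g x * cnj (h x)"]
      borel_measurable_integrable[OF i] by (simp only: borel_measurable_P)
  also have "(\<lambda>x. \<bar>Y x\<bar> *\<^sub>R (complex_of_real (sgn (Y x)) * g x * cnj (h x))) =
      (\<lambda>x. complex_of_real (Y x) * (g x * cnj (h x)))"
    by (rule ext) (simp add: scaleR_conv_of_real abs_sgn mult_ac flip: of_real_mult)
  finally show ?thesis .
qed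

interpretation hardy: log_unitary 1 0 0 2
  by unfold_locales simp_all

text \<open>For \<open>\<sigma> = 0\<close> the map \<open>G\<close> carries test functions exactly onto test functions, so the closure of the
  form including the potential is transported as it is; on the line it is the form sum.\<close>

lemma hardy_minus_neg_part_trace:
  assumes W: "W \<in> borel_measurable halfline" and Y: "form_bounded_potential (\<lambda>y. W (exp y)) K"
  shows "neg_part_trace halfline (hardy_minus W) \<gamma> =
    neg_part_trace (weighted_line 2) (line_model 2 (\<lambda>y. W (exp y))) \<gamma>"
proof -
  let ?N = "weighted_line 2"
  interpret form_bounded_potential "\<lambda>y. W (exp y)" K by (rule Y)
  have [measurable]: "W \<in> borel_measurable halfline" by (rule W)
  have phi: "hardy.\<phi> y = exp y" for y by (simp add: hardy.\<phi>_def)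
  have hd: "h_dom 0 = test_functions {0<..}" by (simp add: h_dom_def)
  have img: "hardy.G ` test_functions {0<..} = line_test"
    using hardy.G_test_functions hardy.test_functions_subset_G[unfolded hd] by blast
  have form: "hardy_form W u v = q (hardy.G u) (hardy.G v)"
    if u: "u \<in> test_functions {0<..}" and v: "v \<in> test_functions {0<..}" for u v
  proof -
    have u': "u \<in> h_dom 0" and v': "v \<in> h_dom 0" using u v hd by simp_all
    note um = h_dom_measurable[OF u'] and vm = h_dom_measurable[OF v']
    note wi = hardy.G_weighted_integrable[of "\<lambda>r. complex_of_real (W r)", OF _ um vm]
      hardy.G_weighted_integral[of "\<lambda>r. complex_of_real (W r)", OF _ um vm]
    have i2: "integrable halfline (\<lambda>r. complex_of_real (W r) * (u r * cnj (v r)))"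
      using wi(1) potential_integrable[OF hardy.G_test_functions[OF u] hardy.G_test_functions[OF v]] by (simp add: phi)
    note i1 = hardy.h_form_eq_laplace[OF u' v']
    have "hardy_form W u v = (\<integral>r. hardy.h_integrand u v r - complex_of_real (W r) * (u r * cnj (v r)) \<partial>halfline)"
      unfolding hardy_form_def
      by (intro Bochner_Integration.integral_cong refl) (simp add: hardy.h_integrand_def)
    also have "\<dots> = (\<integral>r. hardy.h_integrand u v r \<partial>halfline) - (\<integral>r. complex_of_real (W r) * (u r * cnj (v r)) \<partial>halfline)"
      by (rule Bochner_Integration.integral_diff[OF i1(1) i2])
    also have "(\<integral>r. hardy.h_integrand u v r \<partial>halfline) = laplace_form (hardy.G u) (hardy.G v)"
      unfolding i1(2)[symmetric] by (simp add: h_form_def hardy.h_integrand_def)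
    also have "(\<integral>r. complex_of_real (W r) * (u r * cnj (v r)) \<partial>halfline) =
        (\<integral>y. complex_of_real (W (exp y)) * (hardy.G u y * cnj (hardy.G v y)) \<partial>?N)"
      using wi(2) by (simp add: phi)
    finally show ?thesis by (simp add: minus_potential_form_def)
  qed
  have formd: "hardy_form W (\<lambda>x. u x - v x) (\<lambda>x. u x - v x) =
      q (\<lambda>y. hardy.G u y - hardy.G v y) (\<lambda>y. hardy.G u y - hardy.G v y)"
    if "u \<in> test_functions {0<..}" "v \<in> test_functions {0<..}" for u v
    using form[OF test_functions_diff_general[OF that] test_functions_diff_general[OF that]] by (simp add: hardy.G_diff)
  note t = hardy.closure_transport[where q="hardy_form W" and q'=q, OF hardy.h_dom_L2[unfolded hd]]
  have dom: "closure_dom halfline (test_functions {0<..}) (hardy_form W) =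
      {u \<in> L2 halfline. hardy.G u \<in> closure_dom ?N line_test q}"
    unfolding img[symmetric] by (rule t(1)) (rule form formd; assumption)+
  have cf: "closure_form halfline (test_functions {0<..}) (hardy_form W) u v = closure_form ?N line_test q (hardy.G u) (hardy.G v)"
    if "u \<in> L2 halfline" "v \<in> L2 halfline" for u v
    unfolding img[symmetric] by (rule t(2)[OF _ _ that]) (rule form formd; assumption)+
  have "neg_part_trace halfline (hardy_minus W) \<gamma> =
      neg_part_trace ?N (form_operator ?N (closure_dom ?N line_test q) (closure_form ?N line_test q)) \<gamma>"
    unfolding hardy_minus_def
  proof (rule hardy.form_operator_neg_part_trace[OF hardy.G_H _ dom])
    show "closure_dom ?N line_test q \<subseteq> L2 ?N" by (auto simp: closure_dom_def)
    fix u v assume "u \<in> closure_dom halfline (test_functions {0<..}) (hardy_form W)"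
      "v \<in> closure_dom halfline (test_functions {0<..}) (hardy_form W)"
    then show "closure_form halfline (test_functions {0<..}) (hardy_form W) u v =
        closure_form ?N line_test q (hardy.G u) (hardy.G v)"
      by (intro cf) (simp_all add: closure_dom_def)
  qed
  also have "form_operator ?N (closure_dom ?N line_test q) (closure_form ?N line_test q) =
      line_model 2 (\<lambda>y. W (exp y))"
    unfolding line_model_def
    by (rule form_operator_cong[OF closure_eq_form_sum(1) closure_eq_form_sum(2)]) (simp_all only: closure_eq_form_sum(1))
  finally show ?thesis .
qed

section \<open>Potentials in logarithmic coordinates\<close>

lemma indicator_halfline_subset:
  fixes f :: "real \<Rightarrow> real"
  assumes "K \<subseteq> {0<..}"
  shows "(\<lambda>x. indicator {0<..} x *\<^sub>R (indicator K x * f x)) = (\<lambda>x. indicator K x *\<^sub>R f x)"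
  using assms by (auto simp: indicator_def fun_eq_iff)

context log_subst
begin

lemma potential_on_phi:
  assumes V: "potential_on {0<..} V"
  shows "integrable lebesgue (\<lambda>y. indicator {-R..R} y * max (- V (\<phi> y)) 0)"
proof -
  have Vm: "V \<in> borel_measurable halfline" using V by (simp add: potential_on_def)
  define K where "K = \<phi> ` {-R..R}"
  have K: "compact K" "K \<subseteq> {0<..}"
    unfolding K_def \<phi>_def by (auto intro!: compact_continuous_image continuous_intros)
  have Kl: "K \<in> sets lebesgue" using lmeasurable_compact[OF K(1)] by (rule fmeasurableD)
  have "integrable (lebesgue_on K) (\<lambda>x. max (- V x) 0)" using V K by (simp add: potential_on_def)
  then have "integrable lebesgue (\<lambda>x. indicator K x *\<^sub>R max (- V x) 0)"
    using Kl by (subst (asm) integrable_restrict_space) auto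
  then have "integrable lebesgue (\<lambda>x. indicator {0<..} x *\<^sub>R (indicator K x * max (- V x) 0))"
    unfolding indicator_halfline_subset[OF K(2)] .
  then have i: "integrable halfline (\<lambda>x. indicator K x * max (- V x) 0)"
    by (subst integrable_restrict_space) auto
  have ind: "indicator K (\<phi> y) = (indicator {-R..R} y :: real)" for y
  proof -
    have "\<phi> y \<in> K \<longleftrightarrow> y \<in> {-R..R}"
      unfolding K_def by (rule inj_image_mem_iff[OF inj_phi])
    then show ?thesis by (simp only: indicator_def)
  qed
  have i': "integrable lebesgue (\<lambda>y. (\<bar>m\<bar> * \<phi> y) *\<^sub>R (indicator {-R..R} y * max (- V (\<phi> y)) 0))"
    using iffD1[OF integrable_halfline[OF borel_measurable_integrable[OF i]] i] by (simp only: ind)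
  define c where "c = \<bar>m\<bar> * exp (- (\<bar>m\<bar> * \<bar>R\<bar> + \<bar>d\<bar>))"
  have c: "0 < c" using m_nz by (simp add: c_def)
  have Ym: "(\<lambda>y. V (\<phi> y)) \<in> borel_measurable lebesgue" by (rule phi_comp_measurable[OF Vm])
  have [measurable]: "(\<lambda>x. indicator {-R..R} x :: real) \<in> borel_measurable lebesgue"
    by (intro borel_measurable_indicator) auto
  show ?thesis
  proof (rule Bochner_Integration.integrable_bound)
    show "integrable lebesgue (\<lambda>y. (1 / c) * ((\<bar>m\<bar> * \<phi> y) *\<^sub>R (indicator {-R..R} y * max (- V (\<phi> y)) 0)))"
      by (intro integrable_mult_right i')
    show "(\<lambda>y. indicator {-R..R} y * max (- V (\<phi> y)) 0) \<in> borel_measurable lebesgue" using Ym by measurable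
    show "AE y in lebesgue. norm (indicator {-R..R} y * max (- V (\<phi> y)) 0) \<le>
        norm ((1 / c) * ((\<bar>m\<bar> * \<phi> y) *\<^sub>R (indicator {-R..R} y * max (- V (\<phi> y)) 0)))"
    proof (rule AE_I2)
      fix y
      show "norm (indicator {-R..R} y * max (- V (\<phi> y)) 0) \<le>
        norm ((1 / c) * ((\<bar>m\<bar> * \<phi> y) *\<^sub>R (indicator {-R..R} y * max (- V (\<phi> y)) 0)))"
      proof (cases "y \<in> {-R..R}")
        case True
        have "\<bar>m * y\<bar> \<le> \<bar>m\<bar> * \<bar>R\<bar>" unfolding abs_mult using True by (intro mult_left_mono) auto
        then have "- (\<bar>m\<bar> * \<bar>R\<bar> + \<bar>d\<bar>) \<le> m * y + d" by linarith
        then have "c \<le> \<bar>m\<bar> * \<phi> y" unfolding c_def \<phi>_def by (intro mult_left_mono) auto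
        then have "1 \<le> (1 / c) * (\<bar>m\<bar> * \<phi> y)" using c by (simp add: field_simps)
        from mult_right_mono[OF this, of "max (- V (\<phi> y)) 0"]
        have "max (- V (\<phi> y)) 0 \<le> (1 / c) * (\<bar>m\<bar> * \<phi> y) * max (- V (\<phi> y)) 0" by simp
        then have "max (- V (\<phi> y)) 0 \<le> \<bar>(1 / c) * (\<bar>m\<bar> * \<phi> y) * max (- V (\<phi> y)) 0\<bar>" by linarith
        then show ?thesis using True by simp
      qed simp
    qed
  qed
qed

lemma potential_onI_phi:
  assumes Wm: "W \<in> borel_measurable halfline"
    and loc: "\<And>R. integrable lebesgue (\<lambda>y. indicator {-R..R} y * max (- W (\<phi> y)) 0)"
  shows "potential_on {0<..} W"
  unfolding potential_on_def
proof (intro conjI allI impI)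
  show "W \<in> borel_measurable halfline" by (rule Wm)
  fix K :: "real set" assume "compact K \<and> K \<subseteq> {0<..}"
  then have K: "compact K" "K \<subseteq> {0<..}" by auto
  have "continuous_on K \<psi>" unfolding \<psi>_def using K(2) m_nz by (intro continuous_intros) auto
  from compact_imp_bounded[OF compact_continuous_image[OF this K(1)]]
  obtain R where R: "\<forall>y\<in>\<psi> ` K. norm y \<le> R" unfolding bounded_iff by blast
  have inR: "\<bar>y\<bar> \<le> R" if "\<phi> y \<in> K" for y
    using bspec[OF R imageI[OF that, of \<psi>]] by simp
  define C where "C = \<bar>m\<bar> * exp (\<bar>m\<bar> * R + \<bar>d\<bar>)"
  have Kl: "K \<in> sets lebesgue" using lmeasurable_compact[OF K(1)] by (rule fmeasurableD)
  have Ks: "K \<in> sets halfline" using K Kl by (auto simp: sets_halfline)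
  have fm: "(\<lambda>x. indicator K x * max (- W x) 0) \<in> borel_measurable halfline" using Wm Ks by measurable
  have i: "integrable lebesgue (\<lambda>y. (\<bar>m\<bar> * \<phi> y) *\<^sub>R (indicator K (\<phi> y) * max (- W (\<phi> y)) 0))"
  proof (rule Bochner_Integration.integrable_bound)
    show "integrable lebesgue (\<lambda>y. C * (indicator {-R..R} y * max (- W (\<phi> y)) 0))" by (intro integrable_mult_right loc)
    show "(\<lambda>y. (\<bar>m\<bar> * \<phi> y) *\<^sub>R (indicator K (\<phi> y) * max (- W (\<phi> y)) 0)) \<in> borel_measurable lebesgue"
      using phi_comp_measurable[OF fm] by measurable
    show "AE y in lebesgue. norm ((\<bar>m\<bar> * \<phi> y) *\<^sub>R (indicator K (\<phi> y) * max (- W (\<phi> y)) 0)) \<le>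
        norm (C * (indicator {-R..R} y * max (- W (\<phi> y)) 0))"
    proof (rule AE_I2)
      fix y
      show "norm ((\<bar>m\<bar> * \<phi> y) *\<^sub>R (indicator K (\<phi> y) * max (- W (\<phi> y)) 0)) \<le>
        norm (C * (indicator {-R..R} y * max (- W (\<phi> y)) 0))"
      proof (cases "\<phi> y \<in> K")
        case True
        note y = inR[OF True]
        have "\<bar>m * y\<bar> \<le> \<bar>m\<bar> * R" unfolding abs_mult using y by (intro mult_left_mono) auto
        then have "m * y + d \<le> \<bar>m\<bar> * R + \<bar>d\<bar>" by linarith
        then have "\<bar>m\<bar> * \<phi> y \<le> C" unfolding C_def \<phi>_def by (intro mult_left_mono) auto
        from mult_right_mono[OF this, of "max (- W (\<phi> y)) 0"]
        have "\<bar>m\<bar> * \<phi> y * max (- W (\<phi> y)) 0 \<le> C * max (- W (\<phi> y)) 0" by simp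
        moreover have "0 \<le> \<bar>m\<bar> * \<phi> y * max (- W (\<phi> y)) 0" by (intro mult_nonneg_nonneg) (auto intro: less_imp_le)
        moreover have "y \<in> {-R..R}" using y by auto
        moreover have "0 \<le> C" by (simp add: C_def)
        ultimately show ?thesis using True by (simp add: abs_mult abs_of_pos[OF phi_pos])
      qed simp
    qed
  qed
  have "integrable halfline (\<lambda>x. indicator K x * max (- W x) 0)"
    unfolding integrable_halfline[OF fm] by (rule i)
  then have "integrable lebesgue (\<lambda>x. indicator {0<..} x *\<^sub>R (indicator K x * max (- W x) 0))"
    by (subst (asm) integrable_restrict_space) auto
  then have "integrable lebesgue (\<lambda>x. indicator K x *\<^sub>R max (- W x) 0)"
    unfolding indicator_halfline_subset[OF K(2)] .
  then show "integrable (lebesgue_on K) (\<lambda>x. max (- W x) 0)"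
    using Kl by (subst integrable_restrict_space) auto
qed

end

section \<open>The two inequalities\<close>

lemma weighted_line_0: "weighted_line 0 = lebesgue"
  unfolding weighted_line_def by (simp add: density_1)

lemma line_model_0: "line_model 0 Y = line_minus Y"
  by (simp add: line_model_def line_minus_def weighted_line_0)

text \<open>Local integrability is assumed of the negative part only; for the positive part it follows from
  the finite integral, because \<open>y \<le> 1 + y powr p\<close>.\<close>

lemma local_integrable_abs:
  fixes Y :: "real \<Rightarrow> real"
  assumes Ym: "Y \<in> borel_measurable lebesgue" and p: "1 \<le> p"
    and neg: "\<And>R. integrable lebesgue (\<lambda>y. indicator {-R..R} y * max (- Y y) 0)"
    and Z: "integrable lebesgue (\<lambda>y. max (Y y) 0 powr p * exp (b * y))"
  shows "integrable lebesgue (\<lambda>y. indicator {-R..R} y * \<bar>Y y\<bar>)"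
proof (rule Bochner_Integration.integrable_bound)
  let ?h = "\<lambda>y. indicator {-R..R} y * max (- Y y) 0 + indicator {-R..R} y +
    exp (\<bar>b\<bar> * R) * (max (Y y) 0 powr p * exp (b * y))"
  have "integrable lebesgue (indicator {-R..R} :: real \<Rightarrow> real)"
    by (intro integrable_real_indicator) (auto simp: emeasure_lborel_Icc_eq)
  then show "integrable lebesgue ?h"
    by (intro Bochner_Integration.integrable_add neg integrable_mult_right Z)
  have "(\<lambda>x. indicator {-R..R} x :: real) \<in> borel_measurable lebesgue"
    by (intro borel_measurable_indicator) auto
  then show "(\<lambda>y. indicator {-R..R} y * \<bar>Y y\<bar>) \<in> borel_measurable lebesgue" using Ym by measurable
  show "AE y in lebesgue. norm (indicator {-R..R} y * \<bar>Y y\<bar>) \<le> norm (?h y)"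
  proof (rule AE_I2)
    fix y
    show "norm (indicator {-R..R} y * \<bar>Y y\<bar>) \<le> norm (?h y)"
    proof (cases "y \<in> {-R..R}")
      case True
      have "max (Y y) 0 \<le> 1 + max (Y y) 0 powr p"
      proof (cases "1 \<le> Y y")
        case True
        then have "Y y powr 1 \<le> Y y powr p" using p by (intro powr_mono) auto
        then show ?thesis using True by simp
      next
        case False
        then have "max (Y y) 0 \<le> 1" by simp
        then show ?thesis using powr_ge_zero[of "max (Y y) 0" p] by linarith
      qed
      moreover have "1 * max (Y y) 0 powr p \<le> (exp (\<bar>b\<bar> * R) * exp (b * y)) * max (Y y) 0 powr p"
      proof (rule mult_right_mono)
        have "\<bar>b * y\<bar> \<le> \<bar>b\<bar> * R" unfolding abs_mult using True by (intro mult_left_mono) auto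
        then have "0 \<le> \<bar>b\<bar> * R + b * y" by linarith
        then show "1 \<le> exp (\<bar>b\<bar> * R) * exp (b * y)" by (simp flip: exp_add)
      qed simp
      moreover have "\<bar>Y y\<bar> = max (Y y) 0 + max (- Y y) 0" by (simp add: max_def abs_if)
      ultimately have le: "\<bar>Y y\<bar> \<le> ?h y" using True by (simp add: mult_ac)
      have "\<bar>Y y\<bar> \<le> \<bar>?h y\<bar>" using le by (rule order_trans) (rule abs_ge_self)
      then show ?thesis using True by simp
    qed simp
  qed
qed

text \<open>The weight is \<open>exp (2 * y)\<close> if \<open>(2 - \<sigma>) * m = 2\<close> and \<open>exp ((2 - \<sigma>) * d) = 1 / m\<^sup>2\<close>; this determines \<open>m\<close>
  and \<open>d\<close>. The potential of the Hardy operator is \<open>W r = V (exp d * r powr m)\<close>.\<close>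

lemma neg_part_trace_H_minus_le:
  fixes \<gamma> \<sigma> \<alpha> C :: real and V :: "real \<Rightarrow> real"
  assumes \<gamma>: "0 < \<gamma>" and \<sigma>: "\<sigma> \<noteq> 2"
    and a: "a = (2 * \<alpha> + \<sigma>) / (2 - \<sigma>)" "0 \<le> a"
    and p: "p = \<gamma> + (1 + \<alpha>) / (2 - \<sigma>)" "1 \<le> p"
    and C: "hardy_LT_constant \<gamma> a C" and V: "potential_on {0<..} V"
    and fin: "(\<integral>\<^sup>+r. ennreal (max (V r) 0 powr p * r powr \<alpha>) \<partial>halfline) < \<infinity>"
  shows "neg_part_trace halfline (H_minus \<sigma> V) \<gamma> \<le>
    ennreal (\<bar>2 / (2 - \<sigma>)\<bar> powr a * C) * (\<integral>\<^sup>+r. ennreal (max (V r) 0 powr p * r powr \<alpha>) \<partial>halfline)"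
proof -
  define m where "m = 2 / (2 - \<sigma>)"
  define d where "d = - m * ln \<bar>m\<bar>"
  have m: "m \<noteq> 0" "2 - \<sigma> = 2 / m" using \<sigma> by (simp_all add: m_def)
  interpret U: log_unitary m d \<sigma> 2
  proof
    show "m \<noteq> 0" by (rule m)
    fix y
    have "(2 - \<sigma>) * (m * y + d) = 2 * y + 2 * (- ln \<bar>m\<bar>)"
      unfolding m(2) d_def using m(1) by (simp add: field_simps)
    then have "exp ((2 - \<sigma>) * (m * y + d)) = exp (2 * y) * (exp (- ln \<bar>m\<bar>))\<^sup>2"
      by (simp only: exp_add exp_double)
    also have "exp (- ln \<bar>m\<bar>) = 1 / \<bar>m\<bar>" using m(1) by (simp add: exp_minus inverse_eq_divide)
    finally show "m\<^sup>2 * exp ((2 - \<sigma>) * (m * y + d)) = exp (2 * y)"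
      using m(1) by (simp add: power_divide)
  qed
  have p': "p = \<gamma> + (1 + a) / 2"
    unfolding p(1) a(1) using \<sigma> by (simp add: field_simps)
  have Vm: "V \<in> borel_measurable halfline" using V by (simp add: potential_on_def)
  define Y where "Y = (\<lambda>y. V (U.\<phi> y))"
  define W where "W = (\<lambda>r. Y (ln r))"
  have Ym: "Y \<in> borel_measurable lebesgue" unfolding Y_def by (rule U.phi_comp_measurable[OF Vm])
  have phi: "hardy.\<phi> y = exp y" and psi: "hardy.\<psi> r = ln r" for y r
    by (simp_all add: hardy.\<phi>_def hardy.\<psi>_def)
  have WY: "W (exp y) = Y y" for y by (simp add: W_def)
  have Wm: "W \<in> borel_measurable halfline"
    using hardy.psi_comp_measurable[OF Ym] by (simp add: psi W_def)
  have neg: "integrable lebesgue (\<lambda>y. indicator {-R..R} y * max (- Y y) 0)" for R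
    unfolding Y_def by (rule U.potential_on_phi[OF V])
  have Wpot: "potential_on {0<..} W"
    by (rule hardy.potential_onI_phi[OF Wm]) (simp add: phi WY neg)
  let ?Z = "\<lambda>y. max (Y y) 0 powr p * exp ((a + 1) * y)"
  have Zm: "?Z \<in> borel_measurable lebesgue" using Ym by measurable
  have rm: "(\<lambda>r. r) \<in> borel_measurable halfline"
    using id_borel_measurable_lebesgue_on[of "{0<..}"] by (simp add: id_def)
  have IW: "(\<integral>\<^sup>+r. ennreal (max (W r) 0 powr (\<gamma> + (1 + a) / 2) * r powr a) \<partial>halfline) = (\<integral>\<^sup>+y. ennreal (?Z y) \<partial>lebesgue)"
  proof -
    have "(\<lambda>r. ennreal (max (W r) 0 powr p * r powr a)) \<in> borel_measurable halfline" using Wm rm by measurable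
    from hardy.nn_integral_halfline[OF this]
    have "(\<integral>\<^sup>+r. ennreal (max (W r) 0 powr p * r powr a) \<partial>halfline) =
        (\<integral>\<^sup>+y. ennreal (exp y) * ennreal (max (Y y) 0 powr p * exp y powr a) \<partial>lebesgue)"
      by (simp add: phi WY)
    also have "\<dots> = (\<integral>\<^sup>+y. ennreal (?Z y) \<partial>lebesgue)"
    proof (rule nn_integral_cong)
      fix y :: real
      have "exp y * exp y powr a = exp ((a + 1) * y)" by (simp add: powr_def distrib_right flip: exp_add)
      then have "exp y * (max (Y y) 0 powr p * exp y powr a) = ?Z y" by (simp add: mult_ac)
      then show "ennreal (exp y) * ennreal (max (Y y) 0 powr p * exp y powr a) = ennreal (?Z y)"
        by (simp flip: ennreal_mult)
    qed
    finally show ?thesis by (simp only: p')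
  qed
  have IV: "(\<integral>\<^sup>+y. ennreal (?Z y) \<partial>lebesgue) =
      ennreal (\<bar>m\<bar> powr a) * (\<integral>\<^sup>+r. ennreal (max (V r) 0 powr p * r powr \<alpha>) \<partial>halfline)"
  proof -
    have Fm: "(\<lambda>r. ennreal (max (V r) 0 powr p * r powr \<alpha>)) \<in> borel_measurable halfline" using Vm rm by measurable
    have e: "\<bar>m\<bar> powr a * (\<bar>m\<bar> * U.\<phi> y * U.\<phi> y powr \<alpha>) = exp ((a + 1) * y)" for y
    proof -
      have am: "a + 1 = (\<alpha> + 1) * m"
        unfolding a(1) m_def using \<sigma> by (simp add: field_simps)
      have "U.\<phi> y * U.\<phi> y powr \<alpha> = exp ((\<alpha> + 1) * (m * y + d))"
        by (simp add: U.\<phi>_def powr_def algebra_simps flip: exp_add)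
      also have "(\<alpha> + 1) * (m * y + d) = (a + 1) * y - (a + 1) * ln \<bar>m\<bar>"
        unfolding am d_def by (simp add: algebra_simps)
      also have "exp \<dots> = exp ((a + 1) * y) / \<bar>m\<bar> powr (a + 1)"
        using m(1) by (simp add: exp_diff powr_def)
      finally have "\<bar>m\<bar> powr a * (\<bar>m\<bar> * U.\<phi> y * U.\<phi> y powr \<alpha>) =
          (\<bar>m\<bar> powr a * \<bar>m\<bar>) * (exp ((a + 1) * y) / \<bar>m\<bar> powr (a + 1))" by (simp add: mult.assoc)
      also have "\<bar>m\<bar> powr a * \<bar>m\<bar> = \<bar>m\<bar> powr (a + 1)" using m(1) by (simp add: powr_add)
      finally show ?thesis using m(1) by simp
    qed
    have "ennreal (\<bar>m\<bar> powr a) * (\<integral>\<^sup>+r. ennreal (max (V r) 0 powr p * r powr \<alpha>) \<partial>halfline) =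
        (\<integral>\<^sup>+y. ennreal (\<bar>m\<bar> powr a) * (ennreal (\<bar>m\<bar> * U.\<phi> y) * ennreal (max (Y y) 0 powr p * U.\<phi> y powr \<alpha>)) \<partial>lebesgue)"
      unfolding U.nn_integral_halfline[OF Fm]
      by (subst nn_integral_cmult) (use Ym U.phi_borel in \<open>simp_all add: Y_def\<close>)
    also have "\<dots> = (\<integral>\<^sup>+y. ennreal (?Z y) \<partial>lebesgue)"
    proof (rule nn_integral_cong)
      fix y
      have "ennreal (\<bar>m\<bar> powr a) * (ennreal (\<bar>m\<bar> * U.\<phi> y) * ennreal (max (Y y) 0 powr p * U.\<phi> y powr \<alpha>)) =
          ennreal (max (Y y) 0 powr p * (\<bar>m\<bar> powr a * (\<bar>m\<bar> * U.\<phi> y * U.\<phi> y powr \<alpha>)))"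
        by (simp add: mult_ac less_imp_le[OF U.phi_pos] flip: ennreal_mult)
      then show "ennreal (\<bar>m\<bar> powr a) * (ennreal (\<bar>m\<bar> * U.\<phi> y) * ennreal (max (Y y) 0 powr p * U.\<phi> y powr \<alpha>)) = ennreal (?Z y)"
        by (simp only: e)
    qed
    finally show ?thesis by simp
  qed
  have Zfin: "(\<integral>\<^sup>+y. ennreal (?Z y) \<partial>lebesgue) < \<infinity>"
    unfolding IV using fin by (simp add: ennreal_mult_less_top)
  have Zi: "integrable lebesgue ?Z"
    by (rule integrableI_bounded[OF Zm]) (use Zfin in simp)
  obtain K where K: "0 \<le> K" "\<forall>g\<in>line_test.
    integrable (weighted_line 2) (\<lambda>x. max (Y x) 0 * (cmod (g x))\<^sup>2) \<and>
    (\<integral>x. max (Y x) 0 * (cmod (g x))\<^sup>2 \<partial>weighted_line 2) \<le>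
      1 / 2 * (L2_norm lebesgue (vderiv g))\<^sup>2 + K * (L2_norm (weighted_line 2) g)\<^sup>2"
    using potential_form_bound[OF Ym \<gamma> a(2) p' p(2) Zi] by blast
  have fb: "form_bounded_potential (\<lambda>y. W (exp y)) K"
    unfolding WY
  proof
    show "Y \<in> borel_measurable lebesgue" by (rule Ym)
    show "integrable lebesgue (\<lambda>x. indicator {-R..R} x * \<bar>Y x\<bar>)" for R
      by (rule local_integrable_abs[OF Ym p(2) neg Zi])
  qed (use K in auto)
  have "neg_part_trace halfline (H_minus \<sigma> V) \<gamma> = neg_part_trace (weighted_line 2) (line_model 2 Y) \<gamma>"
    unfolding Y_def by (rule U.H_minus_neg_part_trace[OF Vm])
  also have "\<dots> = neg_part_trace halfline (hardy_minus W) \<gamma>"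
    using hardy_minus_neg_part_trace[OF Wm fb, of \<gamma>] by (simp add: WY)
  also have "\<dots> \<le> ennreal C * (\<integral>\<^sup>+r. ennreal (max (W r) 0 powr (\<gamma> + (1 + a) / 2) * r powr a) \<partial>halfline)"
    using C Wpot Zfin unfolding hardy_LT_constant_def IW[symmetric] by blast
  also have "\<dots> = ennreal (\<bar>m\<bar> powr a * C) * (\<integral>\<^sup>+r. ennreal (max (V r) 0 powr p * r powr \<alpha>) \<partial>halfline)"
    using C unfolding IW IV by (simp add: hardy_LT_constant_def ennreal_mult mult_ac)
  finally show ?thesis unfolding m_def .
qed

interpretation critical: log_unitary 1 0 2 0
  by unfold_locales simp_all

lemma neg_part_trace_H_minus_2_le:
  fixes \<gamma> \<alpha> C :: real and V :: "real \<Rightarrow> real"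
  assumes C: "EK_constant \<gamma> \<alpha> C" and V: "potential_on {0<..} V"
    and fin: "(\<integral>\<^sup>+r. ennreal (max (V r) 0 powr (\<gamma> + (1 + \<alpha>) / 2) * \<bar>ln r\<bar> powr \<alpha> * r powr (- 1)) \<partial>halfline) < \<infinity>"
  shows "neg_part_trace halfline (H_minus 2 V) \<gamma> \<le> ennreal C *
    (\<integral>\<^sup>+r. ennreal (max (V r) 0 powr (\<gamma> + (1 + \<alpha>) / 2) * \<bar>ln r\<bar> powr \<alpha> * r powr (- 1)) \<partial>halfline)"
proof -
  have Vm: "V \<in> borel_measurable halfline" using V by (simp add: potential_on_def)
  define Y where "Y = (\<lambda>y. V (hardy.\<phi> y))"
  have phi: "hardy.\<phi> y = exp y" for y by (simp add: hardy.\<phi>_def)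
  have Ym: "Y \<in> borel_measurable lebesgue" unfolding Y_def by (rule hardy.phi_comp_measurable[OF Vm])
  have Ypot: "potential_on UNIV Y"
    unfolding potential_on_def
  proof (intro conjI allI impI)
    show "Y \<in> borel_measurable (lebesgue_on UNIV)" using Ym by simp
    fix K :: "real set" assume "compact K \<and> K \<subseteq> UNIV"
    then have K: "compact K" by simp
    have Kl: "K \<in> sets lebesgue" using lmeasurable_compact[OF K] by (rule fmeasurableD)
    from compact_imp_bounded[OF K] obtain R where R: "\<forall>y\<in>K. norm y \<le> R" unfolding bounded_iff by blast
    have "integrable lebesgue (\<lambda>y. indicator K y *\<^sub>R (indicator {-R..R} y * max (- Y y) 0))"
      unfolding Y_def by (intro integrable_mult_indicator Kl hardy.potential_on_phi[OF V])
    also have "(\<lambda>y. indicator K y *\<^sub>R (indicator {-R..R} y * max (- Y y) 0)) = (\<lambda>y. indicator K y *\<^sub>R max (- Y y) 0)"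
      using R by (auto simp: indicator_def fun_eq_iff abs_le_iff)
    finally show "integrable (lebesgue_on K) (\<lambda>x. max (- Y x) 0)"
      using Kl by (subst integrable_restrict_space) auto
  qed
  have rm: "(\<lambda>r. r) \<in> borel_measurable halfline"
    using id_borel_measurable_lebesgue_on[of "{0<..}"] by (simp add: id_def)
  have lm: "(\<lambda>r. ln r) \<in> borel_measurable halfline"
    using hardy.psi_comp_measurable[of "\<lambda>y. y"] id_borel_measurable_lebesgue by (simp add: hardy.\<psi>_def id_def)
  have I: "(\<integral>\<^sup>+r. ennreal (max (V r) 0 powr (\<gamma> + (1 + \<alpha>) / 2) * \<bar>ln r\<bar> powr \<alpha> * r powr (- 1)) \<partial>halfline) =
      (\<integral>\<^sup>+x. ennreal (max (Y x) 0 powr (\<gamma> + (1 + \<alpha>) / 2) * \<bar>x\<bar> powr \<alpha>) \<partial>lebesgue)"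
  proof -
    have "(\<lambda>r. ennreal (max (V r) 0 powr (\<gamma> + (1 + \<alpha>) / 2) * \<bar>ln r\<bar> powr \<alpha> * r powr (- 1))) \<in> borel_measurable halfline"
      using Vm rm lm by measurable
    from hardy.nn_integral_halfline[OF this] show ?thesis
      by (simp add: phi Y_def powr_minus field_simps flip: ennreal_mult')
  qed
  have "neg_part_trace halfline (H_minus 2 V) \<gamma> = neg_part_trace lebesgue (line_minus Y) \<gamma>"
    using critical.H_minus_neg_part_trace[OF Vm, of \<gamma>] by (simp add: line_model_0 weighted_line_0 Y_def)
  also have "\<dots> \<le> ennreal C * (\<integral>\<^sup>+x. ennreal (max (Y x) 0 powr (\<gamma> + (1 + \<alpha>) / 2) * \<bar>x\<bar> powr \<alpha>) \<partial>lebesgue)"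
    using C Ypot fin unfolding EK_constant_def I by blast
  finally show ?thesis unfolding I .
qed

theorem theorem5p1:
  fixes \<gamma> :: real
  assumes "\<gamma> > 0"
  shows "(\<forall>(\<sigma>::real) (\<alpha>::real) (C::real) (V::real \<Rightarrow> real).
            (\<sigma> > 2 \<and> \<gamma> > 0 \<and> \<alpha> \<le> - \<sigma> / 2 \<and> \<gamma> - (1 + \<alpha>) / (\<sigma> - 2) \<ge> 1 \<or>
             \<sigma> < 2 \<and> \<gamma> > 0 \<and> \<alpha> \<ge> - \<sigma> / 2 \<and> \<gamma> + (1 + \<alpha>) / (2 - \<sigma>) \<ge> 1) \<longrightarrow>
            hardy_LT_constant \<gamma> ((2 * \<alpha> + \<sigma>) / (2 - \<sigma>)) C \<longrightarrow>
            potential_on {0<..} V \<longrightarrow>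
            (\<integral>\<^sup>+r. ennreal (max (V r) 0 powr (\<gamma> + (1 + \<alpha>) / (2 - \<sigma>)) * r powr \<alpha>) \<partial>halfline) < \<infinity> \<longrightarrow>
            neg_part_trace halfline (H_minus \<sigma> V) \<gamma>
              \<le> ennreal (\<bar>2 / (2 - \<sigma>)\<bar> powr ((2 * \<alpha> + \<sigma>) / (2 - \<sigma>)) * C) *
                (\<integral>\<^sup>+r. ennreal (max (V r) 0 powr (\<gamma> + (1 + \<alpha>) / (2 - \<sigma>)) * r powr \<alpha>) \<partial>halfline)) \<and>
         (\<forall>(\<alpha>::real) (C::real) (V::real \<Rightarrow> real).
            (\<gamma> \<ge> 1 / 2 \<and> \<alpha> = 0 \<or> \<gamma> > 0 \<and> \<alpha> > 0 \<and> \<gamma> + (1 + \<alpha>) / 2 \<ge> 1 + \<alpha>) \<longrightarrow>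
            EK_constant \<gamma> \<alpha> C \<longrightarrow>
            potential_on {0<..} V \<longrightarrow>
            (\<integral>\<^sup>+r. ennreal (max (V r) 0 powr (\<gamma> + (1 + \<alpha>) / 2) * \<bar>ln r\<bar> powr \<alpha> * r powr (- 1)) \<partial>halfline) < \<infinity> \<longrightarrow>
            neg_part_trace halfline (H_minus 2 V) \<gamma>
              \<le> ennreal C *
                (\<integral>\<^sup>+r. ennreal (max (V r) 0 powr (\<gamma> + (1 + \<alpha>) / 2) * \<bar>ln r\<bar> powr \<alpha> * r powr (- 1)) \<partial>halfline))"
proof (rule conjI; intro allI impI)
  fix \<sigma> \<alpha> C :: real and V :: "real \<Rightarrow> real"
  assume cond: "\<sigma> > 2 \<and> \<gamma> > 0 \<and> \<alpha> \<le> - \<sigma> / 2 \<and> \<gamma> - (1 + \<alpha>) / (\<sigma> - 2) \<ge> 1 \<or>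
      \<sigma> < 2 \<and> \<gamma> > 0 \<and> \<alpha> \<ge> - \<sigma> / 2 \<and> \<gamma> + (1 + \<alpha>) / (2 - \<sigma>) \<ge> 1"
    and C: "hardy_LT_constant \<gamma> ((2 * \<alpha> + \<sigma>) / (2 - \<sigma>)) C" and V: "potential_on {0<..} V"
    and fin: "(\<integral>\<^sup>+r. ennreal (max (V r) 0 powr (\<gamma> + (1 + \<alpha>) / (2 - \<sigma>)) * r powr \<alpha>) \<partial>halfline) < \<infinity>"
  have flip: "(1 + \<alpha>) / (2 - \<sigma>) = - ((1 + \<alpha>) / (\<sigma> - 2))" for \<sigma> :: real
    using minus_divide_right[of "1 + \<alpha>" "\<sigma> - 2"] by simp
  have \<sigma>: "\<sigma> \<noteq> 2" using cond by auto
  have a: "0 \<le> (2 * \<alpha> + \<sigma>) / (2 - \<sigma>)"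
    using cond by (auto simp: zero_le_divide_iff)
  have p: "1 \<le> \<gamma> + (1 + \<alpha>) / (2 - \<sigma>)" using cond flip[of \<sigma>] by auto
  show "neg_part_trace halfline (H_minus \<sigma> V) \<gamma>
      \<le> ennreal (\<bar>2 / (2 - \<sigma>)\<bar> powr ((2 * \<alpha> + \<sigma>) / (2 - \<sigma>)) * C) *
        (\<integral>\<^sup>+r. ennreal (max (V r) 0 powr (\<gamma> + (1 + \<alpha>) / (2 - \<sigma>)) * r powr \<alpha>) \<partial>halfline)"
    by (rule neg_part_trace_H_minus_le[OF assms \<sigma> refl a refl p C V fin])
next
  fix \<alpha> C :: real and V :: "real \<Rightarrow> real"
  assume "EK_constant \<gamma> \<alpha> C" "potential_on {0<..} V"
    "(\<integral>\<^sup>+r. ennreal (max (V r) 0 powr (\<gamma> + (1 + \<alpha>) / 2) * \<bar>ln r\<bar> powr \<alpha> * r powr (- 1)) \<partial>halfline) < \<infinity>"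
  then show "neg_part_trace halfline (H_minus 2 V) \<gamma>
      \<le> ennreal C *
        (\<integral>\<^sup>+r. ennreal (max (V r) 0 powr (\<gamma> + (1 + \<alpha>) / 2) * \<bar>ln r\<bar> powr \<alpha> * r powr (- 1)) \<partial>halfline)"
    by (rule neg_part_trace_H_minus_2_le)
qed

end
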